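(* Let $n\ge 4$ and $d\ge 1$ be integers, let $\mathfrak g=\mathfrak{so}_{2n}(\mathbb C)$ with natural representation $V=\mathbb C^{2n}$, and let $M$ be a highest weight $\mathfrak g$-module. Put $\Xi_M=(a_k(M))_{k\ge 0}$, where the complex numbers $a_k(M)$ are determined by $e_1y_1^ke_1=a_k(M)e_1$ in $\operatorname{End}_{\mathfrak g}(M\otimes V\otimes V)$. Then sending the generators $s_i,e_i$ ($1\le i\le d-1$) and $y_j$ ($1\le j\le d$) of the affine VW-algebra $\mathrm{VW}_d(\Xi_M)$ to the $\mathfrak g$-endomorphisms of $M\otimes V^{\otimes d}$ with the same names gives a well-defined right action of $\mathrm{VW}_d(\Xi_M)$ on $M\otimes V^{\otimes d}$; in particular it defines an algebra homomorphism $$\Psi_M:\ \mathrm{VW}_d(\Xi_M)\longrightarrow \operatorname{End}_{\mathfrak g}(M\otimes V^{\otimes d})^{\mathrm{opp}}.$$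
   Context: **Affine VW-algebra.** For $d\ge1$ and complex parameters $\Xi=(w_k)_{k\ge0}$, $\mathrm{VW}_d(\Xi)$ is the unital $\mathbb C$-algebra with generators $s_i,e_i$ ($1\le i\le d-1$), $y_j$ ($1\le j\le d$) and relations, for $1\le a,b\le d-1$, $1\le c<d-1$, $1\le i,j\le d$: $s_a^2=1$; $s_as_b=s_bs_a$ for $|a-b|>1$; $s_cs_{c+1}s_c=s_{c+1}s_cs_{c+1}$; $s_ay_i=y_is_a$ for $i\notin\{a,a+1\}$; $e_a^2=w_0e_a$; $e_1y_1^ke_1=w_ke_1$ for all $k\ge0$; $s_ae_b=e_bs_a$ and $e_ae_b=e_be_a$ for $|a-b|>1$; $e_ay_i=y_ie_a$ for $i\notin\{a,a+1\}$; $y_iy_j=y_jy_i$; $e_as_a=e_a=s_ae_a$; $s_ce_{c+1}e_c=s_{c+1}e_c$, $e_ce_{c+1}s_c=e_cs_{c+1}$; $e_{c+1}e_cs_{c+1}=e_{c+1}s_c$, $s_{c+1}e_ce_{c+1}=s_ce_{c+1}$; $e_{c+1}e_ce_{c+1}=e_{c+1}$, $e_ce_{c+1}e_c=e_c$; $s_ay_a-y_{a+1}s_a=e_a-1$, $y_as_a-s_ay_{a+1}=e_a-1$; $e_a(y_a+y_{a+1})=0=(y_a+y_{a+1})e_a$. **Lie algebra.** $V$ has basis $\{v_i\mid i\in\{\pm1,\dots,\pm n\}\}$ and symmetric bilinear form $\langle v_k,v_l\rangle=\delta_{k,-l}$; $\mathfrak g$ is the Lie algebra of $A\in\mathfrak{gl}(V)$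 with $\langle Av,w\rangle+\langle v,Aw\rangle=0$. Put $v_i^*=v_{-i}$. The Cartan subalgebra $\mathfrak h$ consists of the diagonal matrices, $v_i$ has weight $\epsilon_i$ and $v_{-i}$ weight $-\epsilon_i$ ($1\le i\le n$); positive roots are $\epsilon_i\pm\epsilon_j$, $i>j$, spanning $\mathfrak n^+$. A highest weight module is a $\mathfrak g$-module generated by a non-zero vector $m$ with $\mathfrak n^+m=0$ and $\mathfrak hm\subseteq\mathbb Cm$. **Endomorphisms.** $\tau,\sigma\in\operatorname{End}(V\otimes V)$ are $\tau(v\otimes w)=\langle v,w\rangle\sum_iv_i\otimes v_i^*$ and $\sigma(v\otimes w)=w\otimes v$. On $M\otimes V^{\otimes d}$ (with $M$ in position $0$ and the copies of $V$ in positions $1,\dots,d$), $e_i$ and $s_i$ act by $\tau$, respectively $\sigma$, on positions $i,i+1$ and by the identity elsewhere. Let $\{X_\gamma\}$ be a basis of $\mathfrak g$ and $\{X_\gamma^*\}$ the dual basis with respect to the invariant form $(X,Y)=\frac12\operatorname{tr}(XY)$; $\Omega=\sum_\gamma X_\gamma\otimes X_\gamma^*$ (it acts on $V\otimes V$ as $\sigma-\tau$), and $\Omega_{ij}$ denotes $\Omega$ acting in positions $i<j$. Then $y_i=\sum_{0\le k<i}\Omega_{ki}+\frac{2n-1}{2}\,\mathrm{Id}$. All of $s_i,e_i,y_i$ are $\mathfrak g$-endomorphisms. Since $\operatorname{End}_{\mathfrak g}(M)=\mathbb C$ there are unique numbers $a_k(M)$ with $e_1y_1^ke_1=a_k(M)e_1$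 on $M\otimes V\otimes V$. *)

theory Defs
  imports
    Complex_Main
    "HOL-Algebra.QuotRing"
    "HOL-Algebra.Module"
    "HOL-Library.Poly_Mapping"
    "HOL-Library.Function_Algebras"
begin

section \<open>Complex algebras and right actions\<close>

text \<open>A complex algebra, not necessarily commutative, is a record of type
  \<open>(complex, 'a) module\<close>: a ring together with a scalar multiplication.\<close>

definition alg_hom :: "(complex, 'a) module \<Rightarrow> (complex, 'b) module \<Rightarrow> ('a \<Rightarrow> 'b) set" where
  "alg_hom A B = {h \<in> ring_hom A B.
     \<forall>c. \<forall>a\<in>carrier A. h (c \<odot>\<^bsub>A\<^esub> a) = c \<odot>\<^bsub>B\<^esub> h a}"

definition opp_alg :: "(complex, 'a) module \<Rightarrow> (complex, 'a) module" where
  "opp_alg A = A\<lparr>mult := (\<lambda>a b. b \<otimes>\<^bsub>A\<^esub> a)\<rparr>"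

definition right_action ::
  "(complex, 'a) module \<Rightarrow> 'x::ab_group_add set \<Rightarrow> (complex \<Rightarrow> 'x \<Rightarrow> 'x) \<Rightarrow> ('x \<Rightarrow> 'a \<Rightarrow> 'x) \<Rightarrow> bool"
where
  "right_action A T scl act \<longleftrightarrow>
     (\<forall>x\<in>T. \<forall>a\<in>carrier A. act x a \<in> T) \<and>
     (\<forall>x\<in>T. \<forall>y\<in>T. \<forall>a\<in>carrier A. act (x + y) a = act x a + act y a) \<and>
     (\<forall>c. \<forall>x\<in>T. \<forall>a\<in>carrier A. act (scl c x) a = scl c (act x a)) \<and>
     (\<forall>x\<in>T. \<forall>a\<in>carrier A. \<forall>b\<in>carrier A. act x (a \<oplus>\<^bsub>A\<^esub> b) = act x a + act x b) \<and>
     (\<forall>c. \<forall>x\<in>T. \<forall>a\<in>carrier A. act x (c \<odot>\<^bsub>A\<^esub> a) = scl c (act x a)) \<and>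
     (\<forall>x\<in>T. \<forall>a\<in>carrier A. \<forall>b\<in>carrier A. act x (a \<otimes>\<^bsub>A\<^esub> b) = act (act x a) b) \<and>
     (\<forall>x\<in>T. act x \<one>\<^bsub>A\<^esub> = x)"


section \<open>The affine VW-algebra\<close>

text \<open>Lists form a monoid under concatenation, so that \<open>'g list \<Rightarrow>\<^sub>0 complex\<close> with the
  convolution product is the free unital complex algebra on the letters \<open>'g\<close>.\<close>

instantiation list :: (type) monoid_add
begin
definition zero_list :: "'a list" where "zero_list = []"
definition plus_list :: "'a list \<Rightarrow> 'a list \<Rightarrow> 'a list" where "plus_list = (@)"
instance by standard (simp_all add: zero_list_def plus_list_def)
end

definition free_alg :: "'g set \<Rightarrow> ('g list \<Rightarrow>\<^sub>0 complex) ring" where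
  "free_alg G = \<lparr>carrier = {p. \<forall>u\<in>Poly_Mapping.keys p. set u \<subseteq> G},
     mult = (*), one = 1, zero = 0, add = (+)\<rparr>"

lemma keys_one_list: "Poly_Mapping.keys (1 :: 'g list \<Rightarrow>\<^sub>0 complex) = {[]}"
  by (simp add: keys_def lookup_one zero_list_def when_def)

lemma free_alg_ring: "ring (free_alg G)"
proof (rule ringI)
  show "abelian_group (free_alg G)"
  proof (rule abelian_groupI)
    fix x assume x: "x \<in> carrier (free_alg G)"
    show "\<exists>y\<in>carrier (free_alg G). y \<oplus>\<^bsub>free_alg G\<^esub> x = \<zero>\<^bsub>free_alg G\<^esub>"
      using x by (intro bexI[of _ "- x"]) (auto simp: free_alg_def keys_def)
  qed (auto simp: free_alg_def add_ac dest!: subsetD[OF Poly_Mapping.keys_add])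
  show "Group.monoid (free_alg G)"
  proof (rule monoidI)
    fix x y assume "x \<in> carrier (free_alg G)" "y \<in> carrier (free_alg G)"
    then show "x \<otimes>\<^bsub>free_alg G\<^esub> y \<in> carrier (free_alg G)"
      by (fastforce simp: free_alg_def plus_list_def dest!: subsetD[OF Poly_Mapping.keys_mult])
  qed (auto simp: free_alg_def keys_one_list mult.assoc simp del: keys_one)
qed (auto simp: free_alg_def algebra_simps)

datatype vw_gen = gen_s nat | gen_e nat | gen_y nat

definition vw_gens :: "nat \<Rightarrow> vw_gen set" where
  "vw_gens d = {gen_s i | i. 1 \<le> i \<and> i < d} \<union> {gen_e i | i. 1 \<le> i \<and> i < d}
     \<union> {gen_y j | j. 1 \<le> j \<and> j \<le> d}"

type_synonym vw_free = "vw_gen list \<Rightarrow>\<^sub>0 complex"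

definition fs :: "nat \<Rightarrow> vw_free" where "fs i = Poly_Mapping.single [gen_s i] 1"
definition fe :: "nat \<Rightarrow> vw_free" where "fe i = Poly_Mapping.single [gen_e i] 1"
definition fy :: "nat \<Rightarrow> vw_free" where "fy j = Poly_Mapping.single [gen_y j] 1"
definition fc :: "complex \<Rightarrow> vw_free" where "fc c = Poly_Mapping.single [] c"

text \<open>The bounds \<open>a, b < d\<close> and \<open>Suc c < d\<close> are those of \<open>a, b \<le> d - 1\<close> and \<open>c < d - 1\<close>
  without truncated subtraction.  The relations involving the parameters are only imposed
  when \<open>e\<^sub>1\<close> is a generator, that is for \<open>1 < d\<close>.\<close>

inductive vw_rel :: "nat \<Rightarrow> (nat \<Rightarrow> complex) \<Rightarrow> vw_free \<Rightarrow> vw_free \<Rightarrow> bool"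
  for d :: nat and w :: "nat \<Rightarrow> complex" where
  s_sq: "1 \<le> a \<Longrightarrow> a < d \<Longrightarrow> vw_rel d w (fs a * fs a) 1"
| s_comm: "1 \<le> a \<Longrightarrow> a < d \<Longrightarrow> 1 \<le> b \<Longrightarrow> b < d \<Longrightarrow> \<bar>int a - int b\<bar> > 1 \<Longrightarrow>
    vw_rel d w (fs a * fs b) (fs b * fs a)"
| s_braid: "1 \<le> c \<Longrightarrow> Suc c < d \<Longrightarrow>
    vw_rel d w (fs c * fs (c + 1) * fs c) (fs (c + 1) * fs c * fs (c + 1))"
| s_y: "1 \<le> a \<Longrightarrow> a < d \<Longrightarrow> 1 \<le> i \<Longrightarrow> i \<le> d \<Longrightarrow> i \<notin> {a, a + 1} \<Longrightarrow>
    vw_rel d w (fs a * fy i) (fy i * fs a)"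
| e_sq: "1 \<le> a \<Longrightarrow> a < d \<Longrightarrow> vw_rel d w (fe a * fe a) (fc (w 0) * fe a)"
| e_y_e: "1 < d \<Longrightarrow> vw_rel d w (fe 1 * fy 1 ^ k * fe 1) (fc (w k) * fe 1)"
| s_e_comm: "1 \<le> a \<Longrightarrow> a < d \<Longrightarrow> 1 \<le> b \<Longrightarrow> b < d \<Longrightarrow> \<bar>int a - int b\<bar> > 1 \<Longrightarrow>
    vw_rel d w (fs a * fe b) (fe b * fs a)"
| e_comm: "1 \<le> a \<Longrightarrow> a < d \<Longrightarrow> 1 \<le> b \<Longrightarrow> b < d \<Longrightarrow> \<bar>int a - int b\<bar> > 1 \<Longrightarrow>
    vw_rel d w (fe a * fe b) (fe b * fe a)"
| e_y: "1 \<le> a \<Longrightarrow> a < d \<Longrightarrow> 1 \<le> i \<Longrightarrow> i \<le> d \<Longrightarrow> i \<notin> {a, a + 1} \<Longrightarrow>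
    vw_rel d w (fe a * fy i) (fy i * fe a)"
| y_comm: "1 \<le> i \<Longrightarrow> i \<le> d \<Longrightarrow> 1 \<le> j \<Longrightarrow> j \<le> d \<Longrightarrow>
    vw_rel d w (fy i * fy j) (fy j * fy i)"
| e_s: "1 \<le> a \<Longrightarrow> a < d \<Longrightarrow> vw_rel d w (fe a * fs a) (fe a)"
| s_e: "1 \<le> a \<Longrightarrow> a < d \<Longrightarrow> vw_rel d w (fs a * fe a) (fe a)"
| s_e_e: "1 \<le> c \<Longrightarrow> Suc c < d \<Longrightarrow>
    vw_rel d w (fs c * fe (c + 1) * fe c) (fs (c + 1) * fe c)"
| e_e_s: "1 \<le> c \<Longrightarrow> Suc c < d \<Longrightarrow>
    vw_rel d w (fe c * fe (c + 1) * fs c) (fe c * fs (c + 1))"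
| e_e_s': "1 \<le> c \<Longrightarrow> Suc c < d \<Longrightarrow>
    vw_rel d w (fe (c + 1) * fe c * fs (c + 1)) (fe (c + 1) * fs c)"
| s_e_e': "1 \<le> c \<Longrightarrow> Suc c < d \<Longrightarrow>
    vw_rel d w (fs (c + 1) * fe c * fe (c + 1)) (fs c * fe (c + 1))"
| e_e_e: "1 \<le> c \<Longrightarrow> Suc c < d \<Longrightarrow>
    vw_rel d w (fe (c + 1) * fe c * fe (c + 1)) (fe (c + 1))"
| e_e_e': "1 \<le> c \<Longrightarrow> Suc c < d \<Longrightarrow>
    vw_rel d w (fe c * fe (c + 1) * fe c) (fe c)"
| s_y_skein: "1 \<le> a \<Longrightarrow> a < d \<Longrightarrow>
    vw_rel d w (fs a * fy a - fy (a + 1) * fs a) (fe a - 1)"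
| y_s_skein: "1 \<le> a \<Longrightarrow> a < d \<Longrightarrow>
    vw_rel d w (fy a * fs a - fs a * fy (a + 1)) (fe a - 1)"
| e_antisym: "1 \<le> a \<Longrightarrow> a < d \<Longrightarrow> vw_rel d w (fe a * (fy a + fy (a + 1))) 0"
| e_antisym': "1 \<le> a \<Longrightarrow> a < d \<Longrightarrow> vw_rel d w ((fy a + fy (a + 1)) * fe a) 0"

definition vw_ideal :: "nat \<Rightarrow> (nat \<Rightarrow> complex) \<Rightarrow> vw_free set" where
  "vw_ideal d w = genideal (free_alg (vw_gens d)) {l - r | l r. vw_rel d w l r}"

definition vw_cls :: "nat \<Rightarrow> (nat \<Rightarrow> complex) \<Rightarrow> vw_free \<Rightarrow> vw_free set" where
  "vw_cls d w p = vw_ideal d w +>\<^bsub>free_alg (vw_gens d)\<^esub> p"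

definition VW :: "nat \<Rightarrow> (nat \<Rightarrow> complex) \<Rightarrow> (complex, vw_free set) module" where
  "VW d w = (let Q = free_alg (vw_gens d) Quot vw_ideal d w in
     \<lparr>carrier = carrier Q, mult = mult Q, one = one Q, zero = zero Q, add = add Q,
      smult = (\<lambda>c x. vw_cls d w (fc c) \<otimes>\<^bsub>Q\<^esub> x)\<rparr>)"

lemma free_alg_gens:
  "1 \<le> i \<Longrightarrow> i < d \<Longrightarrow> fs i \<in> carrier (free_alg (vw_gens d))"
  "1 \<le> i \<Longrightarrow> i < d \<Longrightarrow> fe i \<in> carrier (free_alg (vw_gens d))"
  "1 \<le> j \<Longrightarrow> j \<le> d \<Longrightarrow> fy j \<in> carrier (free_alg (vw_gens d))"
  "fc c \<in> carrier (free_alg (vw_gens d))"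
  by (auto simp: free_alg_def fs_def fe_def fy_def fc_def vw_gens_def split: if_splits)

lemma free_alg_closed:
  "0 \<in> carrier (free_alg G)" "1 \<in> carrier (free_alg G)"
  "x \<in> carrier (free_alg G) \<Longrightarrow> y \<in> carrier (free_alg G) \<Longrightarrow> x + y \<in> carrier (free_alg G)"
  "x \<in> carrier (free_alg G) \<Longrightarrow> y \<in> carrier (free_alg G) \<Longrightarrow> x * y \<in> carrier (free_alg G)"
proof -
  interpret ring "free_alg G" by (rule free_alg_ring)
  show "0 \<in> carrier (free_alg G)" "1 \<in> carrier (free_alg G)"
    using zero_closed one_closed by (simp_all add: free_alg_def)
  show "x \<in> carrier (free_alg G) \<Longrightarrow> y \<in> carrier (free_alg G) \<Longrightarrow> x + y \<in> carrier (free_alg G)"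
    "x \<in> carrier (free_alg G) \<Longrightarrow> y \<in> carrier (free_alg G) \<Longrightarrow> x * y \<in> carrier (free_alg G)"
    using add.m_closed[of x y] m_closed[of x y] by (simp_all add: free_alg_def)
qed

lemma free_alg_closed':
  "x \<in> carrier (free_alg G) \<Longrightarrow> y \<in> carrier (free_alg G) \<Longrightarrow> x - y \<in> carrier (free_alg G)"
  "x \<in> carrier (free_alg G) \<Longrightarrow> x ^ k \<in> carrier (free_alg G)"
proof -
  show "x - y \<in> carrier (free_alg G)"
    if "x \<in> carrier (free_alg G)" "y \<in> carrier (free_alg G)" for x y
  proof -
    have "- y \<in> carrier (free_alg G)" using that(2) by (auto simp: free_alg_def keys_def)
    from free_alg_closed(3)[OF that(1) this] show ?thesis by simp
  qed
  show "x \<in> carrier (free_alg G) \<Longrightarrow> x ^ k \<in> carrier (free_alg G)"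
    by (induction k) (simp_all add: free_alg_closed)
qed

lemma vw_rel_carrier:
  assumes "vw_rel d w l r"
  shows "l - r \<in> carrier (free_alg (vw_gens d))"
  using assms
  by cases (simp_all add: free_alg_closed free_alg_closed' free_alg_gens)

lemma vw_ideal_ideal: "ideal (vw_ideal d w) (free_alg (vw_gens d))"
  unfolding vw_ideal_def using vw_rel_carrier
  by (intro ring.genideal_ideal[OF free_alg_ring]) auto


section \<open>The orthogonal Lie algebra\<close>

text \<open>\<open>V\<close> consists of the coordinate functions supported on the index set
  \<open>{\<plusminus>1, \<dots>, \<plusminus>n}\<close>, and \<open>bv i\<close> is the basis vector \<open>v\<^sub>i\<close>.  Endomorphisms of \<open>V\<close> are matrices
  \<open>A\<close> in this basis, \<open>A v\<^sub>j = (\<Sum>i. A i j v\<^sub>i)\<close>.\<close>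

definition idx :: "nat \<Rightarrow> int set" where
  "idx n = {i. 1 \<le> \<bar>i\<bar> \<and> \<bar>i\<bar> \<le> int n}"

type_synonym vec = "int \<Rightarrow> complex"
type_synonym mat = "int \<Rightarrow> int \<Rightarrow> complex"

definition vecs :: "nat \<Rightarrow> vec set" where
  "vecs n = {v. \<forall>i. i \<notin> idx n \<longrightarrow> v i = 0}"

definition bv :: "int \<Rightarrow> vec" where
  "bv i = (\<lambda>j. if j = i then 1 else 0)"

definition vscale :: "complex \<Rightarrow> vec \<Rightarrow> vec" where
  "vscale c v = (\<lambda>i. c * v i)"

definition bform :: "nat \<Rightarrow> vec \<Rightarrow> vec \<Rightarrow> complex" where
  "bform n v w = (\<Sum>i\<in>idx n. v i * w (- i))"

definition gl :: "nat \<Rightarrow> mat set" where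
  "gl n = {A. \<forall>i j. i \<notin> idx n \<or> j \<notin> idx n \<longrightarrow> A i j = 0}"

definition mat_vec :: "nat \<Rightarrow> mat \<Rightarrow> vec \<Rightarrow> vec" where
  "mat_vec n A v = (\<lambda>i. \<Sum>j\<in>idx n. A i j * v j)"

definition mat_mul :: "nat \<Rightarrow> mat \<Rightarrow> mat \<Rightarrow> mat" where
  "mat_mul n A B = (\<lambda>i j. \<Sum>k\<in>idx n. A i k * B k j)"

definition lie :: "nat \<Rightarrow> mat \<Rightarrow> mat \<Rightarrow> mat" where
  "lie n A B = mat_mul n A B - mat_mul n B A"

definition mat_trace :: "nat \<Rightarrow> mat \<Rightarrow> complex" where
  "mat_trace n A = (\<Sum>i\<in>idx n. A i i)"

definition mscale :: "complex \<Rightarrow> mat \<Rightarrow> mat" where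
  "mscale c A = (\<lambda>i j. c * A i j)"

interpretation mat: vector_space mscale
  by standard (auto simp: mscale_def fun_eq_iff algebra_simps)

definition so :: "nat \<Rightarrow> mat set" where
  "so n = {A \<in> gl n. \<forall>v\<in>vecs n. \<forall>w\<in>vecs n.
     bform n (mat_vec n A v) w + bform n v (mat_vec n A w) = 0}"

definition cartan :: "nat \<Rightarrow> mat set" where
  "cartan n = {H \<in> so n. \<forall>i j. i \<noteq> j \<longrightarrow> H i j = 0}"

definition eps :: "int \<Rightarrow> mat \<Rightarrow> complex" where
  "eps i H = H i i"

definition pos_roots :: "nat \<Rightarrow> (mat \<Rightarrow> complex) set" where
  "pos_roots n =
     {eps i + eps j | i j. 1 \<le> j \<and> j < i \<and> i \<le> int n} \<union>
     {eps i - eps j | i j. 1 \<le> j \<and> j < i \<and> i \<le> int n}"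

definition root_space :: "nat \<Rightarrow> (mat \<Rightarrow> complex) \<Rightarrow> mat set" where
  "root_space n \<alpha> = {X \<in> so n. \<forall>H\<in>cartan n. lie n H X = mscale (\<alpha> H) X}"

definition n_plus :: "nat \<Rightarrow> mat set" where
  "n_plus n = mat.span (\<Union>\<alpha>\<in>pos_roots n. root_space n \<alpha>)"

definition inv_form :: "nat \<Rightarrow> mat \<Rightarrow> mat \<Rightarrow> complex" where
  "inv_form n X Y = mat_trace n (mat_mul n X Y) / 2"

definition basis_with_dual :: "nat \<Rightarrow> mat set \<Rightarrow> (mat \<Rightarrow> mat) \<Rightarrow> bool" where
  "basis_with_dual n B dual \<longleftrightarrow>
     B \<subseteq> so n \<and> \<not> mat.dependent B \<and> mat.span B = so n \<and>
     (\<forall>X\<in>B. dual X \<in> so n) \<and>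
     (\<forall>X\<in>B. \<forall>Y\<in>B. inv_form n X (dual Y) = (if X = Y then 1 else 0))"

text \<open>Such bases exist: the matrices \<open>E\<^bsub>i,j\<^esub> - E\<^bsub>-j,-i\<^esub>\<close> with \<open>i + j > 0\<close> form a basis whose
  dual basis consists of the transposed matrices.\<close>

definition fmat :: "int \<times> int \<Rightarrow> mat" where
  "fmat p = (\<lambda>i j. (if (i, j) = p then 1 else 0) - (if (- j, - i) = p then 1 else 0))"

lemma finite_idx: "finite (idx n)"
  by (rule finite_subset[of _ "{- int n..int n}"]) (auto simp: idx_def)

lemma idx_uminus: "- i \<in> idx n \<longleftrightarrow> i \<in> idx n"
  by (simp add: idx_def)

lemma mat_vec_bv: "j \<in> idx n \<Longrightarrow> mat_vec n A (bv j) = (\<lambda>i. A i j)"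
  by (simp add: mat_vec_def bv_def finite_idx if_distrib cong: if_cong)

lemma so_iff: "A \<in> so n \<longleftrightarrow> A \<in> gl n \<and> (\<forall>i\<in>idx n. \<forall>j\<in>idx n. A (- j) (- i) = - A i j)"
proof
  assume A: "A \<in> so n"
  { fix i j assume ij: "i \<in> idx n" "j \<in> idx n"
    have b: "bv i \<in> vecs n" if "i \<in> idx n" for i using that by (auto simp: vecs_def bv_def)
    have l: "bform n x (bv i) = x (- i)" if "i \<in> idx n" for x i
    proof -
      have "bform n x (bv i) = (\<Sum>k\<in>idx n. if k = - i then x k else 0)"
        unfolding bform_def by (rule sum.cong) (auto simp: bv_def)
      then show ?thesis using that by (simp add: finite_idx idx_uminus)
    qed
    have r: "bform n (bv i) x = x (- i)" if "i \<in> idx n" for x i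
      using that by (simp add: bform_def bv_def finite_idx if_distrib[of "\<lambda>t. t * _"] cong: if_cong)
    have "bform n (mat_vec n A (bv j)) (bv (- i)) + bform n (bv j) (mat_vec n A (bv (- i))) = 0"
      using A ij b idx_uminus unfolding so_def by blast
    then have "A i j + A (- j) (- i) = 0"
      using ij by (simp add: l r mat_vec_bv idx_uminus)
    then have "A (- j) (- i) = - A i j" by (simp add: add_eq_0_iff) }
  with A show "A \<in> gl n \<and> (\<forall>i\<in>idx n. \<forall>j\<in>idx n. A (- j) (- i) = - A i j)"
    by (auto simp: so_def)
next
  assume A: "A \<in> gl n \<and> (\<forall>i\<in>idx n. \<forall>j\<in>idx n. A (- j) (- i) = - A i j)"
  { fix v w
    have "bform n v (mat_vec n A w) = (\<Sum>i\<in>idx n. \<Sum>j\<in>idx n. v i * A (- i) j * w j)"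
      by (simp add: bform_def mat_vec_def sum_distrib_left mult.assoc)
    also have "\<dots> = (\<Sum>i\<in>idx n. \<Sum>j\<in>idx n. v i * A (- i) (- j) * w (- j))"
      by (intro sum.cong refl sum.reindex_bij_witness[of _ uminus uminus]) (auto simp: idx_uminus)
    also have "\<dots> = (\<Sum>i\<in>idx n. \<Sum>j\<in>idx n. - (A j i * v i * w (- j)))"
      using A by (intro sum.cong refl) simp
    also have "\<dots> = - (\<Sum>j\<in>idx n. \<Sum>i\<in>idx n. A j i * v i * w (- j))"
      by (subst sum.swap) (simp add: sum_negf)
    also have "\<dots> = - bform n (mat_vec n A v) w"
      by (simp add: bform_def mat_vec_def sum_distrib_right)
    finally have "bform n (mat_vec n A v) w + bform n v (mat_vec n A w) = 0" by simp }
  with A show "A \<in> so n" by (simp add: so_def)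
qed

lemma basis_with_dual_exists:
  fixes n :: nat
  defines "P \<equiv> {(i, j). i \<in> idx n \<and> j \<in> idx n \<and> i + j > 0}"
  shows "basis_with_dual n (fmat ` P) (\<lambda>X i j. X j i)"
proof -
  have fin: "finite P"
    by (rule finite_subset[of _ "idx n \<times> idx n"]) (auto simp: P_def finite_idx)
  have fso: "fmat p \<in> so n" "(\<lambda>i j. fmat p j i) \<in> so n" if "p \<in> P" for p
    using that unfolding P_def so_iff
    by (auto simp: gl_def fmat_def idx_uminus split: if_splits)
  have pair: "A (fst p) (snd p) = inv_form n A (\<lambda>i j. fmat p j i)" if "p \<in> P" "A \<in> so n" for A p
  proof -
    obtain a b where p: "p = (a, b)" by force
    have ab: "a \<in> idx n" "b \<in> idx n" using that p by (auto simp: P_def)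
    have "(\<Sum>i\<in>idx n. \<Sum>j\<in>idx n. A i j * fmat p i j) =
      (\<Sum>i\<in>idx n. \<Sum>j\<in>idx n. if i = a then if j = b then A i j else 0 else 0) -
      (\<Sum>i\<in>idx n. \<Sum>j\<in>idx n. if i = - b then if j = - a then A i j else 0 else 0)"
      unfolding sum_subtractf[symmetric] by (intro sum.cong refl) (auto simp: p fmat_def)
    also have "\<dots> = (\<Sum>i\<in>idx n. if i = a then \<Sum>j\<in>idx n. if j = b then A i j else 0 else 0) -
      (\<Sum>i\<in>idx n. if i = - b then \<Sum>j\<in>idx n. if j = - a then A i j else 0 else 0)"
      by (intro arg_cong2[where f = "(-)"] sum.cong refl) auto
    also have "\<dots> = A a b - A (- b) (- a)"
      using ab by (simp add: finite_idx idx_uminus)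
    also have "\<dots> = 2 * A a b" using that(2) ab unfolding so_iff by auto
    finally show ?thesis by (simp add: inv_form_def mat_trace_def mat_mul_def p)
  qed
  have delta: "fmat q (fst p) (snd p) = (if q = p then 1 else 0)" if "p \<in> P" "q \<in> P" for p q
    using that by (auto simp: fmat_def P_def)
  have inj: "inj_on fmat P"
    using delta by (intro inj_onI) (metis zero_neq_one)
  have sub: "mat.subspace (so n)"
    by (auto simp: mat.subspace_def so_iff gl_def mscale_def)
  have coef: "(\<Sum>X\<in>S. mscale (r X) X) (fst p) (snd p) = r (fmat p)"
    if S: "finite S" "S \<subseteq> fmat ` P" "fmat p \<in> S" and p: "p \<in> P" for S r p
  proof -
    have ev: "(\<Sum>X\<in>S. g X) i j = (\<Sum>X\<in>S. g X i j)" for g :: "mat \<Rightarrow> mat" and i j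
      by (induction S rule: infinite_finite_induct) auto
    have "(\<Sum>X\<in>S. mscale (r X) X) (fst p) (snd p) =
      (\<Sum>X\<in>S. if X = fmat p then r X else 0)"
      unfolding ev
    proof (rule sum.cong[OF refl])
      fix X assume "X \<in> S"
      then obtain q where q: "q \<in> P" "X = fmat q" using S by auto
      then show "mscale (r X) X (fst p) (snd p) = (if X = fmat p then r X else 0)"
        using delta[OF p q(1)] inj p by (auto simp: mscale_def inj_on_def)
    qed
    then show ?thesis using S by simp
  qed
  have indep: "\<not> mat.dependent (fmat ` P)"
  proof
    assume "mat.dependent (fmat ` P)"
    then obtain S r X where S: "finite S" "S \<subseteq> fmat ` P" "(\<Sum>X\<in>S. mscale (r X) X) = 0"
      and X: "X \<in> S" "r X \<noteq> 0" unfolding mat.dependent_explicit by auto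
    then obtain p where "p \<in> P" "X = fmat p" by auto
    with coef[OF S(1,2), of p r] S(3) X show False by simp
  qed
  have "A \<in> mat.span (fmat ` P)" if A: "A \<in> so n" for A
  proof -
    define B where "B = (\<Sum>p\<in>P. mscale (A (fst p) (snd p)) (fmat p))"
    have B: "B \<in> mat.span (fmat ` P)"
      unfolding B_def by (intro mat.span_sum mat.span_scale mat.span_base imageI)
    have "fmat ` P \<subseteq> so n" using fso by blast
    from subsetD[OF mat.span_minimal[OF this sub] B] have Bso: "B \<in> so n" .
    have ev: "B i j = (\<Sum>p\<in>P. A (fst p) (snd p) * fmat p i j)" for i j
    proof -
      have "(\<Sum>X\<in>S. g X) i j = (\<Sum>X\<in>S. g X i j)" for g :: "int \<times> int \<Rightarrow> mat" and S
        by (induction S rule: infinite_finite_induct) auto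
      then show ?thesis by (simp add: B_def mscale_def)
    qed
    have P: "B i j = A i j" if "(i, j) \<in> P" for i j
    proof -
      have "B i j = (\<Sum>p\<in>P. if p = (i, j) then A i j else 0)"
        unfolding ev using delta[OF that] by (intro sum.cong refl) auto
      then show ?thesis using that fin by simp
    qed
    have "B i j = A i j" for i j
    proof (cases "i \<in> idx n \<and> j \<in> idx n")
      case False
      then show ?thesis using A Bso by (auto simp: so_iff gl_def)
    next
      case True
      then consider "(i, j) \<in> P" | "(- j, - i) \<in> P" | "j = - i"
        by (cases "i + j > 0"; cases "i + j < 0") (auto simp: P_def idx_uminus)
      then show ?thesis
      proof cases
        case 1 then show ?thesis by (rule P)
      next
        case 2
        then have "B (- j) (- i) = A (- j) (- i)" by (rule P)
        then show ?thesis using A Bso True unfolding so_iff by auto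
      next
        case 3
        have "X i (- i) = 0" if "X \<in> so n" for X
        proof -
          have "X (- (- i)) (- i) = - X i (- i)"
            using that True 3 unfolding so_iff by blast
          then show ?thesis by simp
        qed
        from this[OF A] this[OF Bso] show ?thesis using 3 by simp
      qed
    qed
    then have "B = A" by blast
    with B show ?thesis by simp
  qed
  then have span: "mat.span (fmat ` P) = so n"
    using mat.span_minimal[OF _ sub, of "fmat ` P"] fso(1) by blast
  show ?thesis
    unfolding basis_with_dual_def
  proof (intro conjI ballI)
    fix X Y assume "X \<in> fmat ` P" "Y \<in> fmat ` P"
    then obtain p q where pq: "p \<in> P" "X = fmat p" "q \<in> P" "Y = fmat q" by auto
    then show "inv_form n X (\<lambda>i j. Y j i) = (if X = Y then 1 else 0)"
      using pair[OF pq(3) fso(1)[OF pq(1)]] delta[OF pq(3,1)] inj_on_eq_iff[OF inj pq(1,3)] by simp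
  qed (use fso indep span in auto)
qed

locale so_module = vector_space scl
  for scl :: "complex \<Rightarrow> 'm::ab_group_add \<Rightarrow> 'm" +
  fixes n :: nat and \<rho> :: "mat \<Rightarrow> 'm \<Rightarrow> 'm"
  assumes rho_linear: "X \<in> so n \<Longrightarrow> Vector_Spaces.linear scl scl (\<rho> X)"
    and rho_add: "X \<in> so n \<Longrightarrow> Y \<in> so n \<Longrightarrow> \<rho> (X + Y) x = \<rho> X x + \<rho> Y x"
    and rho_scale: "X \<in> so n \<Longrightarrow> \<rho> (mscale c X) x = scl c (\<rho> X x)"
    and rho_lie: "X \<in> so n \<Longrightarrow> Y \<in> so n \<Longrightarrow> \<rho> (lie n X Y) x = \<rho> X (\<rho> Y x) - \<rho> Y (\<rho> X x)"

locale highest_weight_module = so_module scl n \<rho>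
  for scl :: "complex \<Rightarrow> 'm::ab_group_add \<Rightarrow> 'm" and n \<rho> +
  assumes highest_weight_vector:
    "\<exists>m. m \<noteq> 0 \<and> (\<forall>X\<in>n_plus n. \<rho> X m = 0) \<and> (\<forall>H\<in>cartan n. \<exists>c. \<rho> H m = scl c m) \<and>
       (\<forall>W. subspace W \<and> m \<in> W \<and> (\<forall>X\<in>so n. \<forall>x\<in>W. \<rho> X x \<in> W) \<longrightarrow> W = UNIV)"


section \<open>The tensor product \<open>M \<otimes> V\<^sup>\<otimes>\<^sup>d\<close>\<close>

text \<open>As \<open>V\<close> has the basis \<open>v\<^sub>i\<close>, every element of \<open>M \<otimes> V\<^sup>\<otimes>\<^sup>d\<close> is uniquely
  \<open>\<Sum>u. f u \<otimes> v\<^bsub>u\<^sub>1\<^esub> \<otimes> \<dots> \<otimes> v\<^bsub>u\<^sub>d\<^esub>\<close> with \<open>u\<close> ranging over the words of length \<open>d\<close> in the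
  indices and \<open>f u \<in> M\<close>; it is represented by the coefficient function \<open>f\<close>.
  \<open>tens scl m vs\<close> is the pure tensor of \<open>m\<close> with the vectors in the list \<open>vs\<close>, and the
  universal property is proved below: \<open>tlift n d F\<close> is linear, and if \<open>F\<close> is multilinear it
  takes the value \<open>F m vs\<close> on the pure tensor of \<open>m\<close> and \<open>vs\<close>.\<close>

type_synonym 'm tensor = "int list \<Rightarrow> 'm"

definition iwords :: "nat \<Rightarrow> nat \<Rightarrow> int list set" where
  "iwords n d = {u. set u \<subseteq> idx n \<and> length u = d}"

definition tspace :: "nat \<Rightarrow> nat \<Rightarrow> ('m::zero) tensor set" where
  "tspace n d = {f. \<forall>u. u \<notin> iwords n d \<longrightarrow> f u = 0}"

definition tscale :: "(complex \<Rightarrow> 'm \<Rightarrow> 'm) \<Rightarrow> complex \<Rightarrow> 'm tensor \<Rightarrow> 'm tensor" where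
  "tscale scl c f = (\<lambda>u. scl c (f u))"

definition tens :: "(complex \<Rightarrow> 'm \<Rightarrow> 'm) \<Rightarrow> 'm::zero \<Rightarrow> vec list \<Rightarrow> 'm tensor" where
  "tens scl m vs = (\<lambda>u. if length u = length vs
     then scl (\<Prod>k<length vs. (vs ! k) (u ! k)) m else 0)"

definition tlift :: "nat \<Rightarrow> nat \<Rightarrow> ('m \<Rightarrow> vec list \<Rightarrow> 'x::comm_monoid_add) \<Rightarrow> 'm tensor \<Rightarrow> 'x" where
  "tlift n d F f = (\<Sum>u\<in>iwords n d. F (f u) (map bv u))"

definition vlists :: "nat \<Rightarrow> nat \<Rightarrow> vec list set" where
  "vlists n d = {vs. set vs \<subseteq> vecs n \<and> length vs = d}"

definition multilin ::
  "nat \<Rightarrow> nat \<Rightarrow> (complex \<Rightarrow> 'm \<Rightarrow> 'm) \<Rightarrow> (complex \<Rightarrow> 'x \<Rightarrow> 'x) \<Rightarrow>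
   ('m::ab_group_add \<Rightarrow> vec list \<Rightarrow> 'x::ab_group_add) \<Rightarrow> bool"
where
  "multilin n d scl sclx F \<longleftrightarrow>
     (\<forall>vs\<in>vlists n d. Vector_Spaces.linear scl sclx (\<lambda>m. F m vs)) \<and>
     (\<forall>m. \<forall>vs\<in>vlists n d. \<forall>k<d. \<forall>v\<in>vecs n. \<forall>w\<in>vecs n.
        F m (vs[k := v + w]) = F m (vs[k := v]) + F m (vs[k := w])) \<and>
     (\<forall>m. \<forall>vs\<in>vlists n d. \<forall>k<d. \<forall>c. \<forall>v\<in>vecs n.
        F m (vs[k := vscale c v]) = sclx c (F m (vs[k := v])))"


lemma vlists_update: "vs \<in> vlists n d \<Longrightarrow> v \<in> vecs n \<Longrightarrow> vs[k := v] \<in> vlists n d"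
  by (auto simp: vlists_def dest!: subsetD[OF set_update_subset_insert])

lemma vecs_bv: "i \<in> idx n \<Longrightarrow> bv i \<in> vecs n"
  by (auto simp: vecs_def bv_def)

lemma vlists_bv: "u \<in> iwords n d \<Longrightarrow> map bv u \<in> vlists n d"
  by (auto simp: vlists_def iwords_def vecs_bv)

lemma finite_iwords: "finite (iwords n d)"
  unfolding iwords_def by (rule finite_lists_length_eq[OF finite_idx])

lemma iwords_Suc: "iwords n (Suc d) = (\<lambda>(i, u). i # u) ` (idx n \<times> iwords n d)"
  by (auto simp: iwords_def length_Suc_conv image_iff)

lemma vecs_closed:
  "(\<lambda>_. 0) \<in> vecs n" "0 \<in> vecs n" "v \<in> vecs n \<Longrightarrow> w \<in> vecs n \<Longrightarrow> v + w \<in> vecs n"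
  "v \<in> vecs n \<Longrightarrow> vscale c v \<in> vecs n"
  by (auto simp: vecs_def vscale_def)

lemma vec_expand:
  assumes "v \<in> vecs n"
  shows "(\<Sum>i\<in>idx n. vscale (v i) (bv i)) = v"
proof
  fix k
  have "(\<Sum>i\<in>S. g i) k = (\<Sum>i\<in>S. g i k)" for S and g :: "int \<Rightarrow> vec"
    by (induction S rule: infinite_finite_induct) auto
  then have "(\<Sum>i\<in>idx n. vscale (v i) (bv i)) k = (\<Sum>i\<in>idx n. if i = k then v i else 0)"
    by (auto simp: vscale_def bv_def intro!: sum.cong)
  then show "(\<Sum>i\<in>idx n. vscale (v i) (bv i)) k = v k"
    using assms by (simp add: finite_idx vecs_def)
qed

lemma multilin_Cons:
  assumes F: "multilin n (Suc d) scl sclx F" and v: "v \<in> vecs n"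
  shows "multilin n d scl sclx (\<lambda>m vs. F m (v # vs))"
proof -
  have c: "v # vs \<in> vlists n (Suc d)" if "vs \<in> vlists n d" for vs
    using that v by (auto simp: vlists_def)
  show ?thesis
    unfolding multilin_def
  proof (intro conjI ballI allI impI)
    fix vs assume "vs \<in> vlists n d"
    then show "Vector_Spaces.linear scl sclx (\<lambda>m. F m (v # vs))"
      using F c unfolding multilin_def by blast
  next
    fix m vs k x y assume "vs \<in> vlists n d" "k < d" "x \<in> vecs n" "y \<in> vecs n"
    then have "F m ((v # vs)[Suc k := x + y]) = F m ((v # vs)[Suc k := x]) + F m ((v # vs)[Suc k := y])"
      using F c unfolding multilin_def by (meson Suc_less_eq)
    then show "F m (v # vs[k := x + y]) = F m (v # vs[k := x]) + F m (v # vs[k := y])" by simp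
  next
    fix m vs k b x assume "vs \<in> vlists n d" "k < d" "x \<in> vecs n"
    then have "F m ((v # vs)[Suc k := vscale b x]) = sclx b (F m ((v # vs)[Suc k := x]))"
      using F c unfolding multilin_def by (meson Suc_less_eq)
    then show "F m (v # vs[k := vscale b x]) = sclx b (F m (v # vs[k := x]))" by simp
  qed
qed

lemma multilin_expand:
  assumes "vector_space sclx" "multilin n d scl sclx F" "vs \<in> vlists n d"
  shows "F m vs = (\<Sum>u\<in>iwords n d. sclx (\<Prod>k<d. (vs ! k) (u ! k)) (F m (map bv u)))"
  using assms(2,3)
proof (induction d arbitrary: F vs)
  case 0
  interpret x: vector_space sclx by fact
  have "iwords n 0 = {[]}" by (auto simp: iwords_def)
  with 0 show ?case by (simp add: vlists_def)
next
  case (Suc d)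
  interpret x: vector_space sclx by fact
  obtain v vs' where vs: "vs = v # vs'" "v \<in> vecs n" "vs' \<in> vlists n d"
    using Suc.prems(2) by (auto simp: vlists_def length_Suc_conv)
  have c: "w # vs' \<in> vlists n (Suc d)" if "w \<in> vecs n" for w
    using that vs by (auto simp: vlists_def)
  have add: "F m ((x + y) # vs') = F m (x # vs') + F m (y # vs')"
    if "x \<in> vecs n" "y \<in> vecs n" for x y
  proof -
    have "F m ((v # vs')[0 := x + y]) = F m ((v # vs')[0 := x]) + F m ((v # vs')[0 := y])"
      using Suc.prems(1) c[OF vs(2)] that unfolding multilin_def by blast
    then show ?thesis by simp
  qed
  have scal: "F m (vscale b x # vs') = sclx b (F m (x # vs'))" if "x \<in> vecs n" for x b
  proof -
    have "F m ((v # vs')[0 := vscale b x]) = sclx b (F m ((v # vs')[0 := x]))"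
      using Suc.prems(1) c[OF vs(2)] that unfolding multilin_def by blast
    then show ?thesis by simp
  qed
  have sum: "F m ((\<Sum>i\<in>S. vscale (v i) (bv i)) # vs') = (\<Sum>i\<in>S. sclx (v i) (F m (bv i # vs')))
      \<and> (\<Sum>i\<in>S. vscale (v i) (bv i)) \<in> vecs n" if "finite S" "S \<subseteq> idx n" for S
    using that
  proof (induction S rule: finite_induct)
    case empty
    have "F m (0 # vs') = 0" using add[OF vecs_closed(2,2)] by (metis add.right_neutral add_left_cancel)
    then show ?case using vecs_closed(2) by (simp only: sum.empty simp_thms)
  next
    case (insert i S)
    then have S: "(\<Sum>i\<in>S. vscale (v i) (bv i)) \<in> vecs n" and i: "vscale (v i) (bv i) \<in> vecs n"
      and IH: "F m ((\<Sum>i\<in>S. vscale (v i) (bv i)) # vs') = (\<Sum>i\<in>S. sclx (v i) (F m (bv i # vs')))"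
      by (auto intro: vecs_closed vecs_bv)
    have "i \<in> idx n" using insert by blast
    show ?case
      unfolding sum.insert[OF insert(1,2)] add[OF i S] IH scal[OF vecs_bv[OF \<open>i \<in> idx n\<close>]]
      using vecs_closed(3)[OF i S] by blast
  qed
  have "F m vs = (\<Sum>i\<in>idx n. sclx (v i) (F m (bv i # vs')))"
    using sum[OF finite_idx order_refl] vec_expand[OF vs(2)] vs(1) by simp
  also have "\<dots> = (\<Sum>i\<in>idx n. \<Sum>u\<in>iwords n d.
      sclx (v i * (\<Prod>k<d. (vs' ! k) (u ! k))) (F m (bv i # map bv u)))"
  proof (rule sum.cong[OF refl])
    fix i assume "i \<in> idx n"
    then have "F m (bv i # vs') =
      (\<Sum>u\<in>iwords n d. sclx (\<Prod>k<d. (vs' ! k) (u ! k)) (F m (bv i # map bv u)))"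
      by (intro Suc.IH[of "\<lambda>m vs. F m (bv i # vs)"] multilin_Cons[OF Suc.prems(1)] vecs_bv vs)
    then show "sclx (v i) (F m (bv i # vs')) = (\<Sum>u\<in>iwords n d.
      sclx (v i * (\<Prod>k<d. (vs' ! k) (u ! k))) (F m (bv i # map bv u)))"
      by (simp add: x.scale_sum_right)
  qed
  also have "\<dots> = (\<Sum>u\<in>iwords n (Suc d). sclx (\<Prod>k<Suc d. (vs ! k) (u ! k)) (F m (map bv u)))"
    unfolding iwords_Suc
    by (subst sum.reindex)
      (auto simp: inj_on_def sum.cartesian_product vs(1) prod.lessThan_Suc_shift
        simp del: prod.lessThan_Suc intro!: sum.cong)
  finally show ?case .
qed

theorem tlift_tens:
  assumes "vector_space sclx" "multilin n d scl sclx F" "vs \<in> vlists n d"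
  shows "tlift n d F (tens scl m vs) = F m vs"
proof -
  have "F (tens scl m vs u) (map bv u) = sclx (\<Prod>k<d. (vs ! k) (u ! k)) (F m (map bv u))"
    if u: "u \<in> iwords n d" for u
  proof -
    interpret L: Vector_Spaces.linear scl sclx "\<lambda>m. F m (map bv u)"
      using assms(2) vlists_bv[OF u] unfolding multilin_def by blast
    show ?thesis using u assms(3) by (simp add: tens_def iwords_def vlists_def L.scale)
  qed
  then show ?thesis
    unfolding tlift_def using multilin_expand[OF assms, of m] by (simp cong: sum.cong)
qed

theorem tlift_linear:
  assumes "vector_space sclx" "multilin n d scl sclx F"
  shows "tlift n d F (f + g) = tlift n d F f + tlift n d F g"
    and "tlift n d F (tscale scl c f) = sclx c (tlift n d F f)"
proof -
  interpret x: vector_space sclx by fact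
  have L: "Vector_Spaces.linear scl sclx (\<lambda>m. F m (map bv u))" if "u \<in> iwords n d" for u
    using assms(2) vlists_bv[OF that] unfolding multilin_def by blast
  have "F ((f + g) u) (map bv u) = F (f u) (map bv u) + F (g u) (map bv u)"
    "F (tscale scl c f u) (map bv u) = sclx c (F (f u) (map bv u))" if "u \<in> iwords n d" for u
  proof -
    interpret L: Vector_Spaces.linear scl sclx "\<lambda>m. F m (map bv u)" by (rule L[OF that])
    show "F ((f + g) u) (map bv u) = F (f u) (map bv u) + F (g u) (map bv u)"
      "F (tscale scl c f u) (map bv u) = sclx c (F (f u) (map bv u))"
      by (simp_all add: L.add L.scale tscale_def)
  qed
  then show "tlift n d F (f + g) = tlift n d F f + tlift n d F g"
    "tlift n d F (tscale scl c f) = sclx c (tlift n d F f)"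
    by (simp_all add: tlift_def sum.distrib x.scale_sum_right cong: sum.cong)
qed

lemma sum_tensor_apply: "(\<Sum>i\<in>S. g i) u = (\<Sum>i\<in>S. g i u)" for g :: "'i \<Rightarrow> ('m::comm_monoid_add) tensor"
  by (induction S rule: infinite_finite_induct) auto

theorem tensor_expand:
  assumes "vector_space scl" "f \<in> tspace n d"
  shows "f = (\<Sum>u\<in>iwords n d. tens scl (f u) (map bv u))"
proof
  fix w
  interpret vector_space scl by fact
  have "tens scl (f u) (map bv u) w = (if u = w then f w else 0)" for u
  proof (cases "length w = length u")
    case True
    show ?thesis
    proof (cases "u = w")
      case False
      then obtain k where "k < length u" "u ! k \<noteq> w ! k"
        using True by (metis nth_equalityI)
      then show ?thesis using True False by (auto simp: tens_def bv_def intro!: bexI[of _ k])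
    qed (simp add: tens_def bv_def)
  qed (auto simp: tens_def)
  then show "f w = (\<Sum>u\<in>iwords n d. tens scl (f u) (map bv u)) w"
    using assms(2) by (simp add: sum_tensor_apply finite_iwords tspace_def)
qed

lemma vector_space_tscale:
  assumes "vector_space scl"
  shows "vector_space (tscale scl)"
proof -
  interpret vector_space scl by fact
  show ?thesis by standard (auto simp: tscale_def fun_eq_iff algebra_simps)
qed

lemma tens_update:
  assumes "k < length vs"
  shows "tens scl m (vs[k := v]) = (\<lambda>u. if length u = length vs
     then scl (v (u ! k) * (\<Prod>l\<in>{..<length vs} - {k}. (vs ! l) (u ! l))) m else 0)"
  using assms unfolding tens_def
  by (intro ext) (auto simp: prod.remove[of "{..<length vs}" k] intro!: arg_cong2[where f = scl] prod.cong)

lemma multilin_tens: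
  assumes "vector_space scl"
  shows "multilin n d scl (tscale scl) (tens scl)"
proof -
  interpret vector_space scl by fact
  interpret t: vector_space "tscale scl" by (rule vector_space_tscale) fact
  have "Vector_Spaces.linear scl (tscale scl) (\<lambda>m. tens scl m vs)" for vs
    by unfold_locales (auto simp: tens_def tscale_def fun_eq_iff algebra_simps)
  then show ?thesis
    unfolding multilin_def
    by (auto simp: vlists_def tens_update tscale_def vscale_def fun_eq_iff algebra_simps)
qed


section \<open>The endomorphisms of \<open>M \<otimes> V\<^sup>\<otimes>\<^sup>d\<close>\<close>

text \<open>The operators are given by their values on pure tensors.  Position \<open>i \<ge> 1\<close> of the
  tensor product corresponds to the entry \<open>i - 1\<close> of the list.\<close>

definition s_op :: "nat \<Rightarrow> nat \<Rightarrow> (complex \<Rightarrow> 'm::ab_group_add \<Rightarrow> 'm) \<Rightarrow> nat \<Rightarrow> 'm tensor \<Rightarrow> 'm tensor" where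
  "s_op n d scl i = tlift n d (\<lambda>m vs. tens scl m (vs[i - 1 := vs ! i, i := vs ! (i - 1)]))"

definition e_op :: "nat \<Rightarrow> nat \<Rightarrow> (complex \<Rightarrow> 'm::ab_group_add \<Rightarrow> 'm) \<Rightarrow> nat \<Rightarrow> 'm tensor \<Rightarrow> 'm tensor" where
  "e_op n d scl i = tlift n d (\<lambda>m vs. tscale scl (bform n (vs ! (i - 1)) (vs ! i))
     (\<Sum>j\<in>idx n. tens scl m (vs[i - 1 := bv j, i := bv (- j)])))"

definition pos_act :: "nat \<Rightarrow> nat \<Rightarrow> (complex \<Rightarrow> 'm::ab_group_add \<Rightarrow> 'm) \<Rightarrow> (mat \<Rightarrow> 'm \<Rightarrow> 'm) \<Rightarrow>
    mat \<Rightarrow> nat \<Rightarrow> 'm tensor \<Rightarrow> 'm tensor" where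
  "pos_act n d scl \<rho> X k = tlift n d (\<lambda>m vs. if k = 0 then tens scl (\<rho> X m) vs
     else tens scl m (vs[k - 1 := mat_vec n X (vs ! (k - 1))]))"

definition g_act :: "nat \<Rightarrow> nat \<Rightarrow> (complex \<Rightarrow> 'm::ab_group_add \<Rightarrow> 'm) \<Rightarrow> (mat \<Rightarrow> 'm \<Rightarrow> 'm) \<Rightarrow>
    mat \<Rightarrow> 'm tensor \<Rightarrow> 'm tensor" where
  "g_act n d scl \<rho> X f = (\<Sum>k\<le>d. pos_act n d scl \<rho> X k f)"

definition omega_op :: "nat \<Rightarrow> nat \<Rightarrow> (complex \<Rightarrow> 'm::ab_group_add \<Rightarrow> 'm) \<Rightarrow> (mat \<Rightarrow> 'm \<Rightarrow> 'm) \<Rightarrow>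
    mat set \<Rightarrow> (mat \<Rightarrow> mat) \<Rightarrow> nat \<Rightarrow> nat \<Rightarrow> 'm tensor \<Rightarrow> 'm tensor" where
  "omega_op n d scl \<rho> B dual i j f =
     (\<Sum>X\<in>B. pos_act n d scl \<rho> X i (pos_act n d scl \<rho> (dual X) j f))"

definition y_op :: "nat \<Rightarrow> nat \<Rightarrow> (complex \<Rightarrow> 'm::ab_group_add \<Rightarrow> 'm) \<Rightarrow> (mat \<Rightarrow> 'm \<Rightarrow> 'm) \<Rightarrow>
    mat set \<Rightarrow> (mat \<Rightarrow> mat) \<Rightarrow> nat \<Rightarrow> 'm tensor \<Rightarrow> 'm tensor" where
  "y_op n d scl \<rho> B dual i f =
     (\<Sum>k<i. omega_op n d scl \<rho> B dual k i f) + tscale scl ((2 * of_nat n - 1) / 2) f"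

lemma tlift_multilin_tens:
  assumes "vector_space scl" "vs \<in> vlists n d" "multilin n d scl (tscale scl) F"
  shows "tlift n d F (tens scl m vs) = F m vs"
  using tlift_tens[OF vector_space_tscale] assms by blast

theorem s_op_tens:
  assumes "vector_space scl" "vs \<in> vlists n d" "1 \<le> i" "i < d"
  shows "s_op n d scl i (tens scl m vs) = tens scl m (vs[i - 1 := vs ! i, i := vs ! (i - 1)])"
  unfolding s_op_def
proof (rule tlift_multilin_tens[OF assms(1,2)])
  let ?sw = "\<lambda>vs :: vec list. vs[i - 1 := vs ! i, i := vs ! (i - 1)]"
  let ?p = "\<lambda>k. if k = i then i - 1 else if k = i - 1 then i else k"
  have upd: "?sw (vs[k := v]) = (?sw vs)[?p k := v]" if "length vs = d" for vs v k
    using that assms(3,4) by (cases "k < d") (auto simp: list_eq_iff_nth_eq nth_list_update)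
  have cl: "?sw vs \<in> vlists n d" if "vs \<in> vlists n d" for vs
    using that assms(3,4) by (intro vlists_update) (auto simp: vlists_def)
  have p: "?p k < d" if "k < d" for k using that assms(3,4) by auto
  have M: "multilin n d scl (tscale scl) (tens scl)" by (rule multilin_tens) fact
  show "multilin n d scl (tscale scl) (\<lambda>m vs. tens scl m (?sw vs))"
    unfolding multilin_def
  proof (intro conjI ballI allI impI)
    fix vs assume "vs \<in> vlists n d"
    then show "Vector_Spaces.linear scl (tscale scl) (\<lambda>m. tens scl m (?sw vs))"
      using M cl unfolding multilin_def by blast
  next
    fix m vs k x y assume vs: "vs \<in> vlists n d" "k < d" "x \<in> vecs n" "y \<in> vecs n"
    then have "length vs = d" by (simp add: vlists_def)
    from vs M cl[OF vs(1)] p[OF vs(2)]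
    show "tens scl m (?sw (vs[k := x + y])) = tens scl m (?sw (vs[k := x])) + tens scl m (?sw (vs[k := y]))"
      unfolding upd[OF \<open>length vs = d\<close>] multilin_def by blast
  next
    fix m vs k c x assume vs: "vs \<in> vlists n d" "k < d" "x \<in> vecs n"
    then have "length vs = d" by (simp add: vlists_def)
    from vs M cl[OF vs(1)] p[OF vs(2)]
    show "tens scl m (?sw (vs[k := vscale c x])) = tscale scl c (tens scl m (?sw (vs[k := x])))"
      unfolding upd[OF \<open>length vs = d\<close>] multilin_def by blast
  qed
qed

theorem e_op_tens:
  assumes "vector_space scl" "vs \<in> vlists n d" "1 \<le> i" "i < d"
  shows "e_op n d scl i (tens scl m vs) = tscale scl (bform n (vs ! (i - 1)) (vs ! i))
     (\<Sum>j\<in>idx n. tens scl m (vs[i - 1 := bv j, i := bv (- j)]))"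
  unfolding e_op_def
proof (rule tlift_multilin_tens[OF assms(1,2)])
  interpret vector_space scl by fact
  interpret t: vector_space "tscale scl" by (rule vector_space_tscale) fact
  let ?r = "\<lambda>j (vs :: vec list). vs[i - 1 := bv j, i := bv (- j)]"
  let ?F = "\<lambda>m vs. tscale scl (bform n (vs ! (i - 1)) (vs ! i)) (\<Sum>j\<in>idx n. tens scl m (?r j vs))"
  have ne: "i - 1 \<noteq> i" "i - 1 < d" using assms by auto
  have M: "Vector_Spaces.linear scl (tscale scl) (\<lambda>m. tens scl m vs)" if "vs \<in> vlists n d" for vs
    using multilin_tens[OF assms(1), of n d] that unfolding multilin_def by blast
  have cl: "?r j vs \<in> vlists n d" if "vs \<in> vlists n d" "j \<in> idx n" for vs j
    using that by (intro vlists_update) (auto simp: vecs_bv idx_uminus)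
  have r1: "?r j (vs[k := v]) = ?r j vs" if "k = i \<or> k = i - 1" for j vs k v
    using that ne(1) by (metis list_update_swap list_update_overwrite)
  have r2: "?r j (vs[k := v]) = (?r j vs)[k := v]" if "\<not> (k = i \<or> k = i - 1)" for j vs k v
    using that by (metis list_update_swap)
  have b: "bform n (x + y) z = bform n x z + bform n y z" "bform n z (x + y) = bform n z x + bform n z y"
    "bform n (vscale c x) z = c * bform n x z" "bform n z (vscale c x) = c * bform n z x" for x y z c
    by (simp_all add: bform_def vscale_def algebra_simps sum.distrib sum_distrib_left)
  have T: "tens scl m (vs[k := x + y]) = tens scl m (vs[k := x]) + tens scl m (vs[k := y])"
    "tens scl m (vs[k := vscale c x]) = tscale scl c (tens scl m (vs[k := x]))"
    if "vs \<in> vlists n d" "k < d" "x \<in> vecs n" "y \<in> vecs n" for m vs k x y c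
    using multilin_tens[OF assms(1), of n d] that unfolding multilin_def by blast+
  show "multilin n d scl (tscale scl) ?F"
    unfolding multilin_def
  proof (intro conjI ballI allI impI)
    fix vs assume vs: "vs \<in> vlists n d"
    have "tens scl (x + y) (?r j vs) = tens scl x (?r j vs) + tens scl y (?r j vs)"
      "tens scl (scl c x) (?r j vs) = tscale scl c (tens scl x (?r j vs))" if "j \<in> idx n" for x y c j
    proof -
      interpret L: Vector_Spaces.linear scl "tscale scl" "\<lambda>m. tens scl m (?r j vs)"
        by (rule M[OF cl[OF vs that]])
      show "tens scl (x + y) (?r j vs) = tens scl x (?r j vs) + tens scl y (?r j vs)"
        "tens scl (scl c x) (?r j vs) = tscale scl c (tens scl x (?r j vs))"
        by (rule L.add, rule L.scale)
    qed
    then show "Vector_Spaces.linear scl (tscale scl) (\<lambda>m. ?F m vs)"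
      by unfold_locales
        (simp_all add: sum.distrib t.scale_right_distrib t.scale_sum_right[symmetric] t.scale_left_commute
          cong: sum.cong)
  next
    fix m vs k x y assume vs: "vs \<in> vlists n d" "k < d" "x \<in> vecs n" "y \<in> vecs n"
    then have l: "length vs = d" by (simp add: vlists_def)
    show "?F m (vs[k := x + y]) = ?F m (vs[k := x]) + ?F m (vs[k := y])"
    proof (cases "k = i \<or> k = i - 1")
      case True
      with ne l assms(4) show ?thesis
        unfolding r1[OF True] by (auto simp: b t.scale_left_distrib)
    next
      case False
      have "(\<Sum>j\<in>idx n. tens scl m ((?r j vs)[k := x + y])) =
        (\<Sum>j\<in>idx n. tens scl m ((?r j vs)[k := x])) + (\<Sum>j\<in>idx n. tens scl m ((?r j vs)[k := y]))"
        using T(1)[OF cl[OF vs(1)] vs(2-4)] by (simp add: sum.distrib cong: sum.cong)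
      with False show ?thesis by (simp only: r2[OF False] t.scale_right_distrib) simp
    qed
  next
    fix m vs k c x assume vs: "vs \<in> vlists n d" "k < d" "x \<in> vecs n"
    then have l: "length vs = d" by (simp add: vlists_def)
    show "?F m (vs[k := vscale c x]) = tscale scl c (?F m (vs[k := x]))"
    proof (cases "k = i \<or> k = i - 1")
      case True
      with ne l assms(4) show ?thesis
        unfolding r1[OF True] by (auto simp: b)
    next
      case False
      have "(\<Sum>j\<in>idx n. tens scl m ((?r j vs)[k := vscale c x])) =
        tscale scl c (\<Sum>j\<in>idx n. tens scl m ((?r j vs)[k := x]))"
        using T(2)[OF cl[OF vs(1)] vs(2,3,3)] by (simp add: t.scale_sum_right cong: sum.cong)
      with False show ?thesis by (simp only: r2[OF False]) (simp add: mult.commute)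
    qed
  qed
qed

theorem pos_act_tens:
  assumes "so_module scl n \<rho>" "vs \<in> vlists n d" "X \<in> so n" "k \<le> d"
  shows "pos_act n d scl \<rho> X k (tens scl m vs) = (if k = 0 then tens scl (\<rho> X m) vs
     else tens scl m (vs[k - 1 := mat_vec n X (vs ! (k - 1))]))"
proof -
  interpret so_module scl n \<rho> by fact
  have vs: "vector_space scl" by unfold_locales
  interpret t: vector_space "tscale scl" by (rule vector_space_tscale) fact
  interpret R: Vector_Spaces.linear scl scl "\<rho> X" by (rule rho_linear) fact
  have M: "Vector_Spaces.linear scl (tscale scl) (\<lambda>m. tens scl m vs)" if "vs \<in> vlists n d" for vs
    using multilin_tens[OF vs, of n d] that unfolding multilin_def by blast
  have T: "tens scl m (vs[k := x + y]) = tens scl m (vs[k := x]) + tens scl m (vs[k := y])"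
    "tens scl m (vs[k := vscale c x]) = tscale scl c (tens scl m (vs[k := x]))"
    if "vs \<in> vlists n d" "k < d" "x \<in> vecs n" "y \<in> vecs n" for m vs k x y c
    using multilin_tens[OF vs, of n d] that unfolding multilin_def by blast+
  have mv: "mat_vec n X (x + y) = mat_vec n X x + mat_vec n X y"
    "mat_vec n X (vscale c x) = vscale c (mat_vec n X x)" for x y c
    by (simp_all add: mat_vec_def vscale_def fun_eq_iff algebra_simps sum.distrib sum_distrib_left)
  have mvc: "mat_vec n X x \<in> vecs n" for x
    using assms(3) by (auto simp: so_def gl_def vecs_def mat_vec_def)
  show ?thesis
    unfolding pos_act_def
  proof (rule tlift_multilin_tens[OF vs assms(2)])
    show "multilin n d scl (tscale scl) (\<lambda>m vs. if k = 0 then tens scl (\<rho> X m) vs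
      else tens scl m (vs[k - 1 := mat_vec n X (vs ! (k - 1))]))"
    proof (cases "k = 0")
      case True
      have "Vector_Spaces.linear scl (tscale scl) (\<lambda>m. tens scl (\<rho> X m) vs)" if "vs \<in> vlists n d" for vs
      proof -
        interpret L: Vector_Spaces.linear scl "tscale scl" "\<lambda>m. tens scl m vs" by (rule M[OF that])
        show ?thesis by unfold_locales (simp_all add: L.add L.scale R.add R.scale)
      qed
      with True T show ?thesis unfolding multilin_def by simp
    next
      case False
      let ?r = "\<lambda>vs. vs[k - 1 := mat_vec n X (vs ! (k - 1))]"
      have cl: "?r vs \<in> vlists n d" if "vs \<in> vlists n d" for vs
        using that mvc by (intro vlists_update)
      have r1: "?r (vs[l := x]) = vs[l := mat_vec n X x]" if "l = k - 1" "l < length vs" for vs l x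
        using that by simp
      have r2: "?r (vs[l := x]) = (?r vs)[l := x]" if "l \<noteq> k - 1" for vs l x
        using that list_update_swap[OF that] by simp
      have A: "tens scl m (?r (vs[l := x + y])) = tens scl m (?r (vs[l := x])) + tens scl m (?r (vs[l := y]))"
        "tens scl m (?r (vs[l := vscale c x])) = tscale scl c (tens scl m (?r (vs[l := x])))"
        if "vs \<in> vlists n d" "l < d" "x \<in> vecs n" "y \<in> vecs n" for m vs l x y c
      proof -
        have l: "l < length vs" using that by (simp add: vlists_def)
        show "tens scl m (?r (vs[l := x + y])) = tens scl m (?r (vs[l := x])) + tens scl m (?r (vs[l := y]))"
          using T(1)[OF that(1,2) mvc mvc] T(1)[OF cl[OF that(1)] that(2,3,4)]
          by (metis r1 r2 mv(1) l)
        show "tens scl m (?r (vs[l := vscale c x])) = tscale scl c (tens scl m (?r (vs[l := x])))"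
          using T(2)[OF that(1,2) mvc mvc] T(2)[OF cl[OF that(1)] that(2,3,4)]
          by (metis r1 r2 mv(2) l)
      qed
      show ?thesis
        unfolding multilin_def if_not_P[OF False] using M[OF cl] A by blast
    qed
  qed
qed

definition vw_param :: "nat \<Rightarrow> (complex \<Rightarrow> 'm::ab_group_add \<Rightarrow> 'm) \<Rightarrow> (mat \<Rightarrow> 'm \<Rightarrow> 'm) \<Rightarrow>
    mat set \<Rightarrow> (mat \<Rightarrow> mat) \<Rightarrow> nat \<Rightarrow> complex" where
  "vw_param n scl \<rho> B dual k = (THE c. \<forall>f\<in>tspace n 2.
     e_op n 2 scl 1 ((y_op n 2 scl \<rho> B dual 1 ^^ k) (e_op n 2 scl 1 f)) =
     tscale scl c (e_op n 2 scl 1 f))"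

definition g_End :: "nat \<Rightarrow> nat \<Rightarrow> (complex \<Rightarrow> 'm::ab_group_add \<Rightarrow> 'm) \<Rightarrow> (mat \<Rightarrow> 'm \<Rightarrow> 'm) \<Rightarrow>
    (complex, 'm tensor \<Rightarrow> 'm tensor) module" where
  "g_End n d scl \<rho> = (let T = tspace n d in
     \<lparr>carrier = {E \<in> extensional T. E \<in> T \<rightarrow> T \<and>
        (\<forall>f\<in>T. \<forall>g\<in>T. E (f + g) = E f + E g) \<and>
        (\<forall>c. \<forall>f\<in>T. E (tscale scl c f) = tscale scl c (E f)) \<and>
        (\<forall>X\<in>so n. \<forall>f\<in>T. E (g_act n d scl \<rho> X f) = g_act n d scl \<rho> X (E f))},
      mult = compose T, one = (\<lambda>f\<in>T. f), zero = (\<lambda>f\<in>T. 0),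
      add = (\<lambda>E F. \<lambda>f\<in>T. E f + F f),
      smult = (\<lambda>c E. \<lambda>f\<in>T. tscale scl c (E f))\<rparr>)"

end

theory Submission
  imports Defs
begin

text \<open>All operators are computed on the coefficient functions of tensors, which gives the Brauer
  relations and the commutation of \<open>s\<^sub>a\<close>, \<open>e\<^sub>a\<close> with the action of \<open>X \<in> \<gg>\<close> in a single position;
  in particular \<open>X\<^sub>a + X\<^bsub>a+1\<^esub>\<close> is annihilated by \<open>e\<^sub>a\<close> from both sides.
  The Casimir tensor does not depend on the choice of dual bases, so it may be replaced by
  \<open>(\<Sum>p q. F\<^bsub>p,q\<^esub> \<otimes> F\<^bsub>q,p\<^esub>) / 2\<close> with \<open>F\<^bsub>p,q\<^esub> = E\<^bsub>p,q\<^esub> - E\<^bsub>-q,-p\<^esub>\<close>: it acts on adjacent positions as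
  \<open>s - e\<close> and is invariant.  Invariance makes \<open>y\<^sub>i\<close> commute with \<open>\<Sum>k<j. X\<^sub>k\<close> for \<open>i < j\<close>, hence with \<open>y\<^sub>j\<close>
  and with \<open>\<gg>\<close>, and \<open>y\<^bsub>a+1\<^esub> = s\<^sub>a y\<^sub>a s\<^sub>a + s\<^sub>a - e\<^sub>a\<close> yields the remaining relations.

  For the parameters, \<open>e\<^sub>1 y\<^sub>1\<^sup>k e\<^sub>1\<close> factors on \<open>M \<otimes> V \<otimes> V\<close> through the equivariant contraction
  \<open>M \<otimes> V \<otimes> V \<rightarrow> M\<close> and its dual \<open>M \<rightarrow> M \<otimes> V \<otimes> V\<close>, hence is given by an endomorphism of \<open>M\<close>.
  This is a scalar: the diagonal matrix with entries \<open>i\<close> acts on the vectors obtained from the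
  highest weight vector \<open>m\<close> by a nonempty word of lowering operators with eigenvalues differing from
  that of \<open>m\<close> by negative integers, so that the eigenspace of \<open>m\<close> is spanned by \<open>m\<close>.\<close>

section \<open>Coefficient formulas\<close>

text \<open>Three obstacles shape the proof. The letters of a word act from left to right, so a
  relation of the algebra becomes an identity between operators composed in the opposite order.
  Reversal permutes the relations: \<open>s_e_e\<close> and \<open>e_e_s\<close> are exchanged, as
  are \<open>e_s\<close> and \<open>s_e\<close>, or the two skein relations. The scalar has to be
  found from the generating vector m alone, and words in lowering operators must first be shown to
  span M. The parameters are defined on M \<otimes> V \<otimes> V, while the relation is needed in d
  tensor factors; freezing the letters in the remaining positions connects the two.\<close>

lemma tens_Cons:
  assumes "vector_space scl"
  shows "tens scl m (v # vs) (a # u) = scl (v a) (tens scl m vs u)"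
proof -
  interpret vector_space scl by fact
  show ?thesis by (simp add: tens_def prod.lessThan_Suc_shift del: prod.lessThan_Suc)
qed

text \<open>The tail \<open>vs\<close> is arbitrary: after an operator has acted in one position,
  the vector there is a column of its matrix and no longer a basis vector.\<close>

lemma tens_bv_append:
  assumes "vector_space scl" "length xs = length xs'"
  shows "tens scl m (map bv xs @ vs) (xs' @ us) = (if xs = xs' then tens scl m vs us else 0)"
proof -
  interpret vector_space scl by fact
  show ?thesis
    using assms(2)
    by (induction xs xs' rule: list_induct2) (auto simp: tens_Cons[OF assms(1)] bv_def)
qed

lemma tens_map_bv:
  assumes "vector_space scl"
  shows "tens scl m (map bv w) u = (if w = u then m else 0)"
proof -
  interpret vector_space scl by fact
  show ?thesis
    using tens_bv_append[OF assms, of w u m "[]" "[]"]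
    by (cases "length w = length u") (auto simp: tens_def)
qed

lemma tspace_eqI:
  assumes "f \<in> tspace n d" "g \<in> tspace n d" "\<And>u. u \<in> iwords n d \<Longrightarrow> f u = g u"
  shows "f = g"
proof
  fix u show "f u = g u"
    using assms by (cases "u \<in> iwords n d") (auto simp: tspace_def)
qed

section \<open>Cutting words at the positions that an operator touches\<close>

lemma iwords_split1:
  assumes "u \<in> iwords n d" "k < d"
  obtains xs a ys where "u = xs @ a # ys" "length xs = k"
proof -
  have "u = take k u @ u ! k # drop (Suc k) u"
    using assms by (simp add: iwords_def id_take_nth_drop)
  with assms show thesis by (intro that[of "take k u" "u ! k" "drop (Suc k) u"]) (auto simp: iwords_def)
qed

lemma iwords_split2:
  assumes "u \<in> iwords n d" "Suc k < d"
  obtains xs a b ys where "u = xs @ a # b # ys" "length xs = k"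
proof -
  obtain xs a ys where 1: "u = xs @ a # ys" "length xs = k"
    using iwords_split1[OF assms(1) Suc_lessD[OF assms(2)]] by metis
  with assms obtain b zs where "ys = b # zs" by (cases ys) (auto simp: iwords_def)
  with 1 that show thesis by blast
qed

lemma iwords_split3:
  assumes "u \<in> iwords n d" "Suc (Suc k) < d"
  obtains xs a b c ys where "u = xs @ a # b # c # ys" "length xs = k"
proof -
  obtain xs a b ys where 1: "u = xs @ a # b # ys" "length xs = k"
    using iwords_split2[OF assms(1) Suc_lessD[OF assms(2)]] by metis
  with assms obtain c zs where "ys = c # zs" by (cases ys) (auto simp: iwords_def)
  with 1 that show thesis by blast
qed

lemma iwords_split12:
  assumes "u \<in> iwords n d" "k < l" "Suc l < d"
  obtains xs a ys b c zs where "u = xs @ a # ys @ b # c # zs" "length xs = k"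
    "length (xs @ a # ys) = l"
proof -
  obtain xs b c zs where 1: "u = xs @ b # c # zs" "length xs = l"
    using iwords_split2[OF assms(1,3)] by metis
  have "xs \<in> iwords n l" using 1 assms by (auto simp: iwords_def)
  then obtain xs' a ys where "xs = xs' @ a # ys" "length xs' = k"
    using iwords_split1[OF _ assms(2)] by metis
  with 1 that show thesis by auto
qed

lemma iwords_split21:
  assumes "u \<in> iwords n d" "Suc k < l" "l < d"
  obtains xs a b ys c zs where "u = xs @ a # b # ys @ c # zs" "length xs = k"
    "length (xs @ a # b # ys) = l"
proof -
  obtain xs c zs where 1: "u = xs @ c # zs" "length xs = l"
    using iwords_split1[OF assms(1,3)] by metis
  have "xs \<in> iwords n l" using 1 assms by (auto simp: iwords_def)
  then obtain xs' a b ys where "xs = xs' @ a # b # ys" "length xs' = k"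
    using iwords_split2[OF _ assms(2)] by metis
  with 1 that show thesis by auto
qed

lemma iwords_split22:
  assumes "u \<in> iwords n d" "Suc k < l" "Suc l < d"
  obtains xs a b ys c e zs where "u = xs @ a # b # ys @ c # e # zs" "length xs = k"
    "length (xs @ a # b # ys) = l"
proof -
  obtain xs c e zs where 1: "u = xs @ c # e # zs" "length xs = l"
    using iwords_split2[OF assms(1,3)] by metis
  have "xs \<in> iwords n l" using 1 assms by (auto simp: iwords_def)
  then obtain xs' a b ys where "xs = xs' @ a # b # ys" "length xs' = k"
    using iwords_split2[OF _ assms(2)] by metis
  with 1 that show thesis by auto
qed

lemma iwords_split11:
  assumes "u \<in> iwords n d" "k < l" "l < d"
  obtains xs a ys b zs where "u = xs @ a # ys @ b # zs" "length xs = k"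
    "length (xs @ a # ys) = l"
proof -
  obtain xs b zs where 1: "u = xs @ b # zs" "length xs = l"
    using iwords_split1[OF assms(1,3)] by metis
  have "xs \<in> iwords n l" using 1 assms by (auto simp: iwords_def)
  then obtain xs' a ys where "xs = xs' @ a # ys" "length xs' = k"
    using iwords_split1[OF _ assms(2)] by metis
  with 1 that show thesis by auto
qed

lemma tens_tspace:
  assumes "vector_space scl" "vs \<in> vlists n d"
  shows "tens scl m vs \<in> tspace n d"
  unfolding tspace_def
proof (intro CollectI allI impI)
  fix u assume u: "u \<notin> iwords n d"
  interpret vector_space scl by fact
  show "tens scl m vs u = 0"
  proof (cases "length u = d")
    case True
    with u obtain k where k: "k < d" "u ! k \<notin> idx n"
      by (auto simp: iwords_def set_conv_nth)
    moreover have "vs ! k \<in> vecs n" using assms(2) k by (auto simp: vlists_def)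
    ultimately have "(vs ! k) (u ! k) = 0" by (auto simp: vecs_def)
    then have "(\<Prod>k<d. (vs ! k) (u ! k)) = 0" using k by auto
    then show ?thesis using assms(2) by (simp add: tens_def vlists_def)
  qed (use assms in \<open>simp add: tens_def vlists_def\<close>)
qed

lemma tspace_closed:
  fixes f g :: "'m::ab_group_add tensor"
  shows "(0::'m tensor) \<in> tspace n d"
    "f \<in> tspace n d \<Longrightarrow> g \<in> tspace n d \<Longrightarrow> f + g \<in> tspace n d"
    "f \<in> tspace n d \<Longrightarrow> g \<in> tspace n d \<Longrightarrow> f - g \<in> tspace n d"
    "f \<in> tspace n d \<Longrightarrow> - f \<in> tspace n d"
  by (auto simp: tspace_def)

lemma tspace_sum:
  fixes g :: "'i \<Rightarrow> 'm::ab_group_add tensor"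
  shows "(\<And>i. i \<in> S \<Longrightarrow> g i \<in> tspace n d) \<Longrightarrow> sum g S \<in> tspace n d"
  by (induction S rule: infinite_finite_induct) (auto intro: tspace_closed)

text \<open>For an operator in one position, only those words contribute that agree with the given
  word outside this position.\<close>

lemma sum_iwords_slot:
  fixes F :: "int list \<Rightarrow> 'x::comm_monoid_add"
  assumes "set xs \<subseteq> idx n" "set ys \<subseteq> idx n" "length xs + length ys + 1 = d"
    and "\<And>w. w \<in> iwords n d \<Longrightarrow> (\<And>j. w \<noteq> xs @ j # ys) \<Longrightarrow> F w = 0"
  shows "sum F (iwords n d) = (\<Sum>j\<in>idx n. F (xs @ j # ys))"
proof -
  have "sum F (iwords n d) = sum F ((\<lambda>j. xs @ j # ys) ` idx n)"
  proof (rule sum.mono_neutral_right[OF finite_iwords])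
    show "(\<lambda>j. xs @ j # ys) ` idx n \<subseteq> iwords n d" using assms by (auto simp: iwords_def)
    show "\<forall>w\<in>iwords n d - (\<lambda>j. xs @ j # ys) ` idx n. F w = 0"
    proof
      fix w assume w: "w \<in> iwords n d - (\<lambda>j. xs @ j # ys) ` idx n"
      then have "w \<noteq> xs @ j # ys" for j by (auto simp: iwords_def)
      with w assms(4) show "F w = 0" by blast
    qed
  qed
  also have "\<dots> = (\<Sum>j\<in>idx n. F (xs @ j # ys))"
    by (subst sum.reindex) (auto simp: inj_on_def)
  finally show ?thesis .
qed

section \<open>The operators on coefficient functions\<close>

context so_module
begin

lemma vector_space_scl: "vector_space scl"
  by unfold_locales

sublocale t: vector_space "tscale scl"
  by (rule vector_space_tscale[OF vector_space_scl])

lemma tspace_scale: "f \<in> tspace n d \<Longrightarrow> tscale scl c f \<in> tspace n d"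
  by (auto simp: tspace_def tscale_def)

text \<open>Exchanging two letters is an involution on words, so the coefficient function is pulled
  back along it. Writing the position as \<open>Suc (length xs)\<close> turns the truncated
  \<open>i - 1\<close> of the definition into the length of the prefix.\<close>

lemma s_op_coeff:
  assumes "xs @ a # b # ys \<in> iwords n d"
  shows "s_op n d scl (Suc (length xs)) f (xs @ a # b # ys) = f (xs @ b # a # ys)"
proof -
  let ?k = "length xs"
  have len: "Suc ?k < d" using assms by (auto simp: iwords_def)
  have "tens scl (f w) ((map bv w)[?k := map bv w ! Suc ?k, Suc ?k := map bv w ! ?k]) (xs @ a # b # ys) =
    (if w = xs @ b # a # ys then f w else 0)" if w: "w \<in> iwords n d" for w
  proof -
    obtain xs' a' b' ys' where w': "w = xs' @ a' # b' # ys'" "length xs' = ?k"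
      by (rule iwords_split2[OF w len])
    have 1: "(map bv w)[?k := map bv w ! Suc ?k, Suc ?k := map bv w ! ?k] = map bv (xs' @ b' # a' # ys')"
      unfolding w'(1) w'(2)[symmetric] by (simp add: list_update_append nth_append)
    show ?thesis unfolding 1 tens_map_bv[OF vector_space_scl] using w' by auto
  qed
  then have "s_op n d scl (Suc ?k) f (xs @ a # b # ys) =
    (\<Sum>w\<in>iwords n d. if w = xs @ b # a # ys then f w else 0)"
    by (simp add: s_op_def tlift_def sum_tensor_apply cong: sum.cong)
  also have "\<dots> = f (xs @ b # a # ys)"
    using assms by (simp add: finite_iwords) (auto simp: iwords_def)
  finally show ?thesis .
qed

lemma s_op_tspace:
  assumes "Suc k < d"
  shows "s_op n d scl (Suc k) f \<in> tspace n d"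
proof -
  have "(map bv w)[k := map bv w ! Suc k, Suc k := map bv w ! k] \<in> vlists n d" if "w \<in> iwords n d" for w
    using that assms by (intro vlists_update vlists_bv) (auto simp: iwords_def intro!: vecs_bv)
  then show ?thesis
    unfolding s_op_def tlift_def by (intro tspace_sum) (simp add: tens_tspace[OF vector_space_scl])
qed

lemma bform_bv: "i \<in> idx n \<Longrightarrow> bform n (bv i) (bv j) = (if i = - j then 1 else 0)"
  by (auto simp: bform_def bv_def if_distrib[of "\<lambda>t. t * _"] finite_idx cong: if_cong)

text \<open>This is \<tau> on coefficients: the two slots are contracted by a sum over opposite
  letters, and the result is placed on every pair of opposite letters.\<close>

lemma e_op_coeff:
  assumes "xs @ a # b # ys \<in> iwords n d"
  shows "e_op n d scl (Suc (length xs)) f (xs @ a # b # ys) =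
    (if a = - b then \<Sum>j\<in>idx n. f (xs @ j # - j # ys) else 0)"
proof -
  let ?k = "length xs" and ?u = "xs @ a # b # ys"
  \<comment> \<open>A word contributes exactly if it agrees with the target outside the two slots
    and has opposite letters in them; \<open>?F\<close> is f cut down to these words.\<close>
  let ?F = "\<lambda>w. if \<exists>j. w = xs @ j # - j # ys then f w else 0"
  have len: "Suc ?k < d" using assms by (auto simp: iwords_def)
  have trm: "tscale scl (bform n (map bv w ! ?k) (map bv w ! Suc ?k))
     (\<Sum>j\<in>idx n. tens scl (f w) ((map bv w)[?k := bv j, Suc ?k := bv (- j)])) ?u =
    (if a = - b then ?F w else 0)" if w: "w \<in> iwords n d" for w
  proof -
    obtain xs' a' b' ys' where w': "w = xs' @ a' # b' # ys'" "length xs' = ?k"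
      by (rule iwords_split2[OF w len])
    have 1: "(map bv w)[?k := bv j, Suc ?k := bv (- j)] = map bv (xs' @ j # - j # ys')" for j
      unfolding w'(1) w'(2)[symmetric] by (simp add: list_update_append)
    have "a' \<in> idx n" using w w' by (auto simp: iwords_def)
    then have 2: "bform n (map bv w ! ?k) (map bv w ! Suc ?k) = (if a' = - b' then 1 else 0)"
      unfolding w'(1) w'(2)[symmetric] by (simp add: nth_append bform_bv)
    have "(\<Sum>j\<in>idx n. tens scl (f w) ((map bv w)[?k := bv j, Suc ?k := bv (- j)])) ?u =
      (\<Sum>j\<in>idx n. if j = a then (if b = - a \<and> xs = xs' \<and> ys = ys' then f w else 0) else 0)"
      unfolding 1 sum_tensor_apply tens_map_bv[OF vector_space_scl] using w'(2) by (intro sum.cong) auto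
    also have "\<dots> = (if b = - a \<and> xs = xs' \<and> ys = ys' then f w else 0)"
      using assms by (simp add: finite_idx iwords_def)
    finally have 3: "(\<Sum>j\<in>idx n. tens scl (f w) ((map bv w)[?k := bv j, Suc ?k := bv (- j)])) ?u =
      (if b = - a \<and> xs = xs' \<and> ys = ys' then f w else 0)" .
    have 4: "(\<exists>j. w = xs @ j # - j # ys) \<longleftrightarrow> a' = - b' \<and> xs = xs' \<and> ys = ys'"
      using w' by auto
    show ?thesis unfolding tscale_def 2 3 4 by auto
  qed
  have "e_op n d scl (Suc ?k) f ?u = (\<Sum>w\<in>iwords n d. if a = - b then ?F w else 0)"
    by (simp only: e_op_def tlift_def sum_tensor_apply diff_Suc_1 trm cong: sum.cong)
  also have "\<dots> = (if a = - b then \<Sum>w\<in>iwords n d. ?F w else 0)" by simp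
  also have "(\<Sum>w\<in>iwords n d. ?F w) = (\<Sum>w\<in>(\<lambda>j. xs @ j # - j # ys) ` idx n. f w)"
  proof -
    have "{w \<in> iwords n d. \<exists>j. w = xs @ j # - j # ys} = (\<lambda>j. xs @ j # - j # ys) ` idx n"
    proof (intro equalityI subsetI)
      fix w assume "w \<in> {w \<in> iwords n d. \<exists>j. w = xs @ j # - j # ys}"
      then obtain j where "w \<in> iwords n d" "w = xs @ j # - j # ys" by blast
      then show "w \<in> (\<lambda>j. xs @ j # - j # ys) ` idx n" by (intro image_eqI[of _ _ j]) (simp_all add: iwords_def)
    next
      fix w assume "w \<in> (\<lambda>j. xs @ j # - j # ys) ` idx n"
      then obtain j where "j \<in> idx n" "w = xs @ j # - j # ys" by blast
      then show "w \<in> {w \<in> iwords n d. \<exists>j. w = xs @ j # - j # ys}"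
        using assms by (auto simp: iwords_def idx_uminus)
    qed
    then show ?thesis by (simp add: sum.inter_filter[OF finite_iwords, symmetric])
  qed
  also have "\<dots> = (\<Sum>j\<in>idx n. f (xs @ j # - j # ys))"
    by (subst sum.reindex) (auto simp: inj_on_def)
  finally show ?thesis .
qed

lemma e_op_tspace:
  assumes "Suc k < d"
  shows "e_op n d scl (Suc k) f \<in> tspace n d"
proof -
  have "(map bv w)[k := bv j, Suc k := bv (- j)] \<in> vlists n d" if "w \<in> iwords n d" "j \<in> idx n" for w j
    using that assms by (intro vlists_update vlists_bv) (auto intro!: vecs_bv simp: idx_uminus)
  then show ?thesis
    unfolding e_op_def tlift_def
    by (intro tspace_sum tspace_scale) (simp add: tens_tspace[OF vector_space_scl])
qed

lemma rho_zero: "X \<in> so n \<Longrightarrow> \<rho> X 0 = 0"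
  using Vector_Spaces.linear.axioms[OF rho_linear] module_hom.zero[OF Vector_Spaces.linear.axioms(3)[OF rho_linear]]
  by blast

lemma rho_linear_simps:
  assumes "X \<in> so n"
  shows "\<rho> X (x + y) = \<rho> X x + \<rho> X y" "\<rho> X (x - y) = \<rho> X x - \<rho> X y" "\<rho> X (scl c x) = scl c (\<rho> X x)"
    "\<rho> X (sum g S) = (\<Sum>i\<in>S. \<rho> X (g i))"
proof -
  interpret Vector_Spaces.linear scl scl "\<rho> X" by (rule rho_linear[OF assms])
  show "\<rho> X (x + y) = \<rho> X x + \<rho> X y" "\<rho> X (x - y) = \<rho> X x - \<rho> X y" "\<rho> X (scl c x) = scl c (\<rho> X x)"
    "\<rho> X (sum g S) = (\<Sum>i\<in>S. \<rho> X (g i))"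
    by (simp_all add: add diff scale sum)
qed

lemma pos_act_0:
  assumes "u \<in> iwords n d"
  shows "pos_act n d scl \<rho> X 0 f u = \<rho> X (f u)"
proof -
  have "pos_act n d scl \<rho> X 0 f u = (\<Sum>w\<in>iwords n d. if w = u then \<rho> X (f w) else 0)"
    by (simp add: pos_act_def tlift_def sum_tensor_apply tens_map_bv[OF vector_space_scl] cong: if_cong)
  then show ?thesis using assms by (simp add: finite_iwords)
qed

lemma pos_act_coeff:
  assumes "xs @ a # ys \<in> iwords n d"
  shows "pos_act n d scl \<rho> X (Suc (length xs)) f (xs @ a # ys) =
    (\<Sum>j\<in>idx n. scl (X a j) (f (xs @ j # ys)))"
proof -
  let ?k = "length xs" and ?u = "xs @ a # ys"
  let ?F = "\<lambda>w. tens scl (f w) ((map bv w)[?k := mat_vec n X (map bv w ! ?k)]) ?u"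
  have F: "?F (xs' @ a' # ys') = (if xs' = xs \<and> ys' = ys then scl (X a a') (f (xs' @ a' # ys')) else 0)"
    if "a' \<in> idx n" "length xs' = ?k" for xs' a' ys'
  proof -
    have "(map bv (xs' @ a' # ys'))[?k := mat_vec n X (map bv (xs' @ a' # ys') ! ?k)] =
      map bv xs' @ (\<lambda>i. X i a') # map bv ys'"
      unfolding that(2)[symmetric] by (simp add: list_update_append nth_append mat_vec_bv that(1))
    then show ?thesis
      using that(2) by (simp add: tens_bv_append[OF vector_space_scl] tens_Cons[OF vector_space_scl] tens_map_bv[OF vector_space_scl])
  qed
  have "pos_act n d scl \<rho> X (Suc ?k) f ?u = sum ?F (iwords n d)"
    by (simp add: pos_act_def tlift_def sum_tensor_apply)
  also have "\<dots> = (\<Sum>j\<in>idx n. ?F (xs @ j # ys))"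
  proof (rule sum_iwords_slot)
    fix w assume w: "w \<in> iwords n d" and no: "\<And>j. w \<noteq> xs @ j # ys"
    obtain xs' a' ys' where w': "w = xs' @ a' # ys'" "length xs' = ?k"
      using iwords_split1[OF w, of ?k] assms by (auto simp: iwords_def)
    moreover have "a' \<in> idx n" using w w' by (auto simp: iwords_def)
    ultimately show "?F w = 0" using F[of a' xs' ys'] no by auto
  qed (use assms in \<open>auto simp: iwords_def\<close>)
  also have "\<dots> = (\<Sum>j\<in>idx n. scl (X a j) (f (xs @ j # ys)))"
    by (intro sum.cong refl) (simp only: F simp_thms if_True)
  finally show ?thesis .
qed

lemma pos_act_tspace:
  assumes "X \<in> so n"
  shows "pos_act n d scl \<rho> X k f \<in> tspace n d"
proof -
  have mv: "mat_vec n X v \<in> vecs n" for v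
    using assms by (auto simp: so_def gl_def vecs_def mat_vec_def)
  show ?thesis
    unfolding pos_act_def tlift_def
  proof (intro tspace_sum)
    fix w assume "w \<in> iwords n d"
    then show "(if k = 0 then tens scl (\<rho> X (f w)) (map bv w)
         else tens scl (f w) ((map bv w)[k - 1 := mat_vec n X (map bv w ! (k - 1))])) \<in> tspace n d"
      by (auto intro!: tens_tspace[OF vector_space_scl] vlists_update vlists_bv mv)
  qed
qed

end

section \<open>The Brauer relations\<close>

context so_module
begin

lemma s_op_at0:
  assumes "xs @ a # b # ys \<in> iwords n d" "length xs = k"
  shows "s_op n d scl (Suc k) f (xs @ a # b # ys) = f (xs @ b # a # ys)"
  using s_op_coeff[OF assms(1)] assms(2) by simp

lemma s_op_at1:
  assumes "xs @ a # b # c # ys \<in> iwords n d" "length xs = k"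
  shows "s_op n d scl (Suc (Suc k)) f (xs @ a # b # c # ys) = f (xs @ a # c # b # ys)"
  using s_op_coeff[of "xs @ [a]" b c ys d f] assms by simp

lemma e_op_at0:
  assumes "xs @ a # b # ys \<in> iwords n d" "length xs = k"
  shows "e_op n d scl (Suc k) f (xs @ a # b # ys) =
    (if a = - b then \<Sum>j\<in>idx n. f (xs @ j # - j # ys) else 0)"
  using e_op_coeff[OF assms(1)] assms(2) by simp

lemma e_op_at1:
  assumes "xs @ a # b # c # ys \<in> iwords n d" "length xs = k"
  shows "e_op n d scl (Suc (Suc k)) f (xs @ a # b # c # ys) =
    (if b = - c then \<Sum>j\<in>idx n. f (xs @ a # j # - j # ys) else 0)"
  using e_op_coeff[of "xs @ [a]" b c ys d f] assms by simp

lemma pos_act_at0: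
  assumes "xs @ a # ys \<in> iwords n d" "length xs = k"
  shows "pos_act n d scl \<rho> X (Suc k) f (xs @ a # ys) = (\<Sum>j\<in>idx n. scl (X a j) (f (xs @ j # ys)))"
  using pos_act_coeff[OF assms(1)] assms(2) by simp

lemma pos_act_at1:
  assumes "xs @ a # b # ys \<in> iwords n d" "length xs = k"
  shows "pos_act n d scl \<rho> X (Suc (Suc k)) f (xs @ a # b # ys) =
    (\<Sum>j\<in>idx n. scl (X b j) (f (xs @ a # j # ys)))"
  using pos_act_coeff[of "xs @ [a]" b ys d X f] assms by simp

lemmas at_simps = s_op_at0 s_op_at1 e_op_at0 e_op_at1 pos_act_at0 pos_act_at1

lemma s_op_s_op:
  assumes "Suc k < d" "f \<in> tspace n d"
  shows "s_op n d scl (Suc k) (s_op n d scl (Suc k) f) = f"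
proof (rule tspace_eqI[OF s_op_tspace[OF assms(1)] assms(2)])
  fix u assume u: "u \<in> iwords n d"
  obtain xs a b ys where "u = xs @ a # b # ys" "length xs = k"
    by (rule iwords_split2[OF u assms(1)])
  with u show "s_op n d scl (Suc k) (s_op n d scl (Suc k) f) u = f u"
    by (simp add: at_simps iwords_def)
qed

lemma s_op_braid:
  assumes "Suc (Suc k) < d"
  shows "s_op n d scl (Suc k) (s_op n d scl (Suc (Suc k)) (s_op n d scl (Suc k) f)) =
    s_op n d scl (Suc (Suc k)) (s_op n d scl (Suc k) (s_op n d scl (Suc (Suc k)) f))"
proof (rule tspace_eqI[OF s_op_tspace s_op_tspace])
  fix u assume u: "u \<in> iwords n d"
  obtain xs a b c ys where "u = xs @ a # b # c # ys" "length xs = k"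
    by (rule iwords_split3[OF u assms(1)])
  with u show "s_op n d scl (Suc k) (s_op n d scl (Suc (Suc k)) (s_op n d scl (Suc k) f)) u =
    s_op n d scl (Suc (Suc k)) (s_op n d scl (Suc k) (s_op n d scl (Suc (Suc k)) f)) u"
    by (simp add: at_simps iwords_def)
qed (use assms in auto)

text \<open>The scalar is the dimension of V: contracting the sum of the v_j \<otimes> v_{-j} counts
  the indices.\<close>

lemma e_op_e_op:
  assumes "Suc k < d"
  shows "e_op n d scl (Suc k) (e_op n d scl (Suc k) f) = tscale scl (of_nat (2 * n)) (e_op n d scl (Suc k) f)"
proof (rule tspace_eqI[OF e_op_tspace[OF assms(1)] tspace_scale[OF e_op_tspace[OF assms(1)]]])
  fix u assume u: "u \<in> iwords n d"
  have "idx n = {- int n..-1} \<union> {1..int n}" by (auto simp: idx_def)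
  then have c: "card (idx n) = 2 * n" by (simp add: card_Un_disjoint)
  have s: "(\<Sum>j\<in>S. x) = scl (of_nat (card S)) x" if "finite S" for S :: "int set" and x
    using that by (induction S rule: finite_induct) (simp_all add: scale_left_distrib)
  obtain xs a b ys where "u = xs @ a # b # ys" "length xs = k"
    by (rule iwords_split2[OF u assms(1)])
  with u show "e_op n d scl (Suc k) (e_op n d scl (Suc k) f) u = tscale scl (of_nat (2 * n)) (e_op n d scl (Suc k) f) u"
    by (auto simp: at_simps iwords_def tscale_def idx_uminus s[OF finite_idx] c cong: sum.cong)
qed

text \<open>The form is symmetric: exchanging the slots replaces j by -j in the contraction.\<close>

lemma e_op_s_op:
  assumes "Suc k < d"
  shows "e_op n d scl (Suc k) (s_op n d scl (Suc k) f) = e_op n d scl (Suc k) f"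
proof (rule tspace_eqI[OF e_op_tspace[OF assms(1)] e_op_tspace[OF assms(1)]])
  fix u assume u: "u \<in> iwords n d"
  obtain xs a b ys where u': "u = xs @ a # b # ys" "length xs = k"
    by (rule iwords_split2[OF u assms(1)])
  have "(\<Sum>j\<in>idx n. f (xs @ - j # j # ys)) = (\<Sum>j\<in>idx n. f (xs @ j # - j # ys))"
    by (rule sum.reindex_bij_witness[of _ uminus uminus]) (auto simp: idx_uminus)
  with u u' show "e_op n d scl (Suc k) (s_op n d scl (Suc k) f) u = e_op n d scl (Suc k) f u"
    by (auto simp: at_simps iwords_def idx_uminus cong: sum.cong)
qed

lemma s_op_e_op:
  assumes "Suc k < d"
  shows "s_op n d scl (Suc k) (e_op n d scl (Suc k) f) = e_op n d scl (Suc k) f"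
proof (rule tspace_eqI[OF s_op_tspace[OF assms(1)] e_op_tspace[OF assms(1)]])
  fix u assume u: "u \<in> iwords n d"
  obtain xs a b ys where u': "u = xs @ a # b # ys" "length xs = k"
    by (rule iwords_split2[OF u assms(1)])
  with u show "s_op n d scl (Suc k) (e_op n d scl (Suc k) f) u = e_op n d scl (Suc k) f u"
    by (auto simp: at_simps iwords_def)
qed

text \<open>These are identities of Brauer diagrams on three strands. In each of them the left side
  contains nested contractions, and the Kronecker delta produced by one contraction collapses the
  sum of another.\<close>

lemma brauer_relations:
  fixes f :: "'m tensor"
  assumes "Suc (Suc k) < d"
  defines "s \<equiv> s_op n d scl (Suc k)" and "s' \<equiv> s_op n d scl (Suc (Suc k))"
    and "e \<equiv> e_op n d scl (Suc k)" and "e' \<equiv> e_op n d scl (Suc (Suc k))"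
  shows "e (e' (s f)) = e (s' f)" "s (e' (e f)) = s' (e f)"
    "s' (e (e' f)) = s (e' f)" "e' (e (s' f)) = e' (s f)"
    "e' (e (e' f)) = e' f" "e (e' (e f)) = e f"
proof -
  have T: "s g \<in> tspace n d" "s' g \<in> tspace n d" "e g \<in> tspace n d" "e' g \<in> tspace n d" for g
    using assms(1) by (auto simp: assms(2-5) intro: s_op_tspace e_op_tspace)
  show "e (e' (s f)) = e (s' f)"
  proof (rule tspace_eqI[OF T(3,3)])
    fix u assume u: "u \<in> iwords n d"
    obtain xs a b c ys where "u = xs @ a # b # c # ys" "length xs = k"
      by (rule iwords_split3[OF u assms(1)])
    with u show "e (e' (s f)) u = e (s' f) u"
      by (auto simp: assms(2-5) at_simps iwords_def idx_uminus finite_idx cong: sum.cong)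
  qed
  show "s (e' (e f)) = s' (e f)"
  proof (rule tspace_eqI[OF T(1,2)])
    fix u assume u: "u \<in> iwords n d"
    obtain xs a b c ys where "u = xs @ a # b # c # ys" "length xs = k"
      by (rule iwords_split3[OF u assms(1)])
    with u show "s (e' (e f)) u = s' (e f) u"
      by (auto simp: assms(2-5) at_simps iwords_def idx_uminus finite_idx equation_minus_iff[of b] cong: sum.cong)
  qed
  show "s' (e (e' f)) = s (e' f)"
  proof (rule tspace_eqI[OF T(2,1)])
    fix u assume u: "u \<in> iwords n d"
    obtain xs a b c ys where "u = xs @ a # b # c # ys" "length xs = k"
      by (rule iwords_split3[OF u assms(1)])
    with u show "s' (e (e' f)) u = s (e' f) u"
      by (auto simp: assms(2-5) at_simps iwords_def idx_uminus finite_idx cong: sum.cong)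
  qed
  show "e' (e (s' f)) = e' (s f)"
  proof (rule tspace_eqI[OF T(4,4)])
    fix u assume u: "u \<in> iwords n d"
    obtain xs a b c ys where u': "u = xs @ a # b # c # ys" "length xs = k"
      by (rule iwords_split3[OF u assms(1)])
    with u have "a \<in> idx n" by (auto simp: iwords_def)
    with u u' show "e' (e (s' f)) u = e' (s f) u"
      by (auto simp: assms(2-5) at_simps iwords_def idx_uminus finite_idx equation_minus_iff[of a]
        cong: sum.cong intro: sum.reindex_bij_witness[of _ uminus uminus])
  qed
  show "e' (e (e' f)) = e' f"
  proof (rule tspace_eqI[OF T(4,4)])
    fix u assume u: "u \<in> iwords n d"
    obtain xs a b c ys where "u = xs @ a # b # c # ys" "length xs = k"
      by (rule iwords_split3[OF u assms(1)])
    with u show "e' (e (e' f)) u = e' f u"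
      by (auto simp: assms(2-5) at_simps iwords_def idx_uminus finite_idx equation_minus_iff[of a] cong: sum.cong)
  qed
  show "e (e' (e f)) = e f"
  proof (rule tspace_eqI[OF T(3,3)])
    fix u assume u: "u \<in> iwords n d"
    obtain xs a b c ys where "u = xs @ a # b # c # ys" "length xs = k"
      by (rule iwords_split3[OF u assms(1)])
    with u show "e (e' (e f)) u = e f u"
      by (auto simp: assms(2-5) at_simps iwords_def idx_uminus finite_idx equation_minus_iff[of c] cong: sum.cong)
  qed
qed

text \<open>Words are cut from the left, so the order k < l is fixed. The mixed relation then occurs
  twice, with s to the left of e and with e to the left of s.\<close>

lemma far_comm:
  fixes f :: "'m tensor"
  assumes "Suc k < l" "Suc l < d"
  shows "s_op n d scl (Suc k) (s_op n d scl (Suc l) f) = s_op n d scl (Suc l) (s_op n d scl (Suc k) f)"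
    "s_op n d scl (Suc k) (e_op n d scl (Suc l) f) = e_op n d scl (Suc l) (s_op n d scl (Suc k) f)"
    "e_op n d scl (Suc k) (s_op n d scl (Suc l) f) = s_op n d scl (Suc l) (e_op n d scl (Suc k) f)"
    "e_op n d scl (Suc k) (e_op n d scl (Suc l) f) = e_op n d scl (Suc l) (e_op n d scl (Suc k) f)"
proof -
  have k: "Suc k < d" using assms by simp
  note T = s_op_tspace[OF k] s_op_tspace[OF assms(2)] e_op_tspace[OF k] e_op_tspace[OF assms(2)]
  have *: "s_op n d scl (Suc k) (s_op n d scl (Suc l) f) u = s_op n d scl (Suc l) (s_op n d scl (Suc k) f) u"
    "s_op n d scl (Suc k) (e_op n d scl (Suc l) f) u = e_op n d scl (Suc l) (s_op n d scl (Suc k) f) u"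
    "e_op n d scl (Suc k) (s_op n d scl (Suc l) f) u = s_op n d scl (Suc l) (e_op n d scl (Suc k) f) u"
    "e_op n d scl (Suc k) (e_op n d scl (Suc l) f) u = e_op n d scl (Suc l) (e_op n d scl (Suc k) f) u"
    if u: "u \<in> iwords n d" for u
  proof -
    obtain xs a b ys p q zs where u': "u = xs @ a # b # ys @ p # q # zs" "length xs = k"
      and l: "l = Suc (Suc (k + length ys))"
      by (rule iwords_split22[OF u assms]) auto
    have S: "s_op n d scl (Suc l) g (xs @ i # j # ys @ r # t # zs) = g (xs @ i # j # ys @ t # r # zs)"
      and E: "e_op n d scl (Suc l) g (xs @ i # j # ys @ r # t # zs) =
        (if r = - t then \<Sum>r\<in>idx n. g (xs @ i # j # ys @ r # - r # zs) else 0)"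
      if "i \<in> idx n" "j \<in> idx n" "r \<in> idx n" "t \<in> idx n" for i j r t g
      using s_op_coeff[of "xs @ i # j # ys" r t zs d g] e_op_coeff[of "xs @ i # j # ys" r t zs d g] that u u'
      by (simp_all add: iwords_def l)
    show "s_op n d scl (Suc k) (s_op n d scl (Suc l) f) u = s_op n d scl (Suc l) (s_op n d scl (Suc k) f) u"
      "s_op n d scl (Suc k) (e_op n d scl (Suc l) f) u = e_op n d scl (Suc l) (s_op n d scl (Suc k) f) u"
      "e_op n d scl (Suc k) (s_op n d scl (Suc l) f) u = s_op n d scl (Suc l) (e_op n d scl (Suc k) f) u"
      using u u' by (auto simp: s_op_at0 e_op_at0 S E iwords_def idx_uminus cong: sum.cong)
    show "e_op n d scl (Suc k) (e_op n d scl (Suc l) f) u = e_op n d scl (Suc l) (e_op n d scl (Suc k) f) u"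
    proof -
      have W: "xs @ i # j # ys @ r # t # zs \<in> iwords n d"
        if "i \<in> idx n" "j \<in> idx n" "r \<in> idx n" "t \<in> idx n" for i j r t
        using that u u' by (auto simp: iwords_def)
      have "a \<in> idx n" "b \<in> idx n" "p \<in> idx n" "q \<in> idx n" using u u' by (auto simp: iwords_def)
      then show ?thesis
        by (simp add: u'(1) e_op_at0[OF W u'(2)] E idx_uminus cong: sum.cong) (auto intro: sum.swap)
    qed
  qed
  show "s_op n d scl (Suc k) (s_op n d scl (Suc l) f) = s_op n d scl (Suc l) (s_op n d scl (Suc k) f)"
    by (rule tspace_eqI[OF T(1,2) *(1)])
  show "s_op n d scl (Suc k) (e_op n d scl (Suc l) f) = e_op n d scl (Suc l) (s_op n d scl (Suc k) f)"
    by (rule tspace_eqI[OF T(1,4) *(2)])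
  show "e_op n d scl (Suc k) (s_op n d scl (Suc l) f) = s_op n d scl (Suc l) (e_op n d scl (Suc k) f)"
    by (rule tspace_eqI[OF T(3,2) *(3)])
  show "e_op n d scl (Suc k) (e_op n d scl (Suc l) f) = e_op n d scl (Suc l) (e_op n d scl (Suc k) f)"
    by (rule tspace_eqI[OF T(3,4) *(4)])
qed

end

section \<open>Operators acting in one tensor position\<close>

lemma additive_sum:
  fixes F :: "'a::ab_group_add \<Rightarrow> 'b::ab_group_add"
  assumes "\<And>x y. F (x + y) = F x + F y"
  shows "F (sum g S) = (\<Sum>i\<in>S. F (g i))" "F (x - y) = F x - F y" "F 0 = 0" "F (- x) = - F x"
proof -
  interpret additive F by unfold_locales (rule assms)
  show "F (sum g S) = (\<Sum>i\<in>S. F (g i))" "F (x - y) = F x - F y" "F 0 = 0" "F (- x) = - F x"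
    by (simp_all add: sum diff zero minus)
qed

lemma lie_apply: "lie n X Y i j = (\<Sum>k\<in>idx n. X i k * Y k j) - (\<Sum>k\<in>idx n. Y i k * X k j)"
  by (simp add: lie_def mat_mul_def)

lemma so_lie:
  assumes "X \<in> so n" "Y \<in> so n"
  shows "lie n X Y \<in> so n"
  unfolding so_iff
proof (intro conjI ballI)
  have XY: "\<And>i j. i \<in> idx n \<Longrightarrow> j \<in> idx n \<Longrightarrow> X (- j) (- i) = - X i j"
    "\<And>i j. i \<in> idx n \<Longrightarrow> j \<in> idx n \<Longrightarrow> Y (- j) (- i) = - Y i j"
    using assms unfolding so_iff by auto
  show "lie n X Y \<in> gl n"
    using assms by (auto simp: so_iff gl_def lie_apply)
  fix i j assume ij: "i \<in> idx n" "j \<in> idx n"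
  \<comment> \<open>Reflection in the antidiagonal reverses products, and the two signs cancel;
    hence the commutator of skew matrices is skew.\<close>
  have "(\<Sum>k\<in>idx n. A (- j) k * B k (- i)) = (\<Sum>k\<in>idx n. B i k * A k j)"
    if "\<And>i j. i \<in> idx n \<Longrightarrow> j \<in> idx n \<Longrightarrow> A (- j) (- i) = - A i j"
      "\<And>i j. i \<in> idx n \<Longrightarrow> j \<in> idx n \<Longrightarrow> B (- j) (- i) = - B i j" for A B :: mat
  proof -
    have "(\<Sum>k\<in>idx n. A (- j) k * B k (- i)) = (\<Sum>k\<in>idx n. A (- j) (- k) * B (- k) (- i))"
      by (rule sum.reindex_bij_witness[of _ uminus uminus]) (auto simp: idx_uminus)
    also have "\<dots> = (\<Sum>k\<in>idx n. B i k * A k j)"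
      using ij by (intro sum.cong) (auto simp: that)
    finally show ?thesis .
  qed
  from this[of X Y, OF XY] this[of Y X, OF XY(2,1)] show "lie n X Y (- j) (- i) = - lie n X Y i j"
    by (simp add: lie_apply)
qed

lemma so_subspace: "mat.subspace (so n)"
  by (auto simp: mat.subspace_def so_iff gl_def mscale_def)

lemmas so_closed = mat.subspace_add[OF so_subspace] mat.subspace_scale[OF so_subspace]
  mat.subspace_diff[OF so_subspace] mat.subspace_neg[OF so_subspace] mat.subspace_0[OF so_subspace]
  mat.subspace_sum[OF so_subspace] so_lie

lemma so_neg_iff:
  assumes "X \<in> so n" "a \<in> idx n" "b \<in> idx n"
  shows "X (- a) b = - X (- b) a" "X a (- b) = - X b (- a)"
proof -
  have N: "X (- j) (- i) = - X i j" if "i \<in> idx n" "j \<in> idx n" for i j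
    using assms(1) that unfolding so_iff by blast
  show "X (- a) b = - X (- b) a" "X a (- b) = - X b (- a)"
    using N[of "- b" a] N[of a "- b"] assms(2,3) by (simp_all add: idx_uminus)
qed

context so_module
begin

abbreviation P :: "nat \<Rightarrow> mat \<Rightarrow> nat \<Rightarrow> 'm tensor \<Rightarrow> 'm tensor" where
  "P d X k \<equiv> pos_act n d scl \<rho> X k"

lemma s_op_add:
  assumes "Suc k < d"
  shows "s_op n d scl (Suc k) (f + g) = s_op n d scl (Suc k) f + s_op n d scl (Suc k) g"
    "s_op n d scl (Suc k) (tscale scl c f) = tscale scl c (s_op n d scl (Suc k) f)"
proof -
  note T = s_op_tspace[OF assms]
  show "s_op n d scl (Suc k) (f + g) = s_op n d scl (Suc k) f + s_op n d scl (Suc k) g"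
  proof (rule tspace_eqI[OF T tspace_closed(2)[OF T T]])
    fix u assume u: "u \<in> iwords n d"
    then obtain xs a b ys where "u = xs @ a # b # ys" "length xs = k" by (rule iwords_split2[OF _ assms])
    with u show "s_op n d scl (Suc k) (f + g) u = (s_op n d scl (Suc k) f + s_op n d scl (Suc k) g) u"
      by (simp add: s_op_at0)
  qed
  show "s_op n d scl (Suc k) (tscale scl c f) = tscale scl c (s_op n d scl (Suc k) f)"
  proof (rule tspace_eqI[OF T tspace_scale[OF T]])
    fix u assume u: "u \<in> iwords n d"
    then obtain xs a b ys where "u = xs @ a # b # ys" "length xs = k" by (rule iwords_split2[OF _ assms])
    with u show "s_op n d scl (Suc k) (tscale scl c f) u = tscale scl c (s_op n d scl (Suc k) f) u"
      by (simp add: s_op_at0 tscale_def)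
  qed
qed

lemma e_op_add:
  assumes "Suc k < d"
  shows "e_op n d scl (Suc k) (f + g) = e_op n d scl (Suc k) f + e_op n d scl (Suc k) g"
    "e_op n d scl (Suc k) (tscale scl c f) = tscale scl c (e_op n d scl (Suc k) f)"
proof -
  note T = e_op_tspace[OF assms]
  show "e_op n d scl (Suc k) (f + g) = e_op n d scl (Suc k) f + e_op n d scl (Suc k) g"
  proof (rule tspace_eqI[OF T tspace_closed(2)[OF T T]])
    fix u assume u: "u \<in> iwords n d"
    then obtain xs a b ys where "u = xs @ a # b # ys" "length xs = k" by (rule iwords_split2[OF _ assms])
    with u show "e_op n d scl (Suc k) (f + g) u = (e_op n d scl (Suc k) f + e_op n d scl (Suc k) g) u"
      by (simp add: e_op_at0 sum.distrib)
  qed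
  show "e_op n d scl (Suc k) (tscale scl c f) = tscale scl c (e_op n d scl (Suc k) f)"
  proof (rule tspace_eqI[OF T tspace_scale[OF T]])
    fix u assume u: "u \<in> iwords n d"
    then obtain xs a b ys where "u = xs @ a # b # ys" "length xs = k" by (rule iwords_split2[OF _ assms])
    with u show "e_op n d scl (Suc k) (tscale scl c f) u = tscale scl c (e_op n d scl (Suc k) f) u"
      by (simp add: e_op_at0 tscale_def scale_sum_right)
  qed
qed

lemma pos_act_cases:
  assumes "u \<in> iwords n d" "k \<le> d"
  obtains "k = 0" | xs a ys where "k = Suc (length xs)" "u = xs @ a # ys"
proof (cases k)
  case 0
  then show thesis by (rule that(1))
next
  case (Suc l)
  then obtain xs a ys where "u = xs @ a # ys" "length xs = l"
    using iwords_split1[OF assms(1), of l] assms(2) by (metis Suc_le_lessD)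
  with Suc that(2) show thesis by blast
qed

lemma pos_act_add:
  assumes "X \<in> so n" "k \<le> d"
  shows "P d X k (f + g) = P d X k f + P d X k g" "P d X k (tscale scl c f) = tscale scl c (P d X k f)"
proof -
  note T = pos_act_tspace[OF assms(1), of d k]
  show "P d X k (f + g) = P d X k f + P d X k g"
  proof (rule tspace_eqI[OF T tspace_closed(2)[OF T T]])
    fix u assume u: "u \<in> iwords n d"
    then show "P d X k (f + g) u = (P d X k f + P d X k g) u"
    proof (cases rule: pos_act_cases[OF u assms(2)])
      case 1
      with u assms show ?thesis by (simp add: pos_act_0 rho_linear_simps)
    next
      case (2 xs a ys)
      with u show ?thesis by (simp add: pos_act_coeff scale_right_distrib sum.distrib)
    qed
  qed
  show "P d X k (tscale scl c f) = tscale scl c (P d X k f)"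
  proof (rule tspace_eqI[OF T tspace_scale[OF T]])
    fix u assume u: "u \<in> iwords n d"
    then show "P d X k (tscale scl c f) u = tscale scl c (P d X k f) u"
    proof (cases rule: pos_act_cases[OF u assms(2)])
      case 1
      with u assms show ?thesis by (simp add: pos_act_0 rho_linear_simps tscale_def)
    next
      case (2 xs a ys)
      with u show ?thesis by (simp add: pos_act_coeff tscale_def scale_sum_right mult.commute)
    qed
  qed
qed

lemma pos_act_add_mat:
  assumes "X \<in> so n" "Y \<in> so n" "k \<le> d"
  shows "P d (X + Y) k f = P d X k f + P d Y k f" "P d (mscale c X) k f = tscale scl c (P d X k f)"
proof -
  note T = pos_act_tspace[of _ d k f]
  show "P d (X + Y) k f = P d X k f + P d Y k f"
  proof (rule tspace_eqI)
    fix u assume u: "u \<in> iwords n d"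
    then show "P d (X + Y) k f u = (P d X k f + P d Y k f) u"
    proof (cases rule: pos_act_cases[OF u assms(3)])
      case 1
      with u assms show ?thesis by (simp add: pos_act_0 rho_add)
    next
      case (2 xs a ys)
      with u show ?thesis by (simp add: pos_act_coeff scale_left_distrib sum.distrib)
    qed
  qed (use assms in \<open>auto intro!: T tspace_closed so_closed\<close>)
  show "P d (mscale c X) k f = tscale scl c (P d X k f)"
  proof (rule tspace_eqI)
    fix u assume u: "u \<in> iwords n d"
    then show "P d (mscale c X) k f u = tscale scl c (P d X k f) u"
    proof (cases rule: pos_act_cases[OF u assms(3)])
      case 1
      with u assms show ?thesis by (simp add: pos_act_0 rho_scale tscale_def)
    next
      case (2 xs a ys)
      with u show ?thesis by (simp add: pos_act_coeff mscale_def tscale_def scale_sum_right)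
    qed
  qed (use assms in \<open>auto intro!: T tspace_scale so_closed\<close>)
qed

lemma pos_act_comm_less:
  assumes "X \<in> so n" "Y \<in> so n" "k < l" "l \<le> d"
  shows "P d X k (P d Y l f) = P d Y l (P d X k f)"
proof (rule tspace_eqI[OF pos_act_tspace[OF assms(1)] pos_act_tspace[OF assms(2)]])
  fix u assume u: "u \<in> iwords n d"
  obtain l' where l': "l = Suc l'" using assms by (cases l) auto
  show "P d X k (P d Y l f) u = P d Y l (P d X k f) u"
  proof (cases k)
    case 0
    obtain xs a ys where u': "u = xs @ a # ys" "length xs = l'"
      using iwords_split1[OF u, of l'] assms l' by (metis Suc_le_lessD)
    have W: "xs @ j # ys \<in> iwords n d" if "j \<in> idx n" for j using that u u' by (auto simp: iwords_def)
    have "a \<in> idx n" using u u' by (auto simp: iwords_def)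
    then show ?thesis
      using assms(1) by (simp add: 0 u' l' pos_act_0 pos_act_at0 W rho_linear_simps cong: sum.cong)
  next
    case (Suc k')
    obtain xs a ys b zs where u': "u = xs @ a # ys @ b # zs" "length xs = k'" "length (xs @ a # ys) = l'"
      by (rule iwords_split11[OF u, of k' l']) (use assms l' Suc in auto)
    have W: "xs @ i # ys @ j # zs \<in> iwords n d" if "i \<in> idx n" "j \<in> idx n" for i j
      using that u u' by (auto simp: iwords_def)
    have Q: "P d Y (Suc l') g (xs @ i # ys @ j # zs) = (\<Sum>t\<in>idx n. scl (Y j t) (g (xs @ i # ys @ t # zs)))"
      if "i \<in> idx n" "j \<in> idx n" for g i j
      using pos_act_coeff[of "xs @ i # ys" j zs d Y g] W[OF that] u' by simp
    have "a \<in> idx n" "b \<in> idx n" using u u' by (auto simp: iwords_def)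
    then show ?thesis
      unfolding Suc l' u'(1)
      by (simp add: pos_act_at0[OF W u'(2)] Q scale_sum_right mult.commute cong: sum.cong) (rule sum.swap)
  qed
qed

lemma pos_act_comm:
  assumes "X \<in> so n" "Y \<in> so n" "k \<noteq> l" "k \<le> d" "l \<le> d"
  shows "P d X k (P d Y l f) = P d Y l (P d X k f)"
  using pos_act_comm_less[OF assms(1,2), of k l d f] pos_act_comm_less[OF assms(2,1), of l k d f] assms(3-5)
  by (cases "k < l") auto

text \<open>Each position carries its own representation of the Lie algebra, position 0 by the
  axioms for \<rho> and the others by matrix multiplication. This lets the invariance of the Casimir
  tensor be read as a commutation relation between operators.\<close>

lemma pos_act_lie:
  assumes "X \<in> so n" "Y \<in> so n" "k \<le> d"
  shows "P d (lie n X Y) k f = P d X k (P d Y k f) - P d Y k (P d X k f)"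
proof (rule tspace_eqI)
  fix u assume u: "u \<in> iwords n d"
  then show "P d (lie n X Y) k f u = (P d X k (P d Y k f) - P d Y k (P d X k f)) u"
  proof (cases rule: pos_act_cases[OF u assms(3)])
    case 1
    with u assms show ?thesis by (simp add: pos_act_0 rho_lie)
  next
    case (2 xs a ys)
    have W: "xs @ j # ys \<in> iwords n d" if "j \<in> idx n" for j using that u 2 by (auto simp: iwords_def)
    have *: "P d A k (P d B k f) u = (\<Sum>j\<in>idx n. scl (\<Sum>i\<in>idx n. A a i * B i j) (f (xs @ j # ys)))" for A B
    proof -
      have "a \<in> idx n" using u 2 by (auto simp: iwords_def)
      then have "P d A k (P d B k f) u =
          (\<Sum>i\<in>idx n. \<Sum>j\<in>idx n. scl (A a i * B i j) (f (xs @ j # ys)))"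
        by (simp add: 2 pos_act_coeff W scale_sum_right cong: sum.cong)
      also have "\<dots> = (\<Sum>j\<in>idx n. \<Sum>i\<in>idx n. scl (A a i * B i j) (f (xs @ j # ys)))"
        by (rule sum.swap)
      finally show ?thesis by (simp add: scale_sum_left)
    qed
    have "P d (lie n X Y) k f u = (\<Sum>j\<in>idx n. scl (lie n X Y a j) (f (xs @ j # ys)))"
      using u 2 by (simp add: pos_act_coeff)
    then show ?thesis
      by (simp add: * lie_apply scale_left_diff_distrib sum_subtractf)
  qed
qed (use assms in \<open>auto intro!: pos_act_tspace tspace_closed so_closed\<close>)

lemma s_op_pos_same:
  assumes "X \<in> so n" "Suc k < d"
  shows "s_op n d scl (Suc k) (P d X (Suc k) f) = P d X (Suc (Suc k)) (s_op n d scl (Suc k) f)"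
    "s_op n d scl (Suc k) (P d X (Suc (Suc k)) f) = P d X (Suc k) (s_op n d scl (Suc k) f)"
proof -
  have "s_op n d scl (Suc k) (P d X (Suc k) f) u = P d X (Suc (Suc k)) (s_op n d scl (Suc k) f) u \<and>
    s_op n d scl (Suc k) (P d X (Suc (Suc k)) f) u = P d X (Suc k) (s_op n d scl (Suc k) f) u"
    if u: "u \<in> iwords n d" for u
  proof -
    obtain xs a b ys where u': "u = xs @ a # b # ys" "length xs = k" by (rule iwords_split2[OF u assms(2)])
    have W: "xs @ i # j # ys \<in> iwords n d" if "i \<in> idx n" "j \<in> idx n" for i j
      using that u u' by (auto simp: iwords_def)
    have "a \<in> idx n" "b \<in> idx n" using u u' by (auto simp: iwords_def)
    then show ?thesis
      by (simp add: u'(1) s_op_at0[OF W u'(2)] pos_act_at0[OF W u'(2)] pos_act_at1[OF W u'(2)] cong: sum.cong)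
  qed
  then show "s_op n d scl (Suc k) (P d X (Suc k) f) = P d X (Suc (Suc k)) (s_op n d scl (Suc k) f)"
    "s_op n d scl (Suc k) (P d X (Suc (Suc k)) f) = P d X (Suc k) (s_op n d scl (Suc k) f)"
    by (auto intro!: tspace_eqI[OF s_op_tspace[OF assms(2)] pos_act_tspace[OF assms(1)]])
qed

text \<open>X is skew for the form, so its joint action in both slots annihilates the form (first
  claim) and the dual tensor, the sum of the v_j \<otimes> v_{-j} (second claim).\<close>

lemma e_op_pos_antisym:
  assumes "X \<in> so n" "Suc k < d"
  shows "e_op n d scl (Suc k) (P d X (Suc k) f) + e_op n d scl (Suc k) (P d X (Suc (Suc k)) f) = 0"
    "P d X (Suc k) (e_op n d scl (Suc k) f) + P d X (Suc (Suc k)) (e_op n d scl (Suc k) f) = 0"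
proof -
  have "(e_op n d scl (Suc k) (P d X (Suc k) f) + e_op n d scl (Suc k) (P d X (Suc (Suc k)) f)) u = 0 \<and>
    (P d X (Suc k) (e_op n d scl (Suc k) f) + P d X (Suc (Suc k)) (e_op n d scl (Suc k) f)) u = 0"
    if u: "u \<in> iwords n d" for u
  proof -
    obtain xs a b ys where u': "u = xs @ a # b # ys" "length xs = k" by (rule iwords_split2[OF u assms(2)])
    have W: "xs @ i # j # ys \<in> iwords n d" if "i \<in> idx n" "j \<in> idx n" for i j
      using that u u' by (auto simp: iwords_def)
    have ab: "a \<in> idx n" "b \<in> idx n" using u u' by (auto simp: iwords_def)
    have "(\<Sum>j\<in>idx n. \<Sum>l\<in>idx n. scl (X (- j) l) (f (xs @ j # l # ys))) =
      (\<Sum>l\<in>idx n. \<Sum>j\<in>idx n. scl (X (- j) l) (f (xs @ j # l # ys)))"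
      by (rule sum.swap)
    also have "\<dots> = (\<Sum>j\<in>idx n. \<Sum>l\<in>idx n. scl (X (- l) (- j)) (f (xs @ l # - j # ys)))"
      by (rule sum.reindex_bij_witness[of _ uminus uminus]) (auto simp: idx_uminus)
    also have "\<dots> = (\<Sum>j\<in>idx n. \<Sum>l\<in>idx n. - scl (X j l) (f (xs @ l # - j # ys)))"
      using assms(1) unfolding so_iff by (intro sum.cong refl) simp
    finally have 1: "(\<Sum>j\<in>idx n. \<Sum>l\<in>idx n. scl (X (- j) l) (f (xs @ j # l # ys))) =
      - (\<Sum>j\<in>idx n. \<Sum>l\<in>idx n. scl (X j l) (f (xs @ l # - j # ys)))"
      by (simp add: sum_negf)
    have 2: "(e_op n d scl (Suc k) (P d X (Suc k) f) + e_op n d scl (Suc k) (P d X (Suc (Suc k)) f)) u = 0"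
      using ab by (simp add: u'(1) e_op_at0[OF W u'(2)] pos_act_at0[OF W u'(2)] pos_act_at1[OF W u'(2)]
        1 idx_uminus cong: sum.cong)
    have 3: "(P d X (Suc k) (e_op n d scl (Suc k) f) + P d X (Suc (Suc k)) (e_op n d scl (Suc k) f)) u = 0"
    proof -
      let ?h = "\<Sum>j\<in>idx n. f (xs @ j # - j # ys)"
      have "(\<Sum>j\<in>idx n. scl (X a j) (if j = - b then ?h else 0)) = scl (X a (- b)) ?h"
        using ab by (simp add: if_distrib[of "scl _"] finite_idx idx_uminus cong: if_cong)
      moreover have "(\<Sum>j\<in>idx n. scl (X b j) (if a = - j then ?h else 0)) = scl (X b (- a)) ?h"
        using ab by (simp add: if_distrib[of "scl _"] finite_idx idx_uminus equation_minus_iff[of a] cong: if_cong)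
      moreover have "X a (- b) = - X b (- a)" by (rule so_neg_iff[OF assms(1) ab])
      ultimately show ?thesis
        using ab by (simp add: u'(1) e_op_at0[OF W u'(2)] pos_act_at0[OF W u'(2)] pos_act_at1[OF W u'(2)] cong: sum.cong)
    qed
    from 2 3 show ?thesis by simp
  qed
  then show "e_op n d scl (Suc k) (P d X (Suc k) f) + e_op n d scl (Suc k) (P d X (Suc (Suc k)) f) = 0"
    "P d X (Suc k) (e_op n d scl (Suc k) f) + P d X (Suc (Suc k)) (e_op n d scl (Suc k) f) = 0"
    by (auto intro!: tspace_eqI[of _ n d 0] tspace_closed e_op_tspace pos_act_tspace assms)
qed

lemma pos_far:
  assumes X: "X \<in> so n" and k: "Suc k < d" and l: "l \<le> d" "l \<noteq> Suc k" "l \<noteq> Suc (Suc k)"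
  shows "s_op n d scl (Suc k) (P d X l f) = P d X l (s_op n d scl (Suc k) f)"
    "e_op n d scl (Suc k) (P d X l f) = P d X l (e_op n d scl (Suc k) f)"
proof -
  have "s_op n d scl (Suc k) (P d X l f) u = P d X l (s_op n d scl (Suc k) f) u \<and>
    e_op n d scl (Suc k) (P d X l f) u = P d X l (e_op n d scl (Suc k) f) u"
    if u: "u \<in> iwords n d" for u
  proof -
    consider "l = 0" | l' where "l = Suc l'" "l' < k" | l' where "l = Suc l'" "Suc k < l'"
      using l by (metis Suc_lessI linorder_neqE_nat not0_implies_Suc)
    then show ?thesis
    proof cases
      case 1
      obtain xs a b ys where u': "u = xs @ a # b # ys" "length xs = k" by (rule iwords_split2[OF u k])
      have W: "xs @ i # j # ys \<in> iwords n d" if "i \<in> idx n" "j \<in> idx n" for i j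
        using that u u' by (auto simp: iwords_def)
      have "a \<in> idx n" "b \<in> idx n" using u u' by (auto simp: iwords_def)
      then show ?thesis
        using X by (simp add: 1 u'(1) s_op_at0[OF W u'(2)] e_op_at0[OF W u'(2)] pos_act_0[OF W]
          rho_linear_simps rho_zero idx_uminus if_distrib[of "\<rho> X"] cong: sum.cong)
    next
      case 2
      obtain xs c ys a b zs where u': "u = xs @ c # ys @ a # b # zs" "length xs = l'"
        "length (xs @ c # ys) = k"
        by (rule iwords_split12[OF u 2(2) k])
      have W: "xs @ t # ys @ i # j # zs \<in> iwords n d" if "t \<in> idx n" "i \<in> idx n" "j \<in> idx n" for t i j
        using that u u' by (auto simp: iwords_def)
      have S: "s_op n d scl (Suc k) g (xs @ t # ys @ i # j # zs) = g (xs @ t # ys @ j # i # zs)"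
        and E: "e_op n d scl (Suc k) g (xs @ t # ys @ i # j # zs) =
          (if i = - j then \<Sum>r\<in>idx n. g (xs @ t # ys @ r # - r # zs) else 0)"
        if "t \<in> idx n" "i \<in> idx n" "j \<in> idx n" for t i j g
        using s_op_coeff[of "xs @ t # ys" i j zs d g] e_op_coeff[of "xs @ t # ys" i j zs d g] W[OF that] u'
        by simp_all
      have "a \<in> idx n" "b \<in> idx n" "c \<in> idx n" using u u' by (auto simp: iwords_def)
      then show ?thesis
        unfolding 2(1) u'(1)
        by (auto simp: S E pos_act_at0[OF W u'(2)] idx_uminus scale_sum_right cong: sum.cong intro: sum.swap)
    next
      case 3
      have l': "l' < d" using 3 l by simp
      obtain xs a b ys c zs where u': "u = xs @ a # b # ys @ c # zs" "length xs = k"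
        "length (xs @ a # b # ys) = l'"
        by (rule iwords_split21[OF u 3(2) l'])
      have W: "xs @ i # j # ys @ t # zs \<in> iwords n d" if "t \<in> idx n" "i \<in> idx n" "j \<in> idx n" for t i j
        using that u u' by (auto simp: iwords_def)
      have Q: "P d X (Suc l') g (xs @ i # j # ys @ t # zs) =
          (\<Sum>r\<in>idx n. scl (X t r) (g (xs @ i # j # ys @ r # zs)))"
        if "t \<in> idx n" "i \<in> idx n" "j \<in> idx n" for t i j g
        using pos_act_coeff[of "xs @ i # j # ys" t zs d X g] W[OF that] u' by simp
      have "a \<in> idx n" "b \<in> idx n" "c \<in> idx n" using u u' by (auto simp: iwords_def)
      then show ?thesis
        unfolding 3(1) u'(1)
        by (auto simp: Q s_op_at0[OF W u'(2)] e_op_at0[OF W u'(2)] idx_uminus scale_sum_right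
          cong: sum.cong intro: sum.swap)
    qed
  qed
  then show "s_op n d scl (Suc k) (P d X l f) = P d X l (s_op n d scl (Suc k) f)"
    "e_op n d scl (Suc k) (P d X l f) = P d X l (e_op n d scl (Suc k) f)"
    by (auto intro!: tspace_eqI[of _ n d] e_op_tspace s_op_tspace pos_act_tspace assms)
qed

end

section \<open>The Casimir tensor\<close>

lemma so_ext:
  assumes "A \<in> so n" "C \<in> so n" "\<And>i j. i \<in> idx n \<Longrightarrow> j \<in> idx n \<Longrightarrow> A i j = C i j"
  shows "A = C"
proof (intro ext)
  fix i j show "A i j = C i j"
    using assms unfolding so_iff gl_def by (cases "i \<in> idx n \<and> j \<in> idx n") auto
qed

lemma fmat_so:
  assumes "p \<in> idx n" "q \<in> idx n"
  shows "fmat (p, q) \<in> so n"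
  using assms unfolding so_iff gl_def fmat_def by (auto simp: idx_uminus split: if_splits)

lemma sum_mat_apply: "(\<Sum>x\<in>S. g x) i j = (\<Sum>x\<in>S. g x i j)" for g :: "'i \<Rightarrow> mat"
  by (induction S rule: infinite_finite_induct) auto

lemma fmat_if: "fmat (p, q) i j = (if i = p then if j = q then 1 else 0 else 0) -
    (if i = - q then if j = - p then 1 else 0 else 0)"
  by (auto simp: fmat_def)

lemma if_zero_simps:
  "(if c then x else 0) * y = (if c then x * y else 0)"
  "y * (if c then x else 0) = (if c then y * x else 0)" for x y :: complex by auto

lemma sum_if_const: "(\<Sum>k\<in>S. if c then g k else 0) = (if c then sum g S else 0)"
  by simp

text \<open>Summation against \<open>fmat (i, j)\<close> extracts the skew part of g. For g in
  \<open>so n\<close> this is twice an entry, and the factor 2 is absorbed by the half in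
  \<open>inv_form\<close>.\<close>

lemma sum_sum_fmat:
  assumes "i \<in> idx n" "j \<in> idx n"
  shows "(\<Sum>p\<in>idx n. \<Sum>q\<in>idx n. fmat (i, j) p q * g p q) = g i j - g (- j) (- i)"
  using assms
  by (simp add: fmat_if left_diff_distrib sum_subtractf if_zero_simps sum_if_const finite_idx idx_uminus)

text \<open>As a kernel on pairs of pairs \<open>fmat\<close> is symmetric, so it also extracts
  entries when the summation runs over its label.\<close>

lemma fmat_swap: "fmat (p, q) i j = fmat (i, j) p q"
  by (auto simp: fmat_def)

text \<open>\<open>fmat (p, q)\<close> is the negative of \<open>fmat (- q, - p)\<close>, so a sum
  over all pairs meets each direction twice. Accepting this redundancy avoids a choice of half of
  the pairs.\<close>

lemma fmat_expand:
  assumes "A \<in> so n"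
  shows "(\<Sum>p\<in>idx n. \<Sum>q\<in>idx n. mscale (A p q) (fmat (p, q))) = mscale 2 A"
proof (rule so_ext)
  show "(\<Sum>p\<in>idx n. \<Sum>q\<in>idx n. mscale (A p q) (fmat (p, q))) \<in> so n" "mscale 2 A \<in> so n"
    using assms by (auto intro!: so_closed fmat_so)
  fix i j assume ij: "i \<in> idx n" "j \<in> idx n"
  have "(\<Sum>p\<in>idx n. \<Sum>q\<in>idx n. mscale (A p q) (fmat (p, q))) i j =
      (\<Sum>p\<in>idx n. \<Sum>q\<in>idx n. fmat (i, j) p q * A p q)"
    by (simp add: sum_mat_apply mscale_def fmat_swap[of _ _ i j] mult.commute)
  also have "\<dots> = A i j - A (- j) (- i)" by (rule sum_sum_fmat[OF ij])
  also have "\<dots> = mscale 2 A i j" using assms ij unfolding so_iff mscale_def by simp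
  finally show "(\<Sum>p\<in>idx n. \<Sum>q\<in>idx n. mscale (A p q) (fmat (p, q))) i j = mscale 2 A i j" .
qed

lemma inv_form_fmat:
  assumes "A \<in> so n" "p \<in> idx n" "q \<in> idx n"
  shows "inv_form n (fmat (p, q)) A = A q p"
proof -
  have "inv_form n (fmat (p, q)) A = (A q p - A (- p) (- q)) / 2"
    unfolding inv_form_def mat_trace_def mat_mul_def
    using sum_sum_fmat[OF assms(2,3), of "\<lambda>i j. A j i"] by simp
  then show ?thesis using assms unfolding so_iff by simp
qed

text \<open>The formula is that for the commutator with a matrix unit E_pq. It passes to
  \<open>fmat\<close> because Z is skew; the instances of skewness that are needed are collected in
  \<open>N\<close>.\<close>

lemma lie_fmat:
  assumes "Z \<in> so n" "p \<in> idx n" "q \<in> idx n"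
  shows "lie n Z (fmat (p, q)) = (\<Sum>r\<in>idx n. mscale (Z r p) (fmat (r, q))) - (\<Sum>r\<in>idx n. mscale (Z q r) (fmat (p, r)))"
proof (rule so_ext)
  show "lie n Z (fmat (p, q)) \<in> so n"
    "(\<Sum>r\<in>idx n. mscale (Z r p) (fmat (r, q))) - (\<Sum>r\<in>idx n. mscale (Z q r) (fmat (p, r))) \<in> so n"
    using assms by (auto intro!: so_closed fmat_so)
  fix i j assume ij: "i \<in> idx n" "j \<in> idx n"
  have eqs: "(i = - r) = (r = - i)" "(j = - r) = (r = - j)" for r by auto
  have sw: "(if c then if e then x else 0 else 0) = (if e then if c then x else 0 else 0)"
    for c e and x :: complex by auto
  have L1: "(\<Sum>k\<in>idx n. Z i k * fmat (p, q) k j) = (if j = q then Z i p else 0) - (if j = - p then Z i (- q) else 0)"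
    using assms by (simp add: fmat_if right_diff_distrib sum_subtractf if_zero_simps sum_if_const finite_idx idx_uminus)
  have L2: "(\<Sum>k\<in>idx n. fmat (p, q) i k * Z k j) = (if i = p then Z q j else 0) - (if i = - q then Z (- p) j else 0)"
    using assms by (simp add: fmat_if left_diff_distrib sum_subtractf if_zero_simps sum_if_const finite_idx idx_uminus)
  have R1: "(\<Sum>r\<in>idx n. Z r p * fmat (r, q) i j) = (if j = q then Z i p else 0) - (if i = - q then Z (- j) p else 0)"
    using ij by (simp add: fmat_if right_diff_distrib sum_subtractf if_zero_simps sum_if_const sw[of "i = _" "j = q"]
      eqs(2) finite_idx idx_uminus)
  have R2: "(\<Sum>r\<in>idx n. Z q r * fmat (p, r) i j) = (if i = p then Z q j else 0) - (if j = - p then Z q (- i) else 0)"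
    using ij by (simp add: fmat_if right_diff_distrib sum_subtractf if_zero_simps sum_if_const sw[of "i = - _" "j = - p"]
      eqs(1) finite_idx idx_uminus)
  have N: "Z (- j) p = - Z (- p) j" "Z q (- i) = - Z i (- q)"
    by (rule so_neg_iff(1)[OF assms(1) ij(2) assms(2)], rule so_neg_iff(2)[OF assms(1,3) ij(1)])
  show "lie n Z (fmat (p, q)) i j =
    ((\<Sum>r\<in>idx n. mscale (Z r p) (fmat (r, q))) - (\<Sum>r\<in>idx n. mscale (Z q r) (fmat (p, r)))) i j"
    by (simp add: lie_apply L1 L2 sum_mat_apply mscale_def R1 R2 N)
qed

lemma inv_form_linear:
  "inv_form n (X + Y) Z = inv_form n X Z + inv_form n Y Z"
  "inv_form n (mscale c X) Z = c * inv_form n X Z"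
  by (simp_all add: inv_form_def mat_trace_def mat_mul_def mscale_def algebra_simps sum.distrib
    sum_distrib_left add_divide_distrib)

text \<open>A sum over an infinite set is 0 by convention, so finiteness is what gives the Casimir
  sums their meaning. It follows because the finitely many \<open>fmat\<close> span
  \<open>so n\<close> and B is independent.\<close>

lemma basis_with_dual_finite:
  assumes "basis_with_dual n B dual"
  shows "finite B"
proof -
  let ?S = "(\<lambda>(p, q). fmat (p, q)) ` (idx n \<times> idx n)"
  have "A \<in> mat.span ?S" if "A \<in> so n" for A
  proof -
    have "(\<Sum>p\<in>idx n. \<Sum>q\<in>idx n. mscale (A p q) (fmat (p, q))) \<in> mat.span ?S"
      by (intro mat.span_sum mat.span_scale mat.span_base) auto
    then have "mscale (1/2) (mscale 2 A) \<in> mat.span ?S"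
      unfolding fmat_expand[OF that] by (rule mat.span_scale)
    then show ?thesis by simp
  qed
  moreover have "B \<subseteq> so n" "mat.independent B" using assms by (auto simp: basis_with_dual_def)
  ultimately show ?thesis
    using mat.independent_span_bound[of ?S B] finite_idx by blast
qed

lemma basis_with_dual_expand:
  assumes "basis_with_dual n B dual" "A \<in> so n"
  shows "A = (\<Sum>X\<in>B. mscale (inv_form n A (dual X)) X)"
proof -
  have fin: "finite B" by (rule basis_with_dual_finite[OF assms(1)])
  have "A \<in> mat.span B" using assms by (auto simp: basis_with_dual_def)
  then obtain u where u: "A = (\<Sum>X\<in>B. mscale (u X) X)"
    using mat.span_finite[OF fin] by auto
  have "inv_form n A (dual Y) = u Y" if "Y \<in> B" for Y
  proof -
    have z: "inv_form n 0 Z = 0" for Z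
      by (simp add: inv_form_def mat_trace_def mat_mul_def)
    have "inv_form n (\<Sum>X\<in>S. mscale (u X) X) (dual Y) = (\<Sum>X\<in>S. u X * inv_form n X (dual Y))" for S
      by (induction S rule: infinite_finite_induct) (simp_all only: sum.infinite sum.empty sum.insert inv_form_linear z simp_thms)
    then have "inv_form n A (dual Y) = (\<Sum>X\<in>B. u X * inv_form n X (dual Y))" by (simp add: u)
    also have "\<dots> = (\<Sum>X\<in>B. if X = Y then u X else 0)"
      using assms(1) that by (intro sum.cong) (auto simp: basis_with_dual_def)
    finally show ?thesis using that fin by simp
  qed
  with u show ?thesis by simp
qed

text \<open>The tensor square of the Lie algebra is never formed; an identity in it is stated after
  application of an arbitrary bilinear map. Bilinearity is asked for on \<open>so n\<close> only,
  because a representation is not controlled on other matrices.\<close>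

locale so_bilinear = vector_space sclx for sclx :: "complex \<Rightarrow> 'x::ab_group_add \<Rightarrow> 'x" +
  fixes n :: nat and \<beta> :: "mat \<Rightarrow> mat \<Rightarrow> 'x"
  assumes add_l: "X \<in> so n \<Longrightarrow> Y \<in> so n \<Longrightarrow> Z \<in> so n \<Longrightarrow> \<beta> (X + Y) Z = \<beta> X Z + \<beta> Y Z"
    and add_r: "X \<in> so n \<Longrightarrow> Y \<in> so n \<Longrightarrow> Z \<in> so n \<Longrightarrow> \<beta> X (Y + Z) = \<beta> X Y + \<beta> X Z"
    and scale_l: "X \<in> so n \<Longrightarrow> Y \<in> so n \<Longrightarrow> \<beta> (mscale c X) Y = sclx c (\<beta> X Y)"
    and scale_r: "X \<in> so n \<Longrightarrow> Y \<in> so n \<Longrightarrow> \<beta> X (mscale c Y) = sclx c (\<beta> X Y)"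
begin

lemma zero_l: "Y \<in> so n \<Longrightarrow> \<beta> 0 Y = 0"
  using scale_l[of 0 Y 0] so_closed(5) by simp

lemma zero_r: "X \<in> so n \<Longrightarrow> \<beta> X 0 = 0"
  using scale_r[of X 0 0] so_closed(5) by simp

lemma sum_l:
  assumes "\<And>i. i \<in> S \<Longrightarrow> X i \<in> so n" "Y \<in> so n"
  shows "\<beta> (\<Sum>i\<in>S. mscale (c i) (X i)) Y = (\<Sum>i\<in>S. sclx (c i) (\<beta> (X i) Y))"
  using assms(1)
proof (induction S rule: infinite_finite_induct)
  case (insert i S)
  have "(\<Sum>i\<in>S. mscale (c i) (X i)) \<in> so n" "mscale (c i) (X i) \<in> so n"
    using insert by (auto intro!: so_closed)
  with insert show ?case
    by (simp only: sum.insert add_l[OF _ _ assms(2)] scale_l[OF _ assms(2)] insertI1 insertI2 simp_thms)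
qed (simp_all only: sum.infinite sum.empty zero_l[OF assms(2)] simp_thms)

lemma sum_r:
  assumes "\<And>i. i \<in> S \<Longrightarrow> X i \<in> so n" "Y \<in> so n"
  shows "\<beta> Y (\<Sum>i\<in>S. mscale (c i) (X i)) = (\<Sum>i\<in>S. sclx (c i) (\<beta> Y (X i)))"
  using assms(1)
proof (induction S rule: infinite_finite_induct)
  case (insert i S)
  have "(\<Sum>i\<in>S. mscale (c i) (X i)) \<in> so n" "mscale (c i) (X i) \<in> so n"
    using insert by (auto intro!: so_closed)
  with insert show ?case
    by (simp only: sum.insert add_r[OF assms(2)] scale_r[OF assms(2)] insertI1 insertI2 simp_thms)
qed (simp_all only: sum.infinite sum.empty zero_r[OF assms(2)] simp_thms)

lemma diff_l:
  assumes "X \<in> so n" "Y \<in> so n" "Z \<in> so n"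
  shows "\<beta> (X - Y) Z = \<beta> X Z - \<beta> Y Z"
  using add_l[of "X - Y" Y Z] assms so_closed(3) by simp

lemma diff_r:
  assumes "X \<in> so n" "Y \<in> so n" "Z \<in> so n"
  shows "\<beta> Z (X - Y) = \<beta> Z X - \<beta> Z Y"
  using add_r[of Z "X - Y" Y] assms so_closed(3) by simp

text \<open>Expanding the first factor of each summand in B gives the coefficient
  \<open>dual X q p\<close>. After exchange of the sums, these coefficients assemble the second
  factors to twice \<open>dual X\<close>. As only one side refers to B, the Casimir tensor is
  independent of the basis.\<close>

lemma casimir_fmat:
  assumes "basis_with_dual n B dual"
  shows "sclx 2 (\<Sum>X\<in>B. \<beta> X (dual X)) = (\<Sum>p\<in>idx n. \<Sum>q\<in>idx n. \<beta> (fmat (p, q)) (fmat (q, p)))"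
proof -
  have B: "X \<in> so n" "dual X \<in> so n" if "X \<in> B" for X
    using assms that by (auto simp: basis_with_dual_def)
  have "\<beta> (fmat (p, q)) (fmat (q, p)) = (\<Sum>X\<in>B. sclx (dual X q p) (\<beta> X (fmat (q, p))))"
    if pq: "p \<in> idx n" "q \<in> idx n" for p q
  proof -
    have "fmat (p, q) = (\<Sum>X\<in>B. mscale (dual X q p) X)"
      using basis_with_dual_expand[OF assms fmat_so[OF pq]] inv_form_fmat[OF B(2) pq]
      by (simp cong: sum.cong)
    then show ?thesis
      by (subst \<open>fmat (p, q) = _\<close>, subst sum_l) (use B pq in \<open>auto intro: fmat_so\<close>)
  qed
  then have "(\<Sum>p\<in>idx n. \<Sum>q\<in>idx n. \<beta> (fmat (p, q)) (fmat (q, p))) =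
      (\<Sum>p\<in>idx n. \<Sum>q\<in>idx n. \<Sum>X\<in>B. sclx (dual X q p) (\<beta> X (fmat (q, p))))"
    by (simp cong: sum.cong)
  also have "\<dots> = (\<Sum>q\<in>idx n. \<Sum>p\<in>idx n. \<Sum>X\<in>B. sclx (dual X q p) (\<beta> X (fmat (q, p))))"
    by (rule sum.swap)
  also have "\<dots> = (\<Sum>q\<in>idx n. \<Sum>X\<in>B. \<Sum>p\<in>idx n. sclx (dual X q p) (\<beta> X (fmat (q, p))))"
    by (rule sum.cong[OF refl], rule sum.swap)
  also have "\<dots> = (\<Sum>X\<in>B. \<Sum>q\<in>idx n. \<Sum>p\<in>idx n. sclx (dual X q p) (\<beta> X (fmat (q, p))))"
    by (rule sum.swap)
  also have "\<dots> = (\<Sum>X\<in>B. \<beta> X (\<Sum>q\<in>idx n. \<Sum>p\<in>idx n. mscale (dual X q p) (fmat (q, p))))"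
  proof (rule sum.cong[OF refl])
    fix X assume X: "X \<in> B"
    have "\<beta> X (\<Sum>q\<in>idx n. \<Sum>p\<in>idx n. mscale (dual X q p) (fmat (q, p))) =
        (\<Sum>q\<in>idx n. \<beta> X (\<Sum>p\<in>idx n. mscale (dual X q p) (fmat (q, p))))"
      using sum_r[of "idx n" "\<lambda>q. \<Sum>p\<in>idx n. mscale (dual X q p) (fmat (q, p))" X "\<lambda>_. 1"] B(1)[OF X]
      by (simp add: so_closed fmat_so)
    also have "\<dots> = (\<Sum>q\<in>idx n. \<Sum>p\<in>idx n. sclx (dual X q p) (\<beta> X (fmat (q, p))))"
      by (rule sum.cong[OF refl], rule sum_r) (auto intro: fmat_so B X)
    finally show "(\<Sum>q\<in>idx n. \<Sum>p\<in>idx n. sclx (dual X q p) (\<beta> X (fmat (q, p)))) =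
        \<beta> X (\<Sum>q\<in>idx n. \<Sum>p\<in>idx n. mscale (dual X q p) (fmat (q, p)))" by simp
  qed
  also have "\<dots> = (\<Sum>X\<in>B. sclx 2 (\<beta> X (dual X)))"
    by (intro sum.cong refl) (simp only: fmat_expand[OF B(2)] scale_r[OF B])
  finally show ?thesis by (simp add: scale_sum_right)
qed

text \<open>Expansion by \<open>lie_fmat\<close> yields four triple sums. Renaming summation indices
  identifies the first with the fourth and the second with the third, and these carry opposite
  signs.\<close>

lemma casimir_fmat_invariant:
  assumes "Z \<in> so n"
  shows "(\<Sum>p\<in>idx n. \<Sum>q\<in>idx n. \<beta> (lie n Z (fmat (p, q))) (fmat (q, p)) + \<beta> (fmat (p, q)) (lie n Z (fmat (q, p)))) = 0"
proof -
  let ?I = "idx n"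
  let ?b = "\<lambda>p q r s. \<beta> (fmat (p, q)) (fmat (r, s))"
  have "\<beta> (lie n Z (fmat (p, q))) (fmat (q, p)) =
      (\<Sum>r\<in>?I. sclx (Z r p) (?b r q q p)) - (\<Sum>r\<in>?I. sclx (Z q r) (?b p r q p))"
    "\<beta> (fmat (p, q)) (lie n Z (fmat (q, p))) =
      (\<Sum>r\<in>?I. sclx (Z r q) (?b p q r p)) - (\<Sum>r\<in>?I. sclx (Z p r) (?b p q q r))"
    if "p \<in> ?I" "q \<in> ?I" for p q
    using that by (simp_all add: lie_fmat[OF assms] diff_l diff_r sum_l sum_r fmat_so so_closed)
  then have "(\<Sum>p\<in>?I. \<Sum>q\<in>?I. \<beta> (lie n Z (fmat (p, q))) (fmat (q, p)) + \<beta> (fmat (p, q)) (lie n Z (fmat (q, p)))) =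
      (\<Sum>p\<in>?I. \<Sum>q\<in>?I. \<Sum>r\<in>?I. sclx (Z r p) (?b r q q p)) - (\<Sum>p\<in>?I. \<Sum>q\<in>?I. \<Sum>r\<in>?I. sclx (Z q r) (?b p r q p))
      + ((\<Sum>p\<in>?I. \<Sum>q\<in>?I. \<Sum>r\<in>?I. sclx (Z r q) (?b p q r p)) - (\<Sum>p\<in>?I. \<Sum>q\<in>?I. \<Sum>r\<in>?I. sclx (Z p r) (?b p q q r)))"
    by (simp add: sum.distrib sum_subtractf cong: sum.cong)
  also have "(\<Sum>p\<in>?I. \<Sum>q\<in>?I. \<Sum>r\<in>?I. sclx (Z p r) (?b p q q r)) =
      (\<Sum>p\<in>?I. \<Sum>q\<in>?I. \<Sum>r\<in>?I. sclx (Z r p) (?b r q q p))"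
  proof -
    have "(\<Sum>p\<in>?I. \<Sum>q\<in>?I. \<Sum>r\<in>?I. sclx (Z p r) (?b p q q r)) =
        (\<Sum>q\<in>?I. \<Sum>p\<in>?I. \<Sum>r\<in>?I. sclx (Z p r) (?b p q q r))" by (rule sum.swap)
    also have "\<dots> = (\<Sum>q\<in>?I. \<Sum>p\<in>?I. \<Sum>r\<in>?I. sclx (Z r p) (?b r q q p))"
      by (rule sum.cong[OF refl], rule sum.swap)
    also have "\<dots> = (\<Sum>p\<in>?I. \<Sum>q\<in>?I. \<Sum>r\<in>?I. sclx (Z r p) (?b r q q p))" by (rule sum.swap)
    finally show ?thesis .
  qed
  also have "(\<Sum>p\<in>?I. \<Sum>q\<in>?I. \<Sum>r\<in>?I. sclx (Z r q) (?b p q r p)) =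
      (\<Sum>p\<in>?I. \<Sum>q\<in>?I. \<Sum>r\<in>?I. sclx (Z q r) (?b p r q p))"
    by (rule sum.cong[OF refl], rule sum.swap)
  finally show ?thesis by simp
qed

end

lemma lie_linear:
  "lie n Z (X + Y) = lie n Z X + lie n Z Y" "lie n Z (mscale c X) = mscale c (lie n Z X)"
  by (auto simp: fun_eq_iff lie_apply mscale_def algebra_simps sum.distrib sum_distrib_left sum_subtractf)

lemma (in so_bilinear) casimir_invariant:
  assumes "basis_with_dual n B dual" "Z \<in> so n"
  shows "(\<Sum>X\<in>B. \<beta> (lie n Z X) (dual X) + \<beta> X (lie n Z (dual X))) = 0"
proof -
  \<comment> \<open>The derivative of \<beta> along Z is again bilinear, so
    \<open>casimir_fmat\<close> carries the invariance from the matrices \<open>fmat\<close> over to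
    the given basis.\<close>
  interpret L: so_bilinear sclx n "\<lambda>X Y. \<beta> (lie n Z X) Y + \<beta> X (lie n Z Y)"
    by unfold_locales
      (simp_all add: lie_linear add_l add_r scale_l scale_r so_closed assms(2) scale_right_distrib)
  have "sclx 2 (\<Sum>X\<in>B. \<beta> (lie n Z X) (dual X) + \<beta> X (lie n Z (dual X))) = 0"
    unfolding L.casimir_fmat[OF assms(1)] by (rule casimir_fmat_invariant[OF assms(2)])
  then show ?thesis by simp
qed

text \<open>The bilinear map is a product of two matrix entries. The value consists of two Kronecker
  terms, the matrix coefficients of \<sigma> and of -\<tau> on V \<otimes> V.\<close>

lemma casimir_entries:
  assumes "basis_with_dual n B dual" "a \<in> idx n" "b \<in> idx n" "j \<in> idx n" "l \<in> idx n"
  shows "(\<Sum>X\<in>B. X a j * dual X b l) = fmat (b, l) j a"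
proof -
  interpret so_bilinear "(*) :: complex \<Rightarrow> complex \<Rightarrow> complex" n "\<lambda>X Y. X a j * Y b l"
    by unfold_locales (simp_all add: algebra_simps mscale_def)
  have "2 * (\<Sum>X\<in>B. X a j * dual X b l) =
      (\<Sum>p\<in>idx n. \<Sum>q\<in>idx n. fmat (a, j) p q * fmat (b, l) q p)"
    unfolding casimir_fmat[OF assms(1)] by (simp add: fmat_swap[of _ _ a j] fmat_swap[of _ _ b l])
  also have "\<dots> = 2 * inv_form n (fmat (a, j)) (fmat (b, l))"
    by (simp add: inv_form_def mat_trace_def mat_mul_def)
  also have "\<dots> = 2 * fmat (b, l) j a"
    using assms by (simp add: inv_form_fmat fmat_so)
  finally show ?thesis by simp
qed

section \<open>The relations involving the polynomial generators\<close>

locale so_module_with_basis = so_module scl n \<rho>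
  for scl :: "complex \<Rightarrow> 'm::ab_group_add \<Rightarrow> 'm" and n \<rho> +
  fixes B :: "mat set" and dual :: "mat \<Rightarrow> mat"
  assumes basis: "basis_with_dual n B dual"
begin

abbreviation Om :: "nat \<Rightarrow> nat \<Rightarrow> nat \<Rightarrow> 'm tensor \<Rightarrow> 'm tensor" where
  "Om d i j \<equiv> omega_op n d scl \<rho> B dual i j"

abbreviation Y :: "nat \<Rightarrow> nat \<Rightarrow> 'm tensor \<Rightarrow> 'm tensor" where
  "Y d j \<equiv> y_op n d scl \<rho> B dual j"

lemma B_so: "X \<in> B \<Longrightarrow> X \<in> so n" "X \<in> B \<Longrightarrow> dual X \<in> so n"
  using basis by (auto simp: basis_with_dual_def)

lemma omega_op_tspace: "Om d i j f \<in> tspace n d"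
  unfolding omega_op_def by (intro tspace_sum pos_act_tspace B_so)

lemma y_op_tspace: "f \<in> tspace n d \<Longrightarrow> Y d j f \<in> tspace n d"
  unfolding y_op_def by (intro tspace_closed tspace_sum omega_op_tspace tspace_scale)

lemma omega_op_add:
  assumes "i \<le> d" "j \<le> d"
  shows "Om d i j (f + g) = Om d i j f + Om d i j g" "Om d i j (tscale scl c f) = tscale scl c (Om d i j f)"
  using assms by (simp_all add: omega_op_def pos_act_add B_so sum.distrib t.scale_sum_right)

lemma y_op_add:
  assumes "j \<le> d"
  shows "Y d j (f + g) = Y d j f + Y d j g" "Y d j (tscale scl c f) = tscale scl c (Y d j f)"
  using assms
  by (simp_all add: y_op_def omega_op_add sum.distrib t.scale_sum_right t.scale_right_distrib
      t.scale_left_commute)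

lemma pos_act_sum: "X \<in> so n \<Longrightarrow> k \<le> d \<Longrightarrow> P d X k (sum g S) = (\<Sum>i\<in>S. P d X k (g i))"
  by (rule additive_sum(1)[of "P d X k", OF pos_act_add(1)])

lemma s_op_sum: "Suc k < d \<Longrightarrow> s_op n d scl (Suc k) (sum g S) = (\<Sum>i\<in>S. s_op n d scl (Suc k) (g i))"
  by (rule additive_sum(1)[of "s_op n d scl (Suc k)", OF s_op_add(1)])

lemma e_op_sum: "Suc k < d \<Longrightarrow> e_op n d scl (Suc k) (sum g S) = (\<Sum>i\<in>S. e_op n d scl (Suc k) (g i))"
  by (rule additive_sum(1)[of "e_op n d scl (Suc k)", OF e_op_add(1)])

lemma y_op_sum: "j \<le> d \<Longrightarrow> Y d j (sum g S) = (\<Sum>i\<in>S. Y d j (g i))"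
  by (rule additive_sum(1)[of "Y d j", OF y_op_add(1)])

lemma omega_op_adjacent:
  assumes "Suc k < d"
  shows "Om d (Suc k) (Suc (Suc k)) f = s_op n d scl (Suc k) f - e_op n d scl (Suc k) f"
proof (rule tspace_eqI[OF omega_op_tspace])
  show "s_op n d scl (Suc k) f - e_op n d scl (Suc k) f \<in> tspace n d"
    by (intro tspace_closed s_op_tspace e_op_tspace assms)
  fix u assume u: "u \<in> iwords n d"
  obtain xs a b ys where u': "u = xs @ a # b # ys" "length xs = k" by (rule iwords_split2[OF u assms])
  have W: "xs @ i # j # ys \<in> iwords n d" if "i \<in> idx n" "j \<in> idx n" for i j
    using that u u' by (auto simp: iwords_def)
  have ab: "a \<in> idx n" "b \<in> idx n" using u u' by (auto simp: iwords_def)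
  let ?I = "idx n" and ?g = "\<lambda>i j. f (xs @ i # j # ys)"
  have "Om d (Suc k) (Suc (Suc k)) f u = (\<Sum>X\<in>B. \<Sum>j\<in>?I. \<Sum>l\<in>?I. scl (X a j * dual X b l) (?g j l))"
    unfolding omega_op_def u'(1) sum_tensor_apply using ab
    by (simp add: pos_act_at0[OF W u'(2)] pos_act_at1[OF W u'(2)] scale_sum_right cong: sum.cong)
  also have "\<dots> = (\<Sum>j\<in>?I. \<Sum>X\<in>B. \<Sum>l\<in>?I. scl (X a j * dual X b l) (?g j l))"
    by (rule sum.swap)
  also have "\<dots> = (\<Sum>j\<in>?I. \<Sum>l\<in>?I. \<Sum>X\<in>B. scl (X a j * dual X b l) (?g j l))"
    by (rule sum.cong[OF refl], rule sum.swap)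
  also have "\<dots> = (\<Sum>j\<in>?I. \<Sum>l\<in>?I. scl (fmat (b, l) j a) (?g j l))"
    by (simp add: scale_sum_left[symmetric] casimir_entries[OF basis ab] cong: sum.cong)
  also have "\<dots> = (\<Sum>j\<in>?I. \<Sum>l\<in>?I. (if j = b then if l = a then ?g j l else 0 else 0)
      - (if a = - b then if l = - j then ?g j l else 0 else 0))"
    by (intro sum.cong refl) (auto simp: fmat_def scale_left_diff_distrib)
  also have "\<dots> = ?g b a - (if a = - b then \<Sum>j\<in>?I. ?g j (- j) else 0)"
  proof -
    have o: "(\<Sum>k\<in>?I. if c then h k else 0) = (if c then sum h ?I else 0)" for c and h :: "int \<Rightarrow> 'm" by simp
    show ?thesis using ab by (simp add: sum_subtractf o finite_idx idx_uminus cong: sum.cong)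
  qed
  finally show "Om d (Suc k) (Suc (Suc k)) f u = (s_op n d scl (Suc k) f - e_op n d scl (Suc k) f) u"
    using ab by (simp add: u'(1) s_op_at0[OF W u'(2)] e_op_at0[OF W u'(2)])
qed

text \<open>The bilinear map sends a pair to its first matrix acting in position i after its second
  acting in position j. By \<open>pos_act_lie\<close> its derivative along Z is the commutator with
  the joint action of Z in both positions.\<close>

lemma casimir_commute:
  assumes "Z \<in> so n" "i \<noteq> j" "i \<le> d" "j \<le> d"
  shows "P d Z i (Om d i j f) + P d Z j (Om d i j f) = Om d i j (P d Z i f + P d Z j f)"
proof -
  interpret b: so_bilinear "tscale scl" n "\<lambda>X Y. P d X i (P d Y j f)"
    by unfold_locales (simp_all add: pos_act_add_mat pos_act_add assms so_closed)
  have "P d (lie n Z X) i (P d (dual X) j f) + P d X i (P d (lie n Z (dual X)) j f) =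
      P d Z i (P d X i (P d (dual X) j f)) + P d Z j (P d X i (P d (dual X) j f))
      - P d X i (P d (dual X) j (P d Z i f + P d Z j f))" if "X \<in> B" for X
  proof -
    note S = assms(1) B_so[OF that]
    have D: "P d A k (g - h) = P d A k g - P d A k h" if "A \<in> so n" "k \<le> d" for A k g h
      by (rule additive_sum(2)[of "P d A k", OF pos_act_add(1)[OF that]])
    show ?thesis
      unfolding pos_act_lie[OF S(1,2) assms(3)] pos_act_lie[OF S(1,3) assms(4)]
      by (simp add: D S assms pos_act_add pos_act_comm[OF S(1,3) assms(2-4)]
          pos_act_comm[OF S(1,2) assms(2)[symmetric] assms(4,3)])
  qed
  with b.casimir_invariant[OF basis assms(1)]
  have "(\<Sum>X\<in>B. P d Z i (P d X i (P d (dual X) j f)) + P d Z j (P d X i (P d (dual X) j f))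
      - P d X i (P d (dual X) j (P d Z i f + P d Z j f))) = 0"
    by (simp cong: sum.cong)
  then show ?thesis
    by (simp add: omega_op_def pos_act_sum assms sum.distrib sum_subtractf)
qed

text \<open>A position other than i and j commutes with both factors of each summand of \<Omega>,
  which leaves the pair i, j to \<open>casimir_commute\<close>.\<close>

lemma sum_pos_act_omega:
  assumes "Z \<in> so n" "i \<noteq> j" "K \<subseteq> {..d}" "i \<in> K" "j \<in> K"
  shows "(\<Sum>k\<in>K. P d Z k (Om d i j f)) = Om d i j (\<Sum>k\<in>K. P d Z k f)"
proof -
  have fin: "finite K" using assms(3) finite_subset by blast
  have ij: "i \<le> d" "j \<le> d" using assms by auto
  have split: "(\<Sum>k\<in>K. g k) = g i + g j + (\<Sum>k\<in>K - {i, j}. g k)" for g :: "nat \<Rightarrow> 'm tensor"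
  proof -
    have 1: "sum g K = g i + sum g (K - {i})" by (rule sum.remove[OF fin assms(4)])
    have 2: "sum g (K - {i}) = g j + sum g (K - {i} - {j})"
      by (rule sum.remove) (use fin assms in auto)
    have 3: "K - {i} - {j} = K - {i, j}" by auto
    show ?thesis by (simp only: 1 2 3 add.assoc)
  qed
  have "P d Z k (Om d i j f) = Om d i j (P d Z k f)" if "k \<in> K - {i, j}" for k
  proof -
    have k: "k \<noteq> i" "k \<noteq> j" "k \<le> d" using that assms by auto
    show ?thesis
      by (simp add: omega_op_def pos_act_sum assms k
          pos_act_comm[OF assms(1) _ k(1,3) ij(1)] pos_act_comm[OF assms(1) _ k(2,3) ij(2)] B_so)
  qed
  then have "(\<Sum>k\<in>K - {i, j}. P d Z k (Om d i j f)) = Om d i j (\<Sum>k\<in>K - {i, j}. P d Z k f)"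
    by (simp add: additive_sum(1)[of "Om d i j", OF omega_op_add(1)[OF ij]])
  then show ?thesis
    by (subst (1 2) split) (simp only: casimir_commute[OF assms(1,2) ij] omega_op_add(1)[OF ij])
qed

text \<open>The set K stays general for two uses: \<open>{..<j}\<close> makes y_i commute with y_j
  for i < j, and \<open>{..d}\<close> gives equivariance.\<close>

lemma y_op_sum_pos_act:
  assumes "Z \<in> so n" "K \<subseteq> {..d}" "{..i} \<subseteq> K"
  shows "(\<Sum>k\<in>K. P d Z k (Y d i f)) = Y d i (\<Sum>k\<in>K. P d Z k f)"
proof -
  have i: "i \<le> d" using assms by auto
  have kd: "k \<le> d" if "k \<in> K" for k using assms that by auto
  have 1: "(\<Sum>k\<in>K. P d Z k (Y d i f)) = (\<Sum>k\<in>K. \<Sum>l<i. P d Z k (Om d l i f)) +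
      tscale scl ((2 * of_nat n - 1) / 2) (\<Sum>k\<in>K. P d Z k f)"
    by (simp add: y_op_def pos_act_add assms(1) pos_act_sum sum.distrib t.scale_sum_right kd cong: sum.cong)
  have "(\<Sum>k\<in>K. \<Sum>l<i. P d Z k (Om d l i f)) = (\<Sum>l<i. \<Sum>k\<in>K. P d Z k (Om d l i f))"
    by (rule sum.swap)
  also have "\<dots> = (\<Sum>l<i. Om d l i (\<Sum>k\<in>K. P d Z k f))"
    using assms by (intro sum.cong refl sum_pos_act_omega) auto
  finally have 2: "(\<Sum>k\<in>K. \<Sum>l<i. P d Z k (Om d l i f)) = (\<Sum>l<i. Om d l i (\<Sum>k\<in>K. P d Z k f))" .
  show ?thesis by (subst 1, subst 2) (simp only: y_op_def)
qed

lemma y_op_pos_act: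
  assumes "Z \<in> so n" "i < k" "k \<le> d"
  shows "P d Z k (Y d i f) = Y d i (P d Z k f)"
proof -
  have "P d Z k (Om d l i f) = Om d l i (P d Z k f)" if "l < i" for l
    using assms that by (simp add: omega_op_def pos_act_sum pos_act_comm[OF assms(1)] B_so)
  then show ?thesis using assms by (simp add: y_op_def pos_act_add pos_act_sum)
qed

text \<open>The exchanged order of summation shows, for each X, the joint action in positions 0,
  ..., j-1 applied after the action of \<open>dual X\<close> in position j.\<close>

lemma y_op_eq:
  assumes "j \<le> d"
  shows "Y d j f = (\<Sum>X\<in>B. \<Sum>k<j. P d X k (P d (dual X) j f)) + tscale scl ((2 * of_nat n - 1) / 2) f"
proof -
  have "(\<Sum>k<j. Om d k j f) = (\<Sum>X\<in>B. \<Sum>k<j. P d X k (P d (dual X) j f))"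
    unfolding omega_op_def by (rule sum.swap)
  then show ?thesis by (simp add: y_op_def)
qed

text \<open>The operator y_i acts in positions 0, ..., i. It commutes with the joint action in
  positions 0, ..., j-1 by invariance and with position j because it does not touch it, hence with
  every summand of \<open>y_op_eq\<close>.\<close>

lemma y_op_comm_less:
  assumes "i < j" "j \<le> d"
  shows "Y d i (Y d j f) = Y d j (Y d i f)"
proof -
  have i: "i \<le> d" using assms by simp
  have "Y d i (\<Sum>k<j. P d X k (P d (dual X) j f)) = (\<Sum>k<j. P d X k (P d (dual X) j (Y d i f)))"
    if "X \<in> B" for X
  proof -
    have "Y d i (\<Sum>k<j. P d X k (P d (dual X) j f)) = (\<Sum>k<j. P d X k (Y d i (P d (dual X) j f)))"
      by (rule y_op_sum_pos_act[symmetric]) (use assms B_so[OF that] in auto)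
    then show ?thesis using y_op_pos_act[OF B_so(2)[OF that] assms, of f] by simp
  qed
  then show ?thesis
    unfolding y_op_eq[OF assms(2)] by (simp add: y_op_add[OF i] y_op_sum[OF i])
qed

lemma y_op_comm: "i \<le> d \<Longrightarrow> j \<le> d \<Longrightarrow> Y d i (Y d j f) = Y d j (Y d i f)"
  using y_op_comm_less[of i j d f] y_op_comm_less[of j i d f] by (cases i j rule: linorder_cases) auto

text \<open>K contains both adjacent positions or neither of them. If both, s exchanges their two
  summands, while for e the two summands cancel on either side of the equation.\<close>

lemma sum_pos_act_s_e:
  assumes "Z \<in> so n" "Suc k < d" "K \<subseteq> {..d}" "Suc k \<in> K \<longleftrightarrow> Suc (Suc k) \<in> K"
  shows "s_op n d scl (Suc k) (\<Sum>l\<in>K. P d Z l f) = (\<Sum>l\<in>K. P d Z l (s_op n d scl (Suc k) f))"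
    "e_op n d scl (Suc k) (\<Sum>l\<in>K. P d Z l f) = (\<Sum>l\<in>K. P d Z l (e_op n d scl (Suc k) f))"
proof -
  let ?a = "Suc k" let ?b = "Suc (Suc k)" let ?K = "K - {?a, ?b}"
  have fin: "finite K" using assms(3) finite_subset by blast
  have far: "s_op n d scl ?a (\<Sum>l\<in>?K. P d Z l f) = (\<Sum>l\<in>?K. P d Z l (s_op n d scl ?a f))"
    "e_op n d scl ?a (\<Sum>l\<in>?K. P d Z l f) = (\<Sum>l\<in>?K. P d Z l (e_op n d scl ?a f))"
    unfolding s_op_sum[OF assms(2)] e_op_sum[OF assms(2)]
    by (intro sum.cong refl pos_far[OF assms(1,2)]; use assms(3) in auto)+
  show "s_op n d scl ?a (\<Sum>l\<in>K. P d Z l f) = (\<Sum>l\<in>K. P d Z l (s_op n d scl ?a f))"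
    "e_op n d scl ?a (\<Sum>l\<in>K. P d Z l f) = (\<Sum>l\<in>K. P d Z l (e_op n d scl ?a f))"
  proof (atomize (full), cases "?a \<in> K")
    case True
    have split: "(\<Sum>l\<in>K. g l) = g ?a + g ?b + (\<Sum>l\<in>?K. g l)" for g :: "nat \<Rightarrow> 'm tensor"
    proof -
      have 1: "sum g K = g ?a + sum g (K - {?a})" by (rule sum.remove[OF fin True])
      have 2: "sum g (K - {?a}) = g ?b + sum g (K - {?a} - {?b})"
        by (rule sum.remove) (use fin True assms(4) in auto)
      have 3: "K - {?a} - {?b} = ?K" by auto
      show ?thesis by (simp only: 1 2 3 add.assoc)
    qed
    show "s_op n d scl ?a (\<Sum>l\<in>K. P d Z l f) = (\<Sum>l\<in>K. P d Z l (s_op n d scl ?a f)) \<and>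
        e_op n d scl ?a (\<Sum>l\<in>K. P d Z l f) = (\<Sum>l\<in>K. P d Z l (e_op n d scl ?a f))"
      unfolding split s_op_add[OF assms(2)] e_op_add[OF assms(2)] far s_op_pos_same[OF assms(1,2)]
        e_op_pos_antisym[OF assms(1,2)] by (simp add: add.commute)
  next
    case False
    then have "?K = K" using assms(4) by auto
    with far show "s_op n d scl ?a (\<Sum>l\<in>K. P d Z l f) = (\<Sum>l\<in>K. P d Z l (s_op n d scl ?a f)) \<and>
        e_op n d scl ?a (\<Sum>l\<in>K. P d Z l f) = (\<Sum>l\<in>K. P d Z l (e_op n d scl ?a f))" by simp
  qed
qed

lemma y_op_far:
  assumes "Suc k < d" "j \<le> d" "j \<noteq> Suc k" "j \<noteq> Suc (Suc k)"
  shows "s_op n d scl (Suc k) (Y d j f) = Y d j (s_op n d scl (Suc k) f)"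
    "e_op n d scl (Suc k) (Y d j f) = Y d j (e_op n d scl (Suc k) f)"
proof -
  \<comment> \<open>As j is neither of the two adjacent positions, both lie below j or neither
    does.\<close>
  have K: "Suc k \<in> {..<j} \<longleftrightarrow> Suc (Suc k) \<in> {..<j}" "{..<j} \<subseteq> {..d}" using assms by auto
  have "s_op n d scl (Suc k) (\<Sum>l<j. P d X l (P d (dual X) j f)) =
      (\<Sum>l<j. P d X l (P d (dual X) j (s_op n d scl (Suc k) f)))"
    "e_op n d scl (Suc k) (\<Sum>l<j. P d X l (P d (dual X) j f)) =
      (\<Sum>l<j. P d X l (P d (dual X) j (e_op n d scl (Suc k) f)))" if "X \<in> B" for X
    unfolding sum_pos_act_s_e[OF B_so(1)[OF that] assms(1) K(2,1)]
      pos_far[OF B_so(2)[OF that] assms] by (rule refl)+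
  then show "s_op n d scl (Suc k) (Y d j f) = Y d j (s_op n d scl (Suc k) f)"
    "e_op n d scl (Suc k) (Y d j f) = Y d j (e_op n d scl (Suc k) f)"
    unfolding y_op_eq[OF assms(2)]
    by (simp_all add: s_op_add[OF assms(1)] e_op_add[OF assms(1)] s_op_sum[OF assms(1)] e_op_sum[OF assms(1)])
qed

lemma s_op_omega_same:
  assumes "Suc k < d" "l < Suc k"
  shows "s_op n d scl (Suc k) (Om d l (Suc k) f) = Om d l (Suc (Suc k)) (s_op n d scl (Suc k) f)"
    "s_op n d scl (Suc k) (Om d l (Suc (Suc k)) f) = Om d l (Suc k) (s_op n d scl (Suc k) f)"
  unfolding omega_op_def s_op_sum[OF assms(1)] using assms
  by (auto simp: B_so pos_far s_op_pos_same intro!: sum.cong)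

lemma e_op_omega_antisym:
  assumes "Suc k < d" "l < Suc k"
  shows "e_op n d scl (Suc k) (Om d l (Suc k) f) + e_op n d scl (Suc k) (Om d l (Suc (Suc k)) f) = 0"
    "Om d l (Suc k) (e_op n d scl (Suc k) f) + Om d l (Suc (Suc k)) (e_op n d scl (Suc k) f) = 0"
proof -
  have l: "l \<le> d" "l \<noteq> Suc k" "l \<noteq> Suc (Suc k)" using assms by auto
  have "e_op n d scl (Suc k) (P d X l (P d (dual X) (Suc k) f)) +
      e_op n d scl (Suc k) (P d X l (P d (dual X) (Suc (Suc k)) f)) = 0"
    "P d X l (P d (dual X) (Suc k) (e_op n d scl (Suc k) f)) +
      P d X l (P d (dual X) (Suc (Suc k)) (e_op n d scl (Suc k) f)) = 0" if "X \<in> B" for X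
  proof -
    note S = B_so[OF that]
    have z: "P d X l 0 = 0" by (rule additive_sum(3)[of "P d X l", OF pos_act_add(1)[OF S(1) l(1)]])
    show "e_op n d scl (Suc k) (P d X l (P d (dual X) (Suc k) f)) +
        e_op n d scl (Suc k) (P d X l (P d (dual X) (Suc (Suc k)) f)) = 0"
      by (simp only: pos_far(2)[OF S(1) assms(1) l] pos_act_add(1)[OF S(1) l(1), symmetric]
          e_op_pos_antisym[OF S(2) assms(1)] z)
    show "P d X l (P d (dual X) (Suc k) (e_op n d scl (Suc k) f)) +
        P d X l (P d (dual X) (Suc (Suc k)) (e_op n d scl (Suc k) f)) = 0"
      by (simp only: pos_act_add(1)[OF S(1) l(1), symmetric] e_op_pos_antisym[OF S(2) assms(1)] z)
  qed
  then show "e_op n d scl (Suc k) (Om d l (Suc k) f) + e_op n d scl (Suc k) (Om d l (Suc (Suc k)) f) = 0"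
    "Om d l (Suc k) (e_op n d scl (Suc k) f) + Om d l (Suc (Suc k)) (e_op n d scl (Suc k) f) = 0"
    by (simp_all add: omega_op_def e_op_sum[OF assms(1)] sum.distrib[symmetric])
qed

text \<open>The sum for y_{a+1} has one more term, \<Omega>_{a,a+1} = s - e, whose product with s is
  1 - e; conjugation by s exchanges the other terms with those of y_a. The hypothesis on f is needed
  because s s = 1 holds only on \<open>tspace n d\<close>.\<close>

lemma y_op_skein:
  assumes "Suc k < d" "f \<in> tspace n d"
  shows "Y d (Suc k) (s_op n d scl (Suc k) f) - s_op n d scl (Suc k) (Y d (Suc (Suc k)) f) =
      e_op n d scl (Suc k) f - f"
    "s_op n d scl (Suc k) (Y d (Suc k) f) - Y d (Suc (Suc k)) (s_op n d scl (Suc k) f) =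
      e_op n d scl (Suc k) f - f"
proof -
  have D: "s_op n d scl (Suc k) (g - h) = s_op n d scl (Suc k) g - s_op n d scl (Suc k) h" for g h
    by (rule additive_sum(2)[of "s_op n d scl (Suc k)", OF s_op_add(1)[OF assms(1)]])
  note s = s_op_add[OF assms(1)] s_op_sum[OF assms(1)] s_op_s_op[OF assms] s_op_e_op[OF assms(1)]
    e_op_s_op[OF assms(1)] D omega_op_adjacent[OF assms(1)]
  have c: "(\<Sum>l<Suc k. Om d l (Suc k) (s_op n d scl (Suc k) f)) =
      (\<Sum>l<Suc k. s_op n d scl (Suc k) (Om d l (Suc (Suc k)) f))"
    "(\<Sum>l<Suc k. Om d l (Suc (Suc k)) (s_op n d scl (Suc k) f)) =
      (\<Sum>l<Suc k. s_op n d scl (Suc k) (Om d l (Suc k) f))"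
    by (rule sum.cong[OF refl], simp add: s_op_omega_same[OF assms(1)])+
  show "Y d (Suc k) (s_op n d scl (Suc k) f) - s_op n d scl (Suc k) (Y d (Suc (Suc k)) f) =
      e_op n d scl (Suc k) f - f"
    "s_op n d scl (Suc k) (Y d (Suc k) f) - Y d (Suc (Suc k)) (s_op n d scl (Suc k) f) =
      e_op n d scl (Suc k) f - f"
    unfolding y_op_def sum.lessThan_Suc[of _ "Suc k"] s c by (simp_all only: algebra_simps)
qed

text \<open>The terms with l < a cancel in pairs. The adjacent term contributes e s - e e = (1 - 2n)
  e, and the need to cancel it by twice the scalar in y explains the value (2n - 1)/2.\<close>

lemma y_op_antisym:
  assumes "Suc k < d"
  shows "e_op n d scl (Suc k) (Y d (Suc k) f) + e_op n d scl (Suc k) (Y d (Suc (Suc k)) f) = 0"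
    "Y d (Suc k) (e_op n d scl (Suc k) f) + Y d (Suc (Suc k)) (e_op n d scl (Suc k) f) = 0"
proof -
  have D: "e_op n d scl (Suc k) (g - h) = e_op n d scl (Suc k) g - e_op n d scl (Suc k) h" for g h
    by (rule additive_sum(2)[of "e_op n d scl (Suc k)", OF e_op_add(1)[OF assms(1)]])
  have c: "tscale scl c g + tscale scl c g = tscale scl (2 * c) g" for c g
    by (simp add: t.scale_left_distrib[symmetric])
  have c2: "tscale scl (2 * ((2 * of_nat n - 1) / 2)) g = tscale scl (of_nat (2 * n)) g - g" for g
  proof -
    have "2 * ((2 * of_nat n - 1) / 2) = (of_nat (2 * n) - 1 :: complex)" by simp
    then show ?thesis by (simp only: t.scale_left_diff_distrib t.scale_one)
  qed
  let ?e = "e_op n d scl (Suc k)" and ?c = "(2 * of_nat n - 1) / 2 :: complex"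
  have "?e (Y d (Suc k) f) + ?e (Y d (Suc (Suc k)) f) =
      (\<Sum>l<Suc k. ?e (Om d l (Suc k) f) + ?e (Om d l (Suc (Suc k)) f)) + ?e (Om d (Suc k) (Suc (Suc k)) f)
      + (tscale scl ?c (?e f) + tscale scl ?c (?e f))"
    unfolding y_op_def sum.lessThan_Suc[of _ "Suc k"] e_op_add[OF assms] e_op_sum[OF assms] sum.distrib
    by (simp only: add_ac)
  also have "(\<Sum>l<Suc k. ?e (Om d l (Suc k) f) + ?e (Om d l (Suc (Suc k)) f)) = 0"
    by (rule sum.neutral) (simp add: e_op_omega_antisym[OF assms])
  finally show "?e (Y d (Suc k) f) + ?e (Y d (Suc (Suc k)) f) = 0"
    unfolding c c2 omega_op_adjacent[OF assms] D e_op_s_op[OF assms] e_op_e_op[OF assms] by (simp add: fun_eq_iff)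
  have "Y d (Suc k) (?e f) + Y d (Suc (Suc k)) (?e f) =
      (\<Sum>l<Suc k. Om d l (Suc k) (?e f) + Om d l (Suc (Suc k)) (?e f)) + Om d (Suc k) (Suc (Suc k)) (?e f)
      + (tscale scl ?c (?e f) + tscale scl ?c (?e f))"
    unfolding y_op_def sum.lessThan_Suc[of _ "Suc k"] sum.distrib by (simp only: add_ac)
  also have "(\<Sum>l<Suc k. Om d l (Suc k) (?e f) + Om d l (Suc (Suc k)) (?e f)) = 0"
    by (rule sum.neutral) (simp add: e_op_omega_antisym[OF assms])
  finally show "Y d (Suc k) (?e f) + Y d (Suc (Suc k)) (?e f) = 0"
    unfolding c c2 omega_op_adjacent[OF assms] s_op_e_op[OF assms] e_op_e_op[OF assms] by (simp add: fun_eq_iff)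
qed

lemma g_act_commute:
  assumes "Z \<in> so n"
  shows "j \<le> d \<Longrightarrow> Y d j (g_act n d scl \<rho> Z f) = g_act n d scl \<rho> Z (Y d j f)"
    "Suc k < d \<Longrightarrow> s_op n d scl (Suc k) (g_act n d scl \<rho> Z f) = g_act n d scl \<rho> Z (s_op n d scl (Suc k) f)"
    "Suc k < d \<Longrightarrow> e_op n d scl (Suc k) (g_act n d scl \<rho> Z f) = g_act n d scl \<rho> Z (e_op n d scl (Suc k) f)"
  unfolding g_act_def
  using y_op_sum_pos_act[OF assms, of "{..d}" d j f] sum_pos_act_s_e[OF assms, of k d "{..d}" f] by auto

end

section \<open>Endomorphisms of highest weight modules\<close>

text \<open>So \<open>fmat (p, q)\<close>, where it is nonzero, is a weight vector for the
  difference of the weights of v_p and v_q.\<close>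

lemma lie_cartan_fmat:
  assumes "H \<in> cartan n" "p \<in> idx n" "q \<in> idx n"
  shows "lie n H (fmat (p, q)) = mscale (H p p - H q q) (fmat (p, q))"
proof -
  have H: "H \<in> so n" "\<And>i j. i \<noteq> j \<Longrightarrow> H i j = 0" using assms(1) by (auto simp: cartan_def)
  have "(\<Sum>r\<in>idx n. mscale (H r p) (fmat (r, q))) = (\<Sum>r\<in>idx n. if r = p then mscale (H p p) (fmat (p, q)) else 0)"
    "(\<Sum>r\<in>idx n. mscale (H q r) (fmat (p, r))) = (\<Sum>r\<in>idx n. if r = q then mscale (H q q) (fmat (p, q)) else 0)"
    using H(2) by (auto intro!: sum.cong)
  then show ?thesis
    unfolding lie_fmat[OF H(1) assms(2,3)]
    using assms(2,3) by (simp only: finite_idx sum.delta if_True mat.scale_left_diff_distrib)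
qed

lemma fmat_cartan: "p \<in> idx n \<Longrightarrow> fmat (p, p) \<in> cartan n"
  unfolding cartan_def using fmat_so by (auto simp: fmat_def)

text \<open>The order of the integers is adapted to the choice of positive roots. Since
  \<open>eps (- i)\<close> is the negative of \<open>eps i\<close> on the Cartan subalgebra, the
  sign patterns of p and q lead to the sums and differences in \<open>pos_roots\<close>.\<close>

lemma fmat_n_plus:
  assumes "p \<in> idx n" "q \<in> idx n" "q < p"
  shows "fmat (p, q) \<in> n_plus n"
proof (cases "p = - q")
  case True
  \<comment> \<open>Twice \<open>eps p\<close> is not a root: a skew matrix vanishes on the
    antidiagonal.\<close>
  then have "fmat (p, q) = 0" by (auto simp: fmat_def fun_eq_iff)
  then show ?thesis by (simp add: n_plus_def mat.span_zero)
next
  case False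
  have N: "H (- i) (- i) = - H i i" if "H \<in> cartan n" "i \<in> idx n" for H i
    using that unfolding cartan_def so_iff by blast
  have root: "fmat (p, q) \<in> n_plus n"
    if "\<alpha> \<in> pos_roots n" "\<And>H. H \<in> cartan n \<Longrightarrow> \<alpha> H = H p p - H q q" for \<alpha>
  proof -
    have "fmat (p, q) \<in> root_space n \<alpha>"
      using that(2) by (simp add: root_space_def fmat_so assms lie_cartan_fmat)
    with that(1) show ?thesis unfolding n_plus_def by (auto intro!: mat.span_base)
  qed
  have idx: "1 \<le> \<bar>p\<bar>" "\<bar>p\<bar> \<le> int n" "1 \<le> \<bar>q\<bar>" "\<bar>q\<bar> \<le> int n" using assms by (auto simp: idx_def)
  have pq: "eps (- i) H = - H i i" if "H \<in> cartan n" "i \<in> {p, q}" for H i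
    using N[OF that(1), of i] that(2) assms by (auto simp: eps_def)
  consider "q > 0" | "p < 0" | "p > 0" "q < 0" "- q < p" | "p > 0" "q < 0" "p < - q"
    using idx False assms(3) by linarith
  then show ?thesis
  proof cases
    case 1
    have "eps p - eps q \<in> pos_roots n" using 1 assms(3) idx unfolding pos_roots_def by fastforce
    then show ?thesis by (rule root) (simp add: eps_def)
  next
    case 2
    have "eps (- q) - eps (- p) \<in> pos_roots n"
      using 2 assms(3) idx unfolding pos_roots_def
      by (intro UnI2 CollectI exI[of _ "- q"] exI[of _ "- p"]) auto
    then show ?thesis by (rule root) (simp add: pq)
  next
    case 3
    have "eps p + eps (- q) \<in> pos_roots n"
      using 3 assms(3) idx unfolding pos_roots_def
      by (intro UnI1 CollectI exI[of _ "p"] exI[of _ "- q"]) auto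
    then show ?thesis by (rule root) (simp add: pq, simp add: eps_def)
  next
    case 4
    have "eps (- q) + eps p \<in> pos_roots n"
      using 4 assms(3) idx unfolding pos_roots_def
      by (intro UnI1 CollectI exI[of _ "- q"] exI[of _ "p"]) auto
    then show ?thesis by (rule root) (simp add: pq, simp add: eps_def)
  qed
qed

lemma (in so_module) rho_sum:
  assumes "\<And>i. i \<in> S \<Longrightarrow> X i \<in> so n"
  shows "\<rho> (\<Sum>i\<in>S. X i) x = (\<Sum>i\<in>S. \<rho> (X i) x)"
proof -
  have z: "\<rho> 0 x = 0"
    using rho_scale[of 0 0 x] so_closed(5) by simp
  show ?thesis
    using assms
  proof (induction S rule: infinite_finite_induct)
    case (insert i S)
    have "\<rho> (X i + (\<Sum>i\<in>S. X i)) x = \<rho> (X i) x + \<rho> (\<Sum>i\<in>S. X i) x"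
      using insert by (intro rho_add so_closed) auto
    with insert show ?case by (simp only: sum.insert insertI1 insertI2 simp_thms)
  qed (simp_all only: sum.infinite sum.empty z simp_thms)
qed

lemma (in so_module) rho_subspace_fmat:
  assumes "subspace W" "\<And>p q. p \<in> idx n \<Longrightarrow> q \<in> idx n \<Longrightarrow> \<rho> (fmat (p, q)) x \<in> W" "X \<in> so n"
  shows "\<rho> X x \<in> W"
proof -
  have "\<rho> (mscale 2 X) x = (\<Sum>p\<in>idx n. \<Sum>q\<in>idx n. scl (X p q) (\<rho> (fmat (p, q)) x))"
    unfolding fmat_expand[OF assms(3), symmetric]
    by (subst rho_sum, (auto intro!: so_closed fmat_so)[1], rule sum.cong[OF refl],
        subst rho_sum, (auto intro!: so_closed fmat_so)[1], rule sum.cong[OF refl])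
      (simp add: rho_scale fmat_so)
  also have "\<dots> \<in> W"
    using assms by (intro subspace_sum subspace_scale) auto
  finally have "scl 2 (\<rho> X x) \<in> W" by (simp add: rho_scale assms(3))
  from subspace_scale[OF assms(1) this, of "1/2"] show ?thesis by simp
qed

section \<open>A grading element of the Cartan subalgebra\<close>

definition grading :: "nat \<Rightarrow> mat" where
  "grading n = (\<lambda>i j. if i = j \<and> i \<in> idx n then of_int i else 0)"

lemma grading_cartan: "grading n \<in> cartan n"
  unfolding cartan_def so_iff by (auto simp: grading_def gl_def idx_uminus)

lemma grading_so: "grading n \<in> so n"
  using grading_cartan by (simp add: cartan_def)

text \<open>The sign of the eigenvalue p - q separates raising from lowering operators, so this
  single operator can replace the whole weight decomposition.\<close>

lemma lie_grading_fmat: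
  "p \<in> idx n \<Longrightarrow> q \<in> idx n \<Longrightarrow> lie n (grading n) (fmat (p, q)) = mscale (of_int (p - q)) (fmat (p, q))"
  by (simp add: lie_cartan_fmat[OF grading_cartan]) (simp add: grading_def)

text \<open>The operator \<open>K N\<close> below is the product of \<open>D + 1, \<dots>, D + N\<close>: it kills the sum of the
  eigenspaces of \<open>D\<close> for \<open>-1, \<dots>, -N\<close> and acts on the kernel of \<open>D\<close> as \<open>N!\<close>.\<close>

lemma (in vector_space) kernel_meets_negative_eigenspaces:
  assumes lin: "\<And>x y. D (x + y) = D x + D y" "\<And>a x. D (scale a x) = scale a (D x)"
  obtains S where "subspace S"
    and "\<And>k x. k \<ge> 1 \<Longrightarrow> D x = scale (- of_nat k :: 'a) x \<Longrightarrow> x \<in> S"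
    and "\<And>x. (\<And>k. (of_nat (Suc k) :: 'a) \<noteq> 0) \<Longrightarrow> x \<in> S \<Longrightarrow> D x = 0 \<Longrightarrow> x = 0"
proof -
  define K where "K = rec_nat (\<lambda>y. y) (\<lambda>N g y. D (g y) + scale (of_nat (Suc N)) (g y))"
  have K: "K 0 y = y" "K (Suc N) y = D (K N y) + scale (of_nat (Suc N)) (K N y)" for N y
    by (simp_all add: K_def)
  have Klin: "K N (x + y) = K N x + K N y" "K N (scale a x) = scale a (K N x)" for N x y a
    by (induction N) (simp_all add: K lin scale_right_distrib scale_left_commute add_ac)
  have D0: "D 0 = 0" using lin(2)[of 0 0] by simp
  have up: "K (M + N) y = 0" if "K N y = 0" for M N y
    using that by (induction M) (simp_all add: K D0)
  have eig: "K N x = scale (\<Prod>l<N. of_nat (Suc l) + a) x" if "D x = scale a x" for N x a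
    by (induction N) (simp_all only: K lin that prod.lessThan_Suc scale_scale scale_left_distrib[symmetric]
        prod.empty lessThan_0 scale_one, simp add: algebra_simps)
  \<comment> \<open>By \<open>up\<close> the kernels increase with N, so their union is a subspace.
    No bound on the eigenvalues is fixed in advance, and no direct sum decomposition is
    required.\<close>
  define S where "S = {y. \<exists>N. K N y = 0}"
  have "subspace S"
    unfolding subspace_def
  proof (intro conjI ballI allI)
    have "K 0 0 = 0" by (simp add: K)
    then show "0 \<in> S" unfolding S_def by blast
    fix x y assume "x \<in> S" "y \<in> S"
    then obtain M N where "K M x = 0" "K N y = 0" by (auto simp: S_def)
    then have "K (N + M) (x + y) = 0" using up[of M x N] up[of N y M] by (simp add: Klin add.commute)
    then show "x + y \<in> S" unfolding S_def by blast
  next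
    fix c x assume "x \<in> S"
    then obtain N where "K N x = 0" by (auto simp: S_def)
    then have "K N (scale c x) = 0" by (simp add: Klin)
    then show "scale c x \<in> S" unfolding S_def by blast
  qed
  moreover have "x \<in> S" if "k \<ge> 1" "D x = scale (- of_nat k) x" for k x
  proof -
    \<comment> \<open>The factor for l = k - 1 vanishes; it is present because k is at least
      1.\<close>
    have "(\<Prod>l<k. of_nat (Suc l) + - of_nat k :: 'a) = 0"
      using that(1) by (intro prod_zero) (auto intro!: bexI[of _ "k - 1"])
    then have "K k x = 0" by (simp only: eig[OF that(2)] scale_zero_left)
    then show ?thesis unfolding S_def by blast
  qed
  moreover have "x = 0" if char: "\<And>k. (of_nat (Suc k) :: 'a) \<noteq> 0" and "x \<in> S" "D x = 0" for x
  proof -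
    obtain N where N: "K N x = 0" using \<open>x \<in> S\<close> by (auto simp: S_def)
    have "D x = scale 0 x" using \<open>D x = 0\<close> by simp
    from eig[OF this, of N] N have "scale (\<Prod>l<N. of_nat (Suc l)) x = 0" by simp
    moreover have "(\<Prod>l<N. of_nat (Suc l) :: 'a) \<noteq> 0" using char by (subst prod_zero_iff) (simp, blast)
    ultimately show ?thesis by simp
  qed
  ultimately show thesis by (rule that)
qed

context highest_weight_module
begin

lemma endomorphism_scalar:
  assumes lin: "\<And>x y. \<phi> (x + y) = \<phi> x + \<phi> y" "\<And>a x. \<phi> (scl a x) = scl a (\<phi> x)"
    and comm: "\<And>X x. X \<in> so n \<Longrightarrow> \<phi> (\<rho> X x) = \<rho> X (\<phi> x)"
  obtains c where "\<And>x. \<phi> x = scl c x"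
proof -
  obtain m where m0: "\<forall>X\<in>n_plus n. \<rho> X m = 0" "\<forall>H\<in>cartan n. \<exists>c. \<rho> H m = scl c m"
    and gen0: "\<forall>W. subspace W \<and> m \<in> W \<and> (\<forall>X\<in>so n. \<forall>x\<in>W. \<rho> X x \<in> W) \<longrightarrow> W = UNIV"
    using highest_weight_vector by (elim exE conjE) (rule that)
  note m = bspec[OF m0(1)] bspec[OF m0(2)]
  have gen: "W = UNIV" if "subspace W" "m \<in> W" "\<And>X x. X \<in> so n \<Longrightarrow> x \<in> W \<Longrightarrow> \<rho> X x \<in> W" for W
    using gen0 that by simp
  define N where "N = {(p, q). p \<in> idx n \<and> q \<in> idx n \<and> p < q}"
  define w where "w ps = foldr (\<lambda>pq. \<rho> (fmat pq)) ps m" for ps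
  have w: "w [] = m" "w (pq # ps) = \<rho> (fmat pq) (w ps)" for pq ps by (simp_all add: w_def)
  have Nso: "fmat pq \<in> so n" if "pq \<in> N" for pq using that by (auto simp: N_def fmat_so)
  \<comment> \<open>That words in lowering operators alone span M is the part of the
    Poincare-Birkhoff-Witt theorem used here; it is proved directly, by showing that W is stable
    under \<open>so n\<close>.\<close>
  define W where "W = span (w ` lists N)"
  have W: "subspace W" by (simp add: W_def)
  have wW: "w ps \<in> W" if "ps \<in> lists N" for ps using that by (auto simp: W_def intro: span_base)
  have stab: "\<rho> X x \<in> W" if X: "X \<in> so n" "\<And>ps. ps \<in> lists N \<Longrightarrow> \<rho> X (w ps) \<in> W" and x: "x \<in> W" for X x
  proof -
    have "subspace {x. \<rho> X x \<in> W}"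
      using W by (auto simp: subspace_def rho_linear_simps[OF X(1)] rho_zero[OF X(1)])
    from span_minimal[OF _ this, of "w ` lists N"] X(2) x show ?thesis by (auto simp: W_def)
  qed
  have low: "\<rho> (fmat pq) x \<in> W" if "pq \<in> N" "x \<in> W" for pq x
    using stab[OF Nso[OF that(1)] _ that(2)] wW that(1) w(2) by (metis lists.Cons)
  \<comment> \<open>The induction is on the word, for all X at once: X is moved past the first
    lowering operator, and the commutator is another element of \<open>so n\<close>, to which the
    hypothesis for the shorter word applies.\<close>
  have all: "\<rho> X (w ps) \<in> W" if "ps \<in> lists N" "X \<in> so n" for X ps
    using that
  proof (induction ps arbitrary: X rule: lists.induct)
    case Nil
    show ?case
    proof (rule rho_subspace_fmat[OF W _ Nil])
      fix p q assume pq: "p \<in> idx n" "q \<in> idx n"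
      consider "p < q" | "p = q" | "q < p" by linarith
      then show "\<rho> (fmat (p, q)) (w []) \<in> W"
      proof cases
        case 1
        then show ?thesis using low[of "(p, q)" m] wW[of "[]"] pq by (simp add: N_def w)
      next
        case 2
        then obtain c where "\<rho> (fmat (p, q)) m = scl c m" using m(2) fmat_cartan pq by blast
        then show ?thesis using subspace_scale[OF W wW[of "[]"]] by (simp add: w)
      next
        case 3
        then show ?thesis using m(1)[OF fmat_n_plus[OF pq]] subspace_0[OF W] by (simp add: w)
      qed
    qed
  next
    case (Cons pq ps)
    note F = Nso[OF Cons(1)]
    have "\<rho> X (w (pq # ps)) = \<rho> (fmat pq) (\<rho> X (w ps)) + \<rho> (lie n X (fmat pq)) (w ps)"
      using Cons(4) F by (simp add: w rho_lie)
    also have "\<dots> \<in> W"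
      using Cons F by (intro subspace_add[OF W] low Cons.IH so_lie) auto
    finally show ?case .
  qed
  have "W = UNIV"
    by (rule gen[OF W]) (use wW[of "[]"] stab all in \<open>auto simp: w\<close>)
  obtain c where c: "\<rho> (grading n) m = scl c m" using m(2)[OF grading_cartan] by blast
  \<comment> \<open>The shift by the eigenvalue c puts m into the kernel of D and makes the
    eigenvalues of nonempty words negative integers.\<close>
  define D where "D x = \<rho> (grading n) x - scl c x" for x
  have D: "D (x + y) = D x + D y" "D (scl a x) = scl a (D x)" for x y a
    by (simp_all add: D_def rho_linear_simps grading_so scale_right_distrib scale_right_diff_distrib
        scale_left_commute)
  have wt: "\<exists>k. D (w ps) = scl (- of_nat k) (w ps) \<and> (ps \<noteq> [] \<longrightarrow> k \<ge> 1)" if "ps \<in> lists N" for ps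
    using that
  proof (induction ps rule: lists.induct)
    case Nil
    then show ?case by (intro exI[of _ 0]) (simp add: w D_def c)
  next
    case (Cons pq ps)
    obtain p q where pq: "pq = (p, q)" "p \<in> idx n" "q \<in> idx n" "p < q"
      using Cons(1) by (auto simp: N_def)
    obtain k where k: "D (w ps) = scl (- of_nat k) (w ps)" using Cons by blast
    have F: "fmat (p, q) \<in> so n" by (rule fmat_so) fact+
    have "\<rho> (lie n (grading n) (fmat (p, q))) (w ps) = scl (of_int (p - q)) (\<rho> (fmat (p, q)) (w ps))"
      unfolding lie_grading_fmat[OF pq(2,3)] by (rule rho_scale[OF F])
    then have "D (w (pq # ps)) = \<rho> (fmat (p, q)) (D (w ps)) + scl (of_int (p - q)) (w (pq # ps))"
      by (simp add: w pq D_def rho_lie[OF grading_so F] rho_linear_simps[OF F] algebra_simps)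
    also have "\<dots> = scl (- of_nat k + of_int (p - q)) (w (pq # ps))"
      by (simp only: k rho_linear_simps[OF F] w pq scale_left_distrib)
    also have "- of_nat k + of_int (p - q) = (- of_nat (k + nat (q - p)) :: complex)"
      using pq(4) by simp
    finally show ?case using pq(4) by (intro exI[of _ "k + nat (q - p)"]) simp
  qed
  obtain S where S: "subspace S" "\<And>k x. k \<ge> 1 \<Longrightarrow> D x = scl (- of_nat k) x \<Longrightarrow> x \<in> S"
    "\<And>x. x \<in> S \<Longrightarrow> D x = 0 \<Longrightarrow> x = 0"
    using kernel_meets_negative_eigenspaces[of D, OF D] of_nat_neq_0 by (metis (no_types, lifting))
  have "subspace {x. \<exists>a. x - scl a m \<in> S}"
    unfolding subspace_def
  proof (intro conjI ballI allI)
    show "0 \<in> {x. \<exists>a. x - scl a m \<in> S}" using subspace_0[OF S(1)] by (auto intro!: exI[of _ 0])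
    fix x y assume "x \<in> {x. \<exists>a. x - scl a m \<in> S}" "y \<in> {x. \<exists>a. x - scl a m \<in> S}"
    then obtain a b where "x - scl a m \<in> S" "y - scl b m \<in> S" by blast
    from subspace_add[OF S(1) this] show "x + y \<in> {x. \<exists>a. x - scl a m \<in> S}"
      by (auto simp: algebra_simps intro!: exI[of _ "a + b"])
  next
    fix b x assume "x \<in> {x. \<exists>a. x - scl a m \<in> S}"
    then obtain a where "x - scl a m \<in> S" by blast
    from subspace_scale[OF S(1) this, of b] show "scl b x \<in> {x. \<exists>a. x - scl a m \<in> S}"
      by (auto simp: scale_right_diff_distrib intro!: exI[of _ "b * a"])
  qed
  moreover have "w ` lists N \<subseteq> {x. \<exists>a. x - scl a m \<in> S}"
  proof
    fix x assume "x \<in> w ` lists N"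
    then obtain ps where ps: "ps \<in> lists N" "x = w ps" by blast
    show "x \<in> {x. \<exists>a. x - scl a m \<in> S}"
    proof (cases "ps = []")
      case True
      then show ?thesis using subspace_0[OF S(1)] ps by (auto simp: w intro!: exI[of _ 1])
    next
      case False
      then have "x \<in> S" using wt[OF ps(1)] S(2) ps(2) by blast
      then show ?thesis by (auto intro!: exI[of _ 0])
    qed
  qed
  \<comment> \<open>M is spanned by m and S: the empty word is m, and all other words lie in
    S.\<close>
  ultimately have decomp: "\<exists>a. x - scl a m \<in> S" for x
    using span_minimal \<open>W = UNIV\<close> unfolding W_def by blast
  obtain a where a: "\<phi> m - scl a m \<in> S" using decomp by blast
  \<comment> \<open>Since \<phi> commutes with the grading element, \<phi> m is in the kernel of D
    as m is. Its component in S is then in the kernel too and must vanish.\<close>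
  have "D (\<phi> m) = 0" "D m = 0"
    using comm[OF grading_so, of m] by (simp_all add: D_def c lin)
  then have "D (\<phi> m - scl a m) = 0"
    using D(1)[of "\<phi> m - scl a m" "scl a m"] D(2)[of a m] by simp
  with S(3) a have \<phi>m: "\<phi> m = scl a m" by fastforce
  have \<phi>0: "\<phi> 0 = 0" using lin(2)[of 0 0] by simp
  \<comment> \<open>The vectors on which \<phi> agrees with the scalar a form a submodule containing
    the generator m.\<close>
  have "{x. \<phi> x = scl a x} = UNIV"
  proof (rule gen)
    show "subspace {x. \<phi> x = scl a x}"
      by (auto simp: subspace_def lin \<phi>0 scale_right_distrib scale_left_commute)
  qed (auto simp: \<phi>m comm rho_linear_simps)
  then show thesis using that[of a] by blast
qed

end

section \<open>The parameters\<close>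

locale highest_weight_with_basis =
  highest_weight_module scl n \<rho> + so_module_with_basis scl n \<rho> B dual
  for scl :: "complex \<Rightarrow> 'm::ab_group_add \<Rightarrow> 'm" and n \<rho> B dual +
  assumes n_pos: "1 \<le> n"
begin

text \<open>The tensor h \<otimes> (sum of the v_i \<otimes> v_{-i}), that is, the coevaluation
  belonging to the form.\<close>

definition coev :: "'m \<Rightarrow> 'm tensor" where
  "coev h = (\<lambda>u. if u \<in> (\<lambda>i. [i, - i]) ` idx n then h else 0)"

definition contr :: "'m tensor \<Rightarrow> 'm" where
  "contr f = (\<Sum>j\<in>idx n. f [j, - j])"

lemma idx_1: "1 \<in> idx n"
  using n_pos by (simp add: idx_def)

lemma coev_pair: "i \<in> idx n \<Longrightarrow> coev h [i, j] = (if i = - j then h else 0)"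
  by (auto simp: coev_def)

lemma coev_tspace: "coev h \<in> tspace n 2"
  by (auto simp: coev_def tspace_def iwords_def idx_uminus)

lemma coev_inj: "coev h = coev h' \<Longrightarrow> h = h'"
  using coev_pair[OF idx_1, of _ "- 1"] by (metis minus_minus)

lemma coev_linear: "coev (h + h') = coev h + coev h'" "coev (scl c h) = tscale scl c (coev h)"
  by (auto simp: coev_def tscale_def)

lemma contr_linear: "contr (f + g) = contr f + contr g" "contr (tscale scl c f) = scl c (contr f)"
  by (simp_all add: contr_def sum.distrib tscale_def scale_sum_right)

lemma iwords_2:
  assumes "u \<in> iwords n 2"
  obtains i j where "u = [i, j]" "i \<in> idx n" "j \<in> idx n"
  using assms by (auto simp: iwords_def length_Suc_conv numeral_2_eq_2)

lemma e_op_2: "e_op n 2 scl (Suc 0) f = coev (contr f)"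
proof (rule tspace_eqI[OF e_op_tspace coev_tspace])
  fix u assume u: "u \<in> iwords n 2"
  then obtain i j where "u = [i, j]" "i \<in> idx n" by (rule iwords_2)
  with u show "e_op n 2 scl (Suc 0) f u = coev (contr f) u"
    using e_op_at0[of "[]" i j "[]" 2 0 f] by (simp add: coev_pair contr_def)
qed simp

text \<open>Facts about the image of e pass to \<open>coev\<close> in this way. The preimage is h
  \<otimes> v_1 \<otimes> v_{-1}, whose contraction is h.\<close>

lemma coev_e_op: obtains f where "f \<in> tspace n 2" "coev h = e_op n 2 scl (Suc 0) f"
proof -
  define f :: "'m tensor" where "f = (\<lambda>u. if u = [1, - 1] then h else 0)"
  have "f \<in> tspace n 2" using idx_1 by (auto simp: f_def tspace_def iwords_def idx_uminus)
  moreover have "contr f = h" using idx_1 by (simp add: contr_def f_def finite_idx cong: if_cong)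
  ultimately show thesis using that e_op_2 by metis
qed

text \<open>On the image of e the actions in the two copies of V cancel, so only the action on M
  remains.\<close>

lemma g_act_coev:
  assumes "X \<in> so n"
  shows "g_act n 2 scl \<rho> X (coev h) = coev (\<rho> X h)"
proof -
  obtain f where f: "coev h = e_op n 2 scl (Suc 0) f" by (rule coev_e_op)
  have K: "{..2} = {0, Suc 0, Suc (Suc 0)}" by auto
  have "g_act n 2 scl \<rho> X (coev h) = P 2 X 0 (coev h) + (P 2 X (Suc 0) (coev h) + P 2 X (Suc (Suc 0)) (coev h))"
    unfolding g_act_def K by simp
  also have "\<dots> = P 2 X 0 (coev h)"
    unfolding f e_op_pos_antisym(2)[OF assms, of 0 2 f, simplified] by simp
  finally have 1: "g_act n 2 scl \<rho> X (coev h) = P 2 X 0 (coev h)" .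
  show ?thesis
    unfolding 1
  proof (rule tspace_eqI[OF pos_act_tspace[OF assms] coev_tspace])
    fix u assume "u \<in> iwords n 2"
    then show "P 2 X 0 (coev h) u = coev (\<rho> X h) u"
      by (simp add: pos_act_0 coev_def rho_zero[OF assms])
  qed
qed

text \<open>As e is \<open>coev\<close> after \<open>contr\<close>, equivariance of e and of the
  injective map \<open>coev\<close> forces that of \<open>contr\<close>.\<close>

lemma contr_g_act:
  assumes "X \<in> so n"
  shows "contr (g_act n 2 scl \<rho> X f) = \<rho> X (contr f)"
proof (rule coev_inj)
  have "coev (contr (g_act n 2 scl \<rho> X f)) = g_act n 2 scl \<rho> X (coev (contr f))"
    using g_act_commute(3)[OF assms, of 0 2 f] by (simp add: e_op_2)
  then show "coev (contr (g_act n 2 scl \<rho> X f)) = coev (\<rho> X (contr f))"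
    by (simp add: g_act_coev assms)
qed

section \<open>The parameter relation in two and in d tensor factors\<close>

lemma y_op_power_linear:
  assumes "j \<le> d"
  shows "(Y d j ^^ k) (f + g) = (Y d j ^^ k) f + (Y d j ^^ k) g"
    "(Y d j ^^ k) (tscale scl c f) = tscale scl c ((Y d j ^^ k) f)"
  by (induction k) (simp_all add: y_op_add[OF assms])

lemma y_op_power_g_act:
  assumes "X \<in> so n" "j \<le> d"
  shows "(Y d j ^^ k) (g_act n d scl \<rho> X f) = g_act n d scl \<rho> X ((Y d j ^^ k) f)"
  by (induction k) (simp_all add: g_act_commute(1)[OF assms])

lemma y_op_power_tspace: "f \<in> tspace n d \<Longrightarrow> (Y d j ^^ k) f \<in> tspace n d"
  by (induction k) (simp_all add: y_op_tspace)

text \<open>A definite description is evaluated here, so the scalar must also be unique. It is,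
  because the image of e contains the nonzero tensor \<open>coev m\<close>.\<close>

lemma vw_param_2:
  "e_op n 2 scl (Suc 0) ((Y 2 (Suc 0) ^^ k) (e_op n 2 scl (Suc 0) f)) =
    tscale scl (vw_param n scl \<rho> B dual k) (e_op n 2 scl (Suc 0) f)"
proof -
  define \<phi> where "\<phi> h = contr ((Y 2 (Suc 0) ^^ k) (coev h))" for h
  have \<phi>: "\<phi> (x + y) = \<phi> x + \<phi> y" "\<phi> (scl a x) = scl a (\<phi> x)" for x y a
    by (simp_all add: \<phi>_def coev_linear contr_linear y_op_power_linear)
  have \<phi>': "\<phi> (\<rho> X x) = \<rho> X (\<phi> x)" if "X \<in> so n" for X x
    using that by (simp add: \<phi>_def y_op_power_g_act contr_g_act flip: g_act_coev)
  obtain c where c: "\<And>h. \<phi> h = scl c h"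
    using endomorphism_scalar[OF \<phi> \<phi>'] by blast
  have e: "e_op n 2 scl (Suc 0) ((Y 2 (Suc 0) ^^ k) (e_op n 2 scl (Suc 0) f)) =
      tscale scl c (e_op n 2 scl (Suc 0) f)" for f
    using c[of "contr f"] by (simp add: e_op_2 \<phi>_def coev_linear)
  obtain m :: 'm where "m \<noteq> 0" using highest_weight_vector by (elim exE conjE) (rule that)
  obtain f where f: "f \<in> tspace n 2" "coev m = e_op n 2 scl (Suc 0) f" by (rule coev_e_op)
  have "coev m \<noteq> 0" using \<open>m \<noteq> 0\<close> coev_pair[OF idx_1, of m "- 1"] by auto
  have "vw_param n scl \<rho> B dual k = c"
    unfolding vw_param_def One_nat_def
  proof (rule the_equality)
    show "\<forall>f\<in>tspace n 2. e_op n 2 scl (Suc 0) ((Y 2 (Suc 0) ^^ k) (e_op n 2 scl (Suc 0) f)) =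
        tscale scl c (e_op n 2 scl (Suc 0) f)" using e by blast
    fix c' assume "\<forall>f\<in>tspace n 2. e_op n 2 scl (Suc 0) ((Y 2 (Suc 0) ^^ k) (e_op n 2 scl (Suc 0) f)) =
        tscale scl c' (e_op n 2 scl (Suc 0) f)"
    then have "tscale scl c' (coev m) = tscale scl c (coev m)" using e f by metis
    then show "c' = c" using \<open>coev m \<noteq> 0\<close> t.scale_cancel_right by blast
  qed
  with e show ?thesis by simp
qed

text \<open>Fixing the letters w in positions 3, ..., d makes a tensor a family of tensors in M
  \<otimes> V \<otimes> V. As e_1 and y_1 touch only positions 0, 1 and 2, they act on each member
  separately.\<close>

definition restr :: "int list \<Rightarrow> 'm tensor \<Rightarrow> 'm tensor" where
  "restr w f = (\<lambda>v. if v \<in> iwords n 2 then f (v @ w) else 0)"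

lemma restr_tspace: "restr w f \<in> tspace n 2"
  by (simp add: restr_def tspace_def)

lemma restr_linear: "restr w (f + g) = restr w f + restr w g"
  "restr w (tscale scl c f) = tscale scl c (restr w f)" "restr w (sum h S) = (\<Sum>i\<in>S. restr w (h i))"
  by (auto simp: restr_def tscale_def fun_eq_iff sum_tensor_apply)

lemma restr_e_op:
  assumes "w \<in> iwords n (d - 2)" "2 \<le> d"
  shows "restr w (e_op n d scl (Suc 0) f) = e_op n 2 scl (Suc 0) (restr w f)"
proof (rule tspace_eqI[OF restr_tspace e_op_tspace])
  fix u assume u: "u \<in> iwords n 2"
  then obtain i j where u': "u = [i, j]" "i \<in> idx n" "j \<in> idx n" by (rule iwords_2)
  have "i # j # w \<in> iwords n d" "[i, j] \<in> iwords n 2" "\<And>l. l \<in> idx n \<Longrightarrow> [l, - l] \<in> iwords n 2"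
    using assms u' by (auto simp: iwords_def idx_uminus)
  then show "restr w (e_op n d scl (Suc 0) f) u = e_op n 2 scl (Suc 0) (restr w f) u"
    using e_op_at0[of "[]" i j w d 0 f] e_op_at0[of "[]" i j "[]" 2 0 "restr w f"]
    by (simp add: u' restr_def)
qed simp

lemma restr_pos_act:
  assumes "w \<in> iwords n (d - 2)" "2 \<le> d" "X \<in> so n"
  shows "restr w (P d X 0 f) = P 2 X 0 (restr w f)"
    "restr w (P d X (Suc 0) f) = P 2 X (Suc 0) (restr w f)"
proof -
  have "restr w (P d X 0 f) u = P 2 X 0 (restr w f) u \<and>
    restr w (P d X (Suc 0) f) u = P 2 X (Suc 0) (restr w f) u" if u: "u \<in> iwords n 2" for u
  proof -
    from u obtain i j where u': "u = [i, j]" "i \<in> idx n" "j \<in> idx n" by (rule iwords_2)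
    have "i # j # w \<in> iwords n d" "[i, j] \<in> iwords n 2" "\<And>l. l \<in> idx n \<Longrightarrow> [l, j] \<in> iwords n 2"
      using assms u' by (auto simp: iwords_def idx_uminus)
    then show ?thesis
      using pos_act_at0[of "[]" i "j # w" d 0 X f] pos_act_at0[of "[]" i "[j]" 2 0 X "restr w f"]
        pos_act_0[of "i # j # w" d X f] pos_act_0[of "[i, j]" 2 X "restr w f"]
      by (simp add: u' restr_def)
  qed
  then show "restr w (P d X 0 f) = P 2 X 0 (restr w f)"
    "restr w (P d X (Suc 0) f) = P 2 X (Suc 0) (restr w f)"
    by (auto intro!: tspace_eqI[OF restr_tspace pos_act_tspace[OF assms(3)]])
qed

lemma restr_y_op_power:
  assumes "w \<in> iwords n (d - 2)" "2 \<le> d"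
  shows "restr w ((Y d (Suc 0) ^^ k) f) = (Y 2 (Suc 0) ^^ k) (restr w f)"
proof -
  have "restr w (Y d (Suc 0) g) = Y 2 (Suc 0) (restr w g)" for g
    unfolding y_op_def omega_op_def restr_linear sum.lessThan_Suc[of _ 0] lessThan_0 sum.empty add_0_left
    by (intro arg_cong2[where f = "(+)"] sum.cong refl) (simp add: restr_pos_act[OF assms] B_so)
  then show ?thesis by (induction k) simp_all
qed

lemma e_op_y_op_e_op:
  assumes "2 \<le> d"
  shows "e_op n d scl (Suc 0) ((Y d (Suc 0) ^^ k) (e_op n d scl (Suc 0) f)) =
    tscale scl (vw_param n scl \<rho> B dual k) (e_op n d scl (Suc 0) f)"
proof (rule tspace_eqI)
  show "e_op n d scl (Suc 0) ((Y d (Suc 0) ^^ k) (e_op n d scl (Suc 0) f)) \<in> tspace n d"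
    "tscale scl (vw_param n scl \<rho> B dual k) (e_op n d scl (Suc 0) f) \<in> tspace n d"
    using assms by (auto intro!: tspace_scale e_op_tspace)
  fix u assume u: "u \<in> iwords n d"
  with assms have "length u = Suc (Suc (d - 2))" by (simp add: iwords_def)
  then obtain i j w where u': "u = [i, j] @ w" by (auto simp: length_Suc_conv)
  have w: "w \<in> iwords n (d - 2)" and ij: "[i, j] \<in> iwords n 2" using u u' by (auto simp: iwords_def)
  have r: "g u = restr w g [i, j]" for g using ij by (simp add: restr_def u')
  show "e_op n d scl (Suc 0) ((Y d (Suc 0) ^^ k) (e_op n d scl (Suc 0) f)) u =
    tscale scl (vw_param n scl \<rho> B dual k) (e_op n d scl (Suc 0) f) u"
    unfolding r restr_linear restr_e_op[OF w assms] restr_y_op_power[OF w assms] vw_param_2 by (rule refl)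
qed

text \<open>The relation e_a e_a = w_0 e_a concerns every a, but w_0 is defined through e_1. Knowing
  its value makes \<open>e_op_e_op\<close> applicable for all a.\<close>

lemma vw_param_0: "vw_param n scl \<rho> B dual 0 = of_nat (2 * n)"
proof -
  obtain m :: 'm where "m \<noteq> 0" using highest_weight_vector by (elim exE conjE) (rule that)
  obtain f where f: "coev m = e_op n 2 scl (Suc 0) f" by (rule coev_e_op)
  have "coev m \<noteq> 0" using \<open>m \<noteq> 0\<close> coev_pair[OF idx_1, of m "- 1"] by auto
  moreover have "tscale scl (vw_param n scl \<rho> B dual 0) (coev m) = tscale scl (of_nat (2 * n)) (coev m)"
    using vw_param_2[of 0 f] e_op_e_op[of 0 2 f] unfolding f funpow_0 by simp metis
  ultimately show ?thesis using t.scale_cancel_right by blast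
qed

end

section \<open>Evaluation of noncommutative polynomials\<close>

lemma poly_mapping_sum_single:
  "(\<Sum>u\<in>Poly_Mapping.keys p. Poly_Mapping.single u (Poly_Mapping.lookup p u)) = p"
proof (rule poly_mapping_eqI)
  fix v
  have "Poly_Mapping.lookup (\<Sum>u\<in>S. Poly_Mapping.single u (Poly_Mapping.lookup p u)) v =
      (\<Sum>u\<in>S. if u = v then Poly_Mapping.lookup p u else 0)" for S
    by (induction S rule: infinite_finite_induct) (auto simp: lookup_add lookup_single when_def)
  then show "Poly_Mapping.lookup (\<Sum>u\<in>Poly_Mapping.keys p. Poly_Mapping.single u (Poly_Mapping.lookup p u)) v =
      Poly_Mapping.lookup p v"
    by (simp add: in_keys_iff)
qed

text \<open>All assumptions are restricted to T, because the type of coefficient functions is larger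
  than the tensor space.\<close>

locale letter_action = vector_space sc
  for sc :: "complex \<Rightarrow> 'x::ab_group_add \<Rightarrow> 'x" +
  fixes T :: "'x set" and G :: "'g set" and opr :: "'g \<Rightarrow> 'x \<Rightarrow> 'x"
  assumes T: "subspace T"
    and opr_T: "g \<in> G \<Longrightarrow> x \<in> T \<Longrightarrow> opr g x \<in> T"
    and opr_add: "g \<in> G \<Longrightarrow> x \<in> T \<Longrightarrow> y \<in> T \<Longrightarrow> opr g (x + y) = opr g x + opr g y"
    and opr_scale: "g \<in> G \<Longrightarrow> x \<in> T \<Longrightarrow> opr g (sc c x) = sc c (opr g x)"
begin

abbreviation "F \<equiv> carrier (free_alg G)"

text \<open>\<open>fold\<close> applies the first letter first, so concatenation of words becomes
  composition in the opposite order: the free algebra acts from the right.\<close>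

definition ev :: "('g list \<Rightarrow>\<^sub>0 complex) \<Rightarrow> 'x \<Rightarrow> 'x" where
  "ev p x = (\<Sum>u\<in>Poly_Mapping.keys p. sc (Poly_Mapping.lookup p u) (fold opr u x))"

lemma F_iff: "p \<in> F \<longleftrightarrow> (\<forall>u\<in>Poly_Mapping.keys p. set u \<subseteq> G)"
  by (simp add: free_alg_def)

lemma fold_T: "set u \<subseteq> G \<Longrightarrow> x \<in> T \<Longrightarrow> fold opr u x \<in> T"
  by (induction u arbitrary: x) (auto intro: opr_T)

lemma fold_linear:
  assumes "set u \<subseteq> G" "x \<in> T"
  shows "y \<in> T \<Longrightarrow> fold opr u (x + y) = fold opr u x + fold opr u y" "fold opr u (sc c x) = sc c (fold opr u x)"
  using assms by (induction u arbitrary: x y) (auto simp: opr_T opr_add opr_scale)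

lemma fold_sum:
  assumes "set u \<subseteq> G" "\<And>i. i \<in> S \<Longrightarrow> x i \<in> T"
  shows "fold opr u (\<Sum>i\<in>S. sc (c i) (x i)) = (\<Sum>i\<in>S. sc (c i) (fold opr u (x i)))"
proof -
  have z: "fold opr u 0 = 0" using fold_linear(2)[OF assms(1) subspace_0[OF T], of 0] by simp
  show ?thesis
    using assms(2)
  proof (induction S rule: infinite_finite_induct)
    case (insert i S)
    then show ?case
      using subspace_sum[OF T, of S "\<lambda>i. sc (c i) (x i)"] subspace_scale[OF T]
      by (simp add: fold_linear[OF assms(1)])
  qed (simp_all add: z)
qed

lemma ev_superset:
  assumes "finite S" "Poly_Mapping.keys p \<subseteq> S"
  shows "ev p x = (\<Sum>u\<in>S. sc (Poly_Mapping.lookup p u) (fold opr u x))"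
  unfolding ev_def using assms by (intro sum.mono_neutral_left) (auto simp: in_keys_iff)

lemma ev_add: "ev (p + q) x = ev p x + ev q x"
proof -
  let ?S = "Poly_Mapping.keys p \<union> Poly_Mapping.keys q"
  have "finite ?S" "Poly_Mapping.keys (p + q) \<subseteq> ?S" by (auto dest: subsetD[OF Poly_Mapping.keys_add])
  then show ?thesis
    using ev_superset[of ?S p x] ev_superset[of ?S q x] ev_superset[of ?S "p + q" x]
    by (simp add: lookup_add scale_left_distrib sum.distrib)
qed

lemma ev_sum: "ev (sum p S) x = (\<Sum>i\<in>S. ev (p i) x)"
  and ev_diff: "ev (p' - q') x = ev p' x - ev q' x"
  and ev_zero: "ev 0 x = 0"
  and ev_uminus: "ev (- p') x = - ev p' x"
  using additive_sum[of "\<lambda>p. ev p x"] ev_add by blast+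

lemma ev_single: "ev (Poly_Mapping.single u c) x = sc c (fold opr u x)"
  by (cases "c = 0") (simp_all add: ev_def)

lemma ev_one: "ev 1 x = x"
proof -
  have "Poly_Mapping.single ([] :: 'g list) (1 :: complex) = 1" by (metis single_one zero_list_def)
  then show ?thesis using ev_single[of "[]" 1 x] by simp
qed

lemma ev_T:
  assumes "p \<in> F" "x \<in> T"
  shows "ev p x \<in> T"
  unfolding ev_def using assms
  by (intro subspace_sum[OF T] subspace_scale[OF T] fold_T) (auto simp: F_iff)

lemma ev_linear:
  assumes "p \<in> F" "x \<in> T"
  shows "y \<in> T \<Longrightarrow> ev p (x + y) = ev p x + ev p y" "ev p (sc c x) = sc c (ev p x)"
proof -
  have *: "set u \<subseteq> G" if "u \<in> Poly_Mapping.keys p" for u using assms that by (auto simp: F_iff)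
  show "y \<in> T \<Longrightarrow> ev p (x + y) = ev p x + ev p y"
    unfolding ev_def sum.distrib[symmetric]
    by (rule sum.cong[OF refl]) (simp add: fold_linear * assms scale_right_distrib)
  show "ev p (sc c x) = sc c (ev p x)"
    unfolding ev_def scale_sum_right
    by (rule sum.cong[OF refl]) (simp add: fold_linear * assms scale_left_commute)
qed

lemma ev_mult:
  assumes "p \<in> F" "q \<in> F" "x \<in> T"
  shows "ev (p * q) x = ev q (ev p x)"
proof -
  let ?s = "Poly_Mapping.single" and ?l = "Poly_Mapping.lookup"
  have "p * q = (\<Sum>u\<in>Poly_Mapping.keys p. ?s u (?l p u)) * (\<Sum>v\<in>Poly_Mapping.keys q. ?s v (?l q v))"
    by (simp add: poly_mapping_sum_single)
  also have "\<dots> = (\<Sum>v\<in>Poly_Mapping.keys q. \<Sum>u\<in>Poly_Mapping.keys p. ?s (u @ v) (?l p u * ?l q v))"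
    by (simp add: sum_distrib_left sum_distrib_right mult_single plus_list_def)
  finally have "ev (p * q) x = (\<Sum>v\<in>Poly_Mapping.keys q. \<Sum>u\<in>Poly_Mapping.keys p.
      sc (?l p u * ?l q v) (fold opr v (fold opr u x)))"
    by (simp add: ev_sum ev_single)
  also have "\<dots> = (\<Sum>v\<in>Poly_Mapping.keys q. sc (?l q v) (fold opr v (ev p x)))"
  proof (rule sum.cong[OF refl])
    fix v assume v: "v \<in> Poly_Mapping.keys q"
    have "fold opr v (ev p x) = (\<Sum>u\<in>Poly_Mapping.keys p. sc (?l p u) (fold opr v (fold opr u x)))"
      unfolding ev_def by (rule fold_sum) (use assms v in \<open>auto simp: F_iff intro!: fold_T\<close>)
    then show "(\<Sum>u\<in>Poly_Mapping.keys p. sc (?l p u * ?l q v) (fold opr v (fold opr u x))) =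
        sc (?l q v) (fold opr v (ev p x))"
      by (simp add: scale_sum_right mult.commute)
  qed
  finally show ?thesis by (simp add: ev_def)
qed

lemma ev_power: "p \<in> F \<Longrightarrow> x \<in> T \<Longrightarrow> ev (p ^ k) x = (ev p ^^ k) x"
  by (induction k arbitrary: x) (simp_all add: ev_one ev_mult ev_T free_alg_closed' funpow_swap1)

text \<open>With the action of a Lie algebra element as h, this shows that polynomials in
  equivariant operators are equivariant.\<close>

lemma ev_commute:
  assumes "p \<in> F" "x \<in> T" "\<And>g x. g \<in> G \<Longrightarrow> x \<in> T \<Longrightarrow> h (opr g x) = opr g (h x)"
    and "\<And>x y. h (x + y) = h x + h y" "\<And>c x. h (sc c x) = sc c (h x)"
  shows "h (ev p x) = ev p (h x)"
proof -
  have f: "h (fold opr u x) = fold opr u (h x)" if "set u \<subseteq> G" "x \<in> T" for u x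
    using that by (induction u arbitrary: x) (simp_all add: assms(3) opr_T)
  have "h (ev p x) = (\<Sum>u\<in>Poly_Mapping.keys p. sc (Poly_Mapping.lookup p u) (h (fold opr u x)))"
    unfolding ev_def by (simp add: additive_sum(1)[of h, OF assms(4)] assms(5))
  also have "\<dots> = ev p (h x)"
    unfolding ev_def using assms(1,2) by (intro sum.cong refl) (simp add: f F_iff)
  finally show ?thesis .
qed

definition annihilator :: "('g list \<Rightarrow>\<^sub>0 complex) set" where
  "annihilator = {p \<in> F. \<forall>x\<in>T. ev p x = 0}"

text \<open>The product q p acts as zero because \<open>ev q x\<close> stays in T, and p q because
  \<open>ev q\<close> fixes 0. The annihilator therefore contains the ideal generated by the
  relations once it contains the relations.\<close>

lemma annihilator_ideal: "ideal annihilator (free_alg G)"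
proof (rule idealI[OF free_alg_ring])
  interpret R: ring "free_alg G" by (rule free_alg_ring)
  have fa: "x \<oplus>\<^bsub>free_alg G\<^esub> y = x + y" "x \<otimes>\<^bsub>free_alg G\<^esub> y = x * y" "\<zero>\<^bsub>free_alg G\<^esub> = 0" for x y
    by (simp_all add: free_alg_def)
  have z: "ev p 0 = 0" if "p \<in> F" for p using ev_linear(2)[OF that subspace_0[OF T], of 0] by simp
  have inv: "\<ominus>\<^bsub>free_alg G\<^esub> p = - p" if "p \<in> F" for p
  proof -
    have "- p \<in> F" using that by (auto simp: F_iff keys_def)
    then show ?thesis using that by (intro R.minus_equality) (simp_all add: fa)
  qed
  show "subgroup annihilator (add_monoid (free_alg G))"
  proof (rule R.add.subgroupI)
    show "annihilator \<subseteq> F" by (auto simp: annihilator_def)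
    have "0 \<in> annihilator" by (simp add: annihilator_def free_alg_closed ev_zero)
    then show "annihilator \<noteq> {}" by blast
  next
    fix p assume p: "p \<in> annihilator"
    then show "\<ominus>\<^bsub>free_alg G\<^esub> p \<in> annihilator"
      using R.a_inv_closed[of p] by (auto simp: annihilator_def inv ev_uminus)
  qed (auto simp: annihilator_def fa ev_add free_alg_closed)
  fix p q assume "p \<in> annihilator" "q \<in> F"
  then show "q \<otimes>\<^bsub>free_alg G\<^esub> p \<in> annihilator" "p \<otimes>\<^bsub>free_alg G\<^esub> q \<in> annihilator"
    by (auto simp: annihilator_def fa free_alg_closed ev_mult ev_T z)
qed

end

section \<open>Classes in the quotient algebra and their action\<close>

lemma VW_carrier: "carrier (VW d w) = vw_cls d w ` carrier (free_alg (vw_gens d))"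
  by (auto simp: VW_def Let_def FactRing_def A_RCOSETS_def' vw_cls_def)

lemma VW_one: "\<one>\<^bsub>VW d w\<^esub> = vw_cls d w 1"
  by (simp add: VW_def Let_def FactRing_def vw_cls_def) (simp add: free_alg_def)

lemma VW_ops:
  assumes "p \<in> carrier (free_alg (vw_gens d))" "q \<in> carrier (free_alg (vw_gens d))"
  shows "vw_cls d w p \<oplus>\<^bsub>VW d w\<^esub> vw_cls d w q = vw_cls d w (p + q)"
    "vw_cls d w p \<otimes>\<^bsub>VW d w\<^esub> vw_cls d w q = vw_cls d w (p * q)"
    "c \<odot>\<^bsub>VW d w\<^esub> vw_cls d w p = vw_cls d w (fc c * p)"
proof -
  interpret I: ideal "vw_ideal d w" "free_alg (vw_gens d)" by (rule vw_ideal_ideal)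
  have fa: "x \<oplus>\<^bsub>free_alg G\<^esub> y = x + y" "x \<otimes>\<^bsub>free_alg G\<^esub> y = x * y" for x y and G :: "vw_gen set"
    by (simp_all add: free_alg_def)
  show "vw_cls d w p \<oplus>\<^bsub>VW d w\<^esub> vw_cls d w q = vw_cls d w (p + q)"
    using I.a_rcos_sum[OF assms] by (simp add: VW_def Let_def FactRing_def vw_cls_def fa)
  show "vw_cls d w p \<otimes>\<^bsub>VW d w\<^esub> vw_cls d w q = vw_cls d w (p * q)"
    using I.rcoset_mult_add[OF assms] by (simp add: VW_def Let_def FactRing_def vw_cls_def fa)
  show "c \<odot>\<^bsub>VW d w\<^esub> vw_cls d w p = vw_cls d w (fc c * p)"
    using I.rcoset_mult_add[OF free_alg_gens(4) assms(1)]
    by (simp add: VW_def Let_def FactRing_def vw_cls_def fa)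
qed

lemma vw_cls_self: "p \<in> carrier (free_alg (vw_gens d)) \<Longrightarrow> p \<in> vw_cls d w p"
proof -
  interpret I: ideal "vw_ideal d w" "free_alg (vw_gens d)" by (rule vw_ideal_ideal)
  assume "p \<in> carrier (free_alg (vw_gens d))"
  then show ?thesis using I.a_rcos_self by (simp add: vw_cls_def)
qed

lemma vw_cls_mem: "q \<in> vw_cls d w p \<Longrightarrow> \<exists>r\<in>vw_ideal d w. q = r + p"
  by (auto simp: vw_cls_def a_r_coset_def' free_alg_def)

locale vw_letter_action = letter_action sc T "vw_gens d" opr
  for sc :: "complex \<Rightarrow> 'x::ab_group_add \<Rightarrow> 'x" and T d opr +
  fixes w :: "nat \<Rightarrow> complex"
  assumes rel: "vw_rel d w l r \<Longrightarrow> x \<in> T \<Longrightarrow> ev l x = ev r x"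
begin

text \<open>An element of the quotient is a coset, that is, a set of polynomials. Any member may
  serve as representative, since the ideal annihilates T; this is \<open>act_cls\<close>.\<close>

definition act :: "'x \<Rightarrow> vw_free set \<Rightarrow> 'x" where
  "act x A = ev (SOME p. p \<in> A) x"

lemma vw_ideal_annihilator: "vw_ideal d w \<subseteq> annihilator"
proof -
  interpret R: ring "free_alg (vw_gens d)" by (rule free_alg_ring)
  show ?thesis
    unfolding vw_ideal_def
    by (rule R.genideal_minimal[OF annihilator_ideal])
      (auto simp: annihilator_def vw_rel_carrier ev_diff rel)
qed

lemma act_cls:
  assumes "p \<in> F" "x \<in> T"
  shows "act x (vw_cls d w p) = ev p x"
proof -
  have "(SOME q. q \<in> vw_cls d w p) \<in> vw_cls d w p"
    by (rule someI[of "\<lambda>q. q \<in> vw_cls d w p", OF vw_cls_self[OF assms(1)]])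
  then obtain r where "r \<in> vw_ideal d w" "(SOME q. q \<in> vw_cls d w p) = r + p"
    using vw_cls_mem by blast
  with vw_ideal_annihilator assms(2) show ?thesis
    by (auto simp: act_def ev_add annihilator_def)
qed

lemma act_right_action: "right_action (VW d w) T sc act"
proof -
  have m: "act (ev p x) (vw_cls d w q) = ev q (ev p x)" if "p \<in> F" "q \<in> F" "x \<in> T" for p q x
    using that by (simp add: act_cls ev_T)
  have fc: "ev (fc c) x = sc c x" for c x by (simp add: fc_def ev_single)
  show ?thesis
    unfolding right_action_def VW_carrier VW_one
    by (auto simp: act_cls VW_ops free_alg_closed free_alg_gens ev_T ev_linear ev_add ev_mult ev_one m fc
        subspace_add[OF T] subspace_scale[OF T])
qed

text \<open>The generators determine the action of words by the product rule, that of monomials by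
  the scalar rule and that of polynomials by additivity.\<close>

lemma act_unique:
  assumes act': "right_action (VW d w) T sc act'"
    and gens: "\<And>g x. g \<in> vw_gens d \<Longrightarrow> x \<in> T \<Longrightarrow>
      act' x (vw_cls d w (Poly_Mapping.single [g] 1)) = opr g x"
    and "x \<in> T" "p \<in> F"
  shows "act' x (vw_cls d w p) = ev p x"
proof -
  let ?c = "vw_cls d w" and ?s = "Poly_Mapping.single"
  have A: "act' x (?c (p + q)) = act' x (?c p) + act' x (?c q)" "act' x (?c (p * q)) = act' (act' x (?c p)) (?c q)"
    "act' x (?c (fc a * p)) = sc a (act' x (?c p))" "act' x (?c 1) = x"
    if "p \<in> F" "q \<in> F" "x \<in> T" for p q x a
    using act' that unfolding right_action_def VW_carrier VW_one
    by (auto simp flip: VW_ops)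
  have sF: "?s u a \<in> F" if "set u \<subseteq> vw_gens d" for u a using that by (auto simp: F_iff split: if_splits)
  have word: "act' x (?c (?s u 1)) = fold opr u x" if "set u \<subseteq> vw_gens d" "x \<in> T" for u x
    using that
  proof (induction u arbitrary: x)
    case Nil
    have "?s ([] :: vw_gen list) (1 :: complex) = 1" by (simp flip: zero_list_def)
    then show ?case using A(4)[OF sF sF, of "[]" "[]" x] Nil by simp
  next
    case (Cons g u)
    have "?s (g # u) (1 :: complex) = ?s [g] 1 * ?s u 1" by (simp add: mult_single plus_list_def)
    then show ?case
      using Cons A(2)[OF sF sF, of "[g]" u x] by (simp add: gens opr_T)
  qed
  have mono: "act' x (?c (?s u a)) = sc a (fold opr u x)" if "set u \<subseteq> vw_gens d" for u a
  proof -
    have "?s u a = fc a * ?s u 1" by (simp add: fc_def mult_single plus_list_def)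
    then show ?thesis using A(3)[OF sF[OF that] sF[OF that] assms(3)] word[OF that assms(3)] by simp
  qed
  \<comment> \<open>Membership in \<open>F\<close> is part of the induction because additivity on
    classes is available only for polynomials in the generators.\<close>
  have "act' x (?c (\<Sum>u\<in>S. ?s u (a u))) = (\<Sum>u\<in>S. sc (a u) (fold opr u x)) \<and> (\<Sum>u\<in>S. ?s u (a u)) \<in> F"
    if "finite S" "\<And>u. u \<in> S \<Longrightarrow> set u \<subseteq> vw_gens d" for S a
    using that
  proof (induction S rule: finite_induct)
    case empty
    show ?case using mono[of "[]" 0] by (simp add: free_alg_closed)
  next
    case (insert u S)
    then show ?case by (simp add: A(1) sF assms(3) mono free_alg_closed)
  qed
  from this[of "Poly_Mapping.keys p" "Poly_Mapping.lookup p"] assms(4) show ?thesis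
    by (simp add: F_iff poly_mapping_sum_single ev_def)
qed

end

lemma (in so_module) g_act_tspace: "X \<in> so n \<Longrightarrow> g_act n d scl \<rho> X f \<in> tspace n d"
  unfolding g_act_def by (intro tspace_sum pos_act_tspace)

text \<open>In a right action a product acts by its left factor first, which is the multiplication
  of the opposite algebra. The maps are restricted to the tensor space because \<open>g_End\<close>
  consists of extensional functions.\<close>

lemma (in so_module) alg_hom_of_right_action:
  assumes R: "right_action (VW d w) (tspace n d) (tscale scl) act"
    and comm: "\<And>X f a. X \<in> so n \<Longrightarrow> f \<in> tspace n d \<Longrightarrow> a \<in> carrier (VW d w) \<Longrightarrow>
      act (g_act n d scl \<rho> X f) a = g_act n d scl \<rho> X (act f a)"
  shows "(\<lambda>a\<in>carrier (VW d w). \<lambda>f\<in>tspace n d. act f a) \<in> alg_hom (VW d w) (opp_alg (g_End n d scl \<rho>))"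
proof -
  let ?A = "VW d w" and ?T = "tspace n d"
  note D = R[unfolded right_action_def]
  have cl: "a \<otimes>\<^bsub>?A\<^esub> b \<in> carrier ?A" "a \<oplus>\<^bsub>?A\<^esub> b \<in> carrier ?A" "\<one>\<^bsub>?A\<^esub> \<in> carrier ?A" "c \<odot>\<^bsub>?A\<^esub> a \<in> carrier ?A"
    if "a \<in> carrier ?A" "b \<in> carrier ?A" for a b c
    using that by (auto simp: VW_carrier VW_ops VW_one free_alg_closed free_alg_gens)
  have one: "\<one>\<^bsub>?A\<^esub> \<in> carrier ?A" by (auto simp: VW_carrier VW_one free_alg_closed)
  have "(\<lambda>a\<in>carrier ?A. \<lambda>f\<in>?T. act f a) \<in> ring_hom ?A (opp_alg (g_End n d scl \<rho>))"
  proof (rule ring_hom_memI)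
    fix a assume a: "a \<in> carrier ?A"
    show "(\<lambda>a\<in>carrier ?A. \<lambda>f\<in>?T. act f a) a \<in> carrier (opp_alg (g_End n d scl \<rho>))"
      using a D comm g_act_tspace
      by (auto simp: opp_alg_def g_End_def Let_def tspace_closed tspace_scale)
  next
    fix a b assume ab: "a \<in> carrier ?A" "b \<in> carrier ?A"
    show "(\<lambda>a\<in>carrier ?A. \<lambda>f\<in>?T. act f a) (a \<otimes>\<^bsub>?A\<^esub> b) =
      (\<lambda>a\<in>carrier ?A. \<lambda>f\<in>?T. act f a) a \<otimes>\<^bsub>opp_alg (g_End n d scl \<rho>)\<^esub> (\<lambda>a\<in>carrier ?A. \<lambda>f\<in>?T. act f a) b"
      using ab D cl[OF ab] by (auto simp: opp_alg_def g_End_def Let_def compose_def)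
    show "(\<lambda>a\<in>carrier ?A. \<lambda>f\<in>?T. act f a) (a \<oplus>\<^bsub>?A\<^esub> b) =
      (\<lambda>a\<in>carrier ?A. \<lambda>f\<in>?T. act f a) a \<oplus>\<^bsub>opp_alg (g_End n d scl \<rho>)\<^esub> (\<lambda>a\<in>carrier ?A. \<lambda>f\<in>?T. act f a) b"
      using ab D cl[OF ab] by (auto simp: opp_alg_def g_End_def Let_def)
  next
    show "(\<lambda>a\<in>carrier ?A. \<lambda>f\<in>?T. act f a) \<one>\<^bsub>?A\<^esub> = \<one>\<^bsub>opp_alg (g_End n d scl \<rho>)\<^esub>"
      using D one by (auto simp: opp_alg_def g_End_def Let_def)
  qed
  then show ?thesis
    unfolding alg_hom_def using D cl(4) by (auto simp: opp_alg_def g_End_def Let_def)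
qed

section \<open>The action of the affine VW-algebra\<close>

context highest_weight_with_basis
begin

definition gen_op :: "nat \<Rightarrow> vw_gen \<Rightarrow> 'm tensor \<Rightarrow> 'm tensor" where
  "gen_op d g = (case g of gen_s i \<Rightarrow> s_op n d scl i | gen_e i \<Rightarrow> e_op n d scl i | gen_y j \<Rightarrow> Y d j)"

lemma gen_op_cases:
  assumes "g \<in> vw_gens d"
  obtains k where "g = gen_s (Suc k)" "Suc k < d" | k where "g = gen_e (Suc k)" "Suc k < d"
    | j where "g = gen_y j" "1 \<le> j" "j \<le> d"
proof -
  have "\<exists>k. i = Suc k" if "1 \<le> i" for i using that by (cases i) auto
  with assms that show thesis unfolding vw_gens_def by blast
qed

lemma gen_op_letter_action: "letter_action (tscale scl) (tspace n d) (vw_gens d) (gen_op d)"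
proof unfold_locales
  show "t.subspace (tspace n d)"
    by (simp add: t.subspace_def tspace_closed tspace_scale)
  show "gen_op d g f \<in> tspace n d" if "g \<in> vw_gens d" "f \<in> tspace n d" for g f
    using that by (cases rule: gen_op_cases[OF that(1)]) (simp_all add: gen_op_def s_op_tspace e_op_tspace y_op_tspace)
  show "gen_op d g (f + f') = gen_op d g f + gen_op d g f'" if "g \<in> vw_gens d" for g f f'
    by (cases rule: gen_op_cases[OF that]) (simp_all add: gen_op_def s_op_add e_op_add y_op_add)
  show "gen_op d g (tscale scl c f) = tscale scl c (gen_op d g f)" if "g \<in> vw_gens d" for g c f
    by (cases rule: gen_op_cases[OF that]) (simp_all add: gen_op_def s_op_add e_op_add y_op_add)
qed

lemma gen_op_g_act:
  assumes "g \<in> vw_gens d" "X \<in> so n"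
  shows "g_act n d scl \<rho> X (gen_op d g f) = gen_op d g (g_act n d scl \<rho> X f)"
  by (cases rule: gen_op_cases[OF assms(1)]) (simp_all add: gen_op_def g_act_commute[OF assms(2)])

text \<open>The absolute value leaves open which position is smaller, so both orders are reduced to
  \<open>far_comm\<close>.\<close>

lemma far_commute:
  fixes f :: "'m tensor"
  assumes "1 \<le> a" "a < d" "1 \<le> b" "b < d" "\<bar>int a - int b\<bar> > 1"
  shows "s_op n d scl a (s_op n d scl b f) = s_op n d scl b (s_op n d scl a f)"
    "s_op n d scl a (e_op n d scl b f) = e_op n d scl b (s_op n d scl a f)"
    "e_op n d scl a (e_op n d scl b f) = e_op n d scl b (e_op n d scl a f)"
proof -
  obtain k l where kl: "a = Suc k" "b = Suc l" using assms(1,3) by (metis Suc_le_D One_nat_def)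
  consider "Suc k < l" | "Suc l < k" using assms(5) kl by linarith
  then have "s_op n d scl a (s_op n d scl b f) = s_op n d scl b (s_op n d scl a f) \<and>
    s_op n d scl a (e_op n d scl b f) = e_op n d scl b (s_op n d scl a f) \<and>
    e_op n d scl a (e_op n d scl b f) = e_op n d scl b (e_op n d scl a f)"
  proof cases
    case 1
    show ?thesis using far_comm(1,2,4)[OF 1, of d f] assms(4) by (simp add: kl)
  next
    case 2
    show ?thesis using far_comm(1,3,4)[OF 2, of d f] assms(2) by (simp add: kl)
  qed
  then show "s_op n d scl a (s_op n d scl b f) = s_op n d scl b (s_op n d scl a f)"
    "s_op n d scl a (e_op n d scl b f) = e_op n d scl b (s_op n d scl a f)"
    "e_op n d scl a (e_op n d scl b f) = e_op n d scl b (e_op n d scl a f)" by blast+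
qed

lemma vw_letter_action_gen_op:
  "vw_letter_action (tscale scl) (tspace n d) d (gen_op d) (vw_param n scl \<rho> B dual)"
proof -
  interpret letter_action "tscale scl" "tspace n d" "vw_gens d" "gen_op d"
    by (rule gen_op_letter_action)
  have ev_gen: "ev (fs i) f = s_op n d scl i f" "ev (fe i) f = e_op n d scl i f"
    "ev (fy i) f = Y d i f" "ev (fc c) f = tscale scl c f" for i c f
    by (simp_all add: fs_def fe_def fy_def fc_def ev_single gen_op_def)
  have closed: "1 \<le> i \<Longrightarrow> i < d \<Longrightarrow> f \<in> tspace n d \<Longrightarrow> s_op n d scl i f \<in> tspace n d"
    "1 \<le> i \<Longrightarrow> i < d \<Longrightarrow> f \<in> tspace n d \<Longrightarrow> e_op n d scl i f \<in> tspace n d" for i f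
    by (cases i; simp add: s_op_tspace e_op_tspace)+
  note ev_simps = ev_gen ev_mult ev_add ev_diff ev_one ev_zero free_alg_gens free_alg_closed free_alg_closed'
    closed y_op_tspace tspace_closed tspace_scale
  show ?thesis
  proof unfold_locales
    fix l r :: vw_free and f :: "'m tensor" assume f: "f \<in> tspace n d" and rel: "vw_rel d (vw_param n scl \<rho> B dual) l r"
    \<comment> \<open>Each relation is matched with the operator identity in reversed order:
      \<open>e_s\<close> with \<open>s_op_e_op\<close>, and \<open>e_antisym\<close> with the second
      part of \<open>y_op_antisym\<close>.\<close>
    from rel show "ev l f = ev r f"
    proof cases
      case (s_sq a)
      then show ?thesis using f s_op_s_op[of "a - 1" d f] by (simp add: ev_simps)
    next
      case (s_comm a b)
      with f show ?thesis by (simp add: ev_simps far_commute(1)[of a d b])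
    next
      case (s_braid c)
      with f show ?thesis using s_op_braid[of "c - 1" d f] by (simp add: ev_simps)
    next
      case (s_y a i)
      with f show ?thesis using y_op_far(1)[of "a - 1" d i f] by (simp add: ev_simps)
    next
      case (e_sq a)
      with f show ?thesis using e_op_e_op[of "a - 1" d f] e_op_add(2)[of "a - 1" d _ f]
        by (simp add: ev_simps vw_param_0)
    next
      case (e_y_e k)
      with f have "ev (fy 1 ^ k) g = (Y d (Suc 0) ^^ k) g" if "g \<in> tspace n d" for g
        using that by (simp add: ev_power free_alg_gens ev_gen(3)[abs_def])
      \<comment> \<open>In \<open>fc c * fe 1\<close> the scalar acts before e, so homogeneity of e
        moves it outside.\<close>
      with e_y_e f show ?thesis
        using e_op_y_op_e_op[of d k f] e_op_add(2)[of 0 d _ f]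
        by (simp add: ev_simps y_op_power_tspace)
    next
      case (s_e_comm a b)
      with f show ?thesis by (simp add: ev_simps far_commute(2)[of a d b])
    next
      case (e_comm a b)
      with f show ?thesis by (simp add: ev_simps far_commute(3)[of a d b])
    next
      case (e_y a i)
      with f show ?thesis using y_op_far(2)[of "a - 1" d i f] by (simp add: ev_simps)
    next
      case (y_comm i j)
      with f show ?thesis by (simp add: ev_simps y_op_comm)
    next
      case (e_s a)
      with f show ?thesis using s_op_e_op[of "a - 1" d f] by (simp add: ev_simps)
    next
      case (s_e a)
      with f show ?thesis using e_op_s_op[of "a - 1" d f] by (simp add: ev_simps)
    next
      case (s_e_e c)
      with f show ?thesis using brauer_relations(1)[of "c - 1" d f] by (simp add: ev_simps)
    next
      case (e_e_s c)
      with f show ?thesis using brauer_relations(2)[of "c - 1" d f] by (simp add: ev_simps)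
    next
      case (e_e_s' c)
      with f show ?thesis using brauer_relations(3)[of "c - 1" d f] by (simp add: ev_simps)
    next
      case (s_e_e' c)
      with f show ?thesis using brauer_relations(4)[of "c - 1" d f] by (simp add: ev_simps)
    next
      case (e_e_e c)
      with f show ?thesis using brauer_relations(5)[of "c - 1" d f] by (simp add: ev_simps)
    next
      case (e_e_e' c)
      with f show ?thesis using brauer_relations(6)[of "c - 1" d f] by (simp add: ev_simps)
    next
      case (s_y_skein a)
      with f show ?thesis using y_op_skein(1)[of "a - 1" d f] by (simp add: ev_simps)
    next
      case (y_s_skein a)
      with f show ?thesis using y_op_skein(2)[of "a - 1" d f] by (simp add: ev_simps)
    next
      case (e_antisym a)
      with f show ?thesis using y_op_antisym(2)[of "a - 1" d f] by (simp add: ev_simps)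
    next
      case (e_antisym' a)
      with f show ?thesis using y_op_antisym(1)[of "a - 1" d f] e_op_add(1)[of "a - 1" d] by (simp add: ev_simps)
    qed
  qed
qed

end

theorem theoremA:
  fixes n d :: nat
    and scl :: "complex \<Rightarrow> 'm::ab_group_add \<Rightarrow> 'm"
    and \<rho> :: "mat \<Rightarrow> 'm \<Rightarrow> 'm"
    and B :: "mat set" and dual :: "mat \<Rightarrow> mat"
  assumes "n \<ge> 4" and "d \<ge> 1"
    and "highest_weight_module scl n \<rho>"
    and "basis_with_dual n B dual"
  shows "let w = vw_param n scl \<rho> B dual;
             A = VW d w;
             T = tspace n d;
             gens = (\<lambda>act. \<forall>f\<in>T.
               (\<forall>i. 1 \<le> i \<and> i < d \<longrightarrow> act f (vw_cls d w (fs i)) = s_op n d scl i f) \<and>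
               (\<forall>i. 1 \<le> i \<and> i < d \<longrightarrow> act f (vw_cls d w (fe i)) = e_op n d scl i f) \<and>
               (\<forall>j. 1 \<le> j \<and> j \<le> d \<longrightarrow> act f (vw_cls d w (fy j)) = y_op n d scl \<rho> B dual j f))
         in \<exists>act. right_action A T (tscale scl) act \<and> gens act \<and>
              (\<forall>act'. right_action A T (tscale scl) act' \<and> gens act' \<longrightarrow>
                 (\<forall>f\<in>T. \<forall>a\<in>carrier A. act' f a = act f a)) \<and>
              (\<lambda>a\<in>carrier A. \<lambda>f\<in>T. act f a) \<in> alg_hom A (opp_alg (g_End n d scl \<rho>))"
proof -
  interpret highest_weight_module scl n \<rho> by fact
  interpret highest_weight_with_basis scl n \<rho> B dual
    by unfold_locales (use assms in auto)
  define w where "w = vw_param n scl \<rho> B dual"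
  interpret A: vw_letter_action "tscale scl" "tspace n d" d "gen_op d" w
    unfolding w_def by (rule vw_letter_action_gen_op)
  have gens: "A.act f (vw_cls d w (Poly_Mapping.single [g] 1)) = gen_op d g f"
    if "g \<in> vw_gens d" "f \<in> tspace n d" for g f
    using that by (subst A.act_cls) (auto simp: A.ev_single A.F_iff)
  have unique: "act' f a = A.act f a"
    if "right_action (VW d w) (tspace n d) (tscale scl) act'"
      "\<And>g f. g \<in> vw_gens d \<Longrightarrow> f \<in> tspace n d \<Longrightarrow>
        act' f (vw_cls d w (Poly_Mapping.single [g] 1)) = gen_op d g f"
      "f \<in> tspace n d" "a \<in> carrier (VW d w)" for act' f a
    using that A.act_unique[OF that(1,2,3)] A.act_cls by (auto simp: VW_carrier)
  have comm: "A.act (g_act n d scl \<rho> X f) a = g_act n d scl \<rho> X (A.act f a)"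
    if X: "X \<in> so n" and f: "f \<in> tspace n d" and a: "a \<in> carrier (VW d w)" for X f a
  proof -
    obtain p where p: "p \<in> A.F" "a = vw_cls d w p" using a by (auto simp: VW_carrier)
    have lin: "g_act n d scl \<rho> X (g + h) = g_act n d scl \<rho> X g + g_act n d scl \<rho> X h"
      "g_act n d scl \<rho> X (tscale scl c g) = tscale scl c (g_act n d scl \<rho> X g)" for g h c
      using X by (simp_all add: g_act_def pos_act_add sum.distrib t.scale_sum_right)
    show ?thesis
      using A.ev_commute[OF p(1) f gen_op_g_act[OF _ X] lin] f X p
      by (simp add: A.act_cls g_act_tspace)
  qed
  \<comment> \<open>The three families of conditions amount to one condition on letters, the form in
    which existence and uniqueness are available.\<close>
  have gen_iff: "(\<forall>f\<in>tspace n d.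
      (\<forall>i. 1 \<le> i \<and> i < d \<longrightarrow> act f (vw_cls d w (fs i)) = s_op n d scl i f) \<and>
      (\<forall>i. 1 \<le> i \<and> i < d \<longrightarrow> act f (vw_cls d w (fe i)) = e_op n d scl i f) \<and>
      (\<forall>j. 1 \<le> j \<and> j \<le> d \<longrightarrow> act f (vw_cls d w (fy j)) = y_op n d scl \<rho> B dual j f)) \<longleftrightarrow>
    (\<forall>g\<in>vw_gens d. \<forall>f\<in>tspace n d. act f (vw_cls d w (Poly_Mapping.single [g] 1)) = gen_op d g f)" for act
    unfolding vw_gens_def by (auto simp: gen_op_def fs_def fe_def fy_def)
  show ?thesis
    unfolding Let_def w_def[symmetric] gen_iff
  proof (rule exI[of _ A.act], intro conjI)
    show "right_action (VW d w) (tspace n d) (tscale scl) A.act" by (rule A.act_right_action)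
    show "\<forall>g\<in>vw_gens d. \<forall>f\<in>tspace n d.
        A.act f (vw_cls d w (Poly_Mapping.single [g] 1)) = gen_op d g f"
      by (intro ballI gens)
    show "\<forall>act'. right_action (VW d w) (tspace n d) (tscale scl) act' \<and>
        (\<forall>g\<in>vw_gens d. \<forall>f\<in>tspace n d.
          act' f (vw_cls d w (Poly_Mapping.single [g] 1)) = gen_op d g f) \<longrightarrow>
        (\<forall>f\<in>tspace n d. \<forall>a\<in>carrier (VW d w). act' f a = A.act f a)"
      by (intro allI impI ballI, elim conjE) (rule unique; simp)
    show "(\<lambda>a\<in>carrier (VW d w). \<lambda>f\<in>tspace n d. A.act f a) \<in>
        alg_hom (VW d w) (opp_alg (g_End n d scl \<rho>))"
      by (rule alg_hom_of_right_action[OF A.act_right_action comm])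
  qed
qed

end
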